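(* Let $K$ be a knot in the $3$-sphere $S^3$ with exterior $E(K)$, and let $G(K)=\pi_1(E(K))$ be its knot group. Then $G(K)$ is an $R$-group if and only if $G(K)$ is an $\bar{R}$-group. That is, for knot groups, the two classes of $R$-groups and $\bar{R}$-groups coincide.
   Context: The knot group of a knot $K\subset S^3$ is $G(K)=\pi_1(E(K))$, where the exterior $E(K)$ is the complement of an open tubular neighborhood of $K$. A group $G$ is an $R$-group if it has the unique root property: for any $x,y\in G$, an equation $x^n=y^n$ for some non-zero integer $n$ implies $x=y$. For $x$ in a group $G$, the isolator subset of the cyclic group $\langle x\rangle$ is $I\langle x\rangle=\{g\in G\mid g^n\in\langle x\rangle \text{ for some positive integer } n\}$. A group $G$ is an $\bar{R}$-group if $G$ is torsion-free and, for every $x\in G$, the normalizer and the centralizer in $G$ of the subset $I\langle x\rangle$ coincide. (The paper uses throughout the following characterization by Fay and Walls: $G$ is an $\bar{R}$-group if and only if $G$ is an $R$-group and, for all $x,y\in G$ with $y\neq 1$ and all $m,n\in\mathbb{Z}$, the relation $x^{-1}y^mx=y^n$ implies $m=n$.) *)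

theory Defs
  imports
    "HOL-Analysis.Analysis"
    "HOL-Algebra.Group_Action"
    "HOL-Algebra.Generated_Groups"
begin

section \<open>The fundamental group\<close>

definition loops_at :: "'a::topological_space set \<Rightarrow> 'a \<Rightarrow> (real \<Rightarrow> 'a) set" where
  "loops_at X x = {p. path p \<and> path_image p \<subseteq> X \<and> pathstart p = x \<and> pathfinish p = x}"

definition fundamental_group :: "'a::real_normed_vector set \<Rightarrow> 'a \<Rightarrow> (real \<Rightarrow> 'a) set monoid" where
  "fundamental_group X x =
     \<lparr>carrier = loops_at X x // {(p, q). homotopic_paths X p q},
      mult = (\<lambda>A B. {r. \<exists>p\<in>A. \<exists>q\<in>B. homotopic_paths X (p +++ q) r}),
      one = {r. homotopic_paths X (linepath x x) r}\<rparr>"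

lemma carrier_fundamental_group:
  "carrier (fundamental_group X x) = (\<lambda>p. Collect (homotopic_paths X p)) ` loops_at X x"
  by (auto simp: fundamental_group_def quotient_def)

lemma homotopic_class_eq_iff:
  assumes "p \<in> loops_at X x"
  shows "Collect (homotopic_paths X p) = Collect (homotopic_paths X q) \<longleftrightarrow> homotopic_paths X p q"
  using assms unfolding loops_at_def
  by (auto simp: set_eq_iff intro: homotopic_paths_trans homotopic_paths_sym)

lemma mult_fundamental_group:
  assumes "p \<in> loops_at X x" "q \<in> loops_at X x"
  shows "Collect (homotopic_paths X p) \<otimes>\<^bsub>fundamental_group X x\<^esub> Collect (homotopic_paths X q)
           = Collect (homotopic_paths X (p +++ q))"
proof -
  have "homotopic_paths X (p +++ q) r"
    if "homotopic_paths X p p'" "homotopic_paths X q q'" "homotopic_paths X (p' +++ q') r" for p' q' r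
    using that assms
    by (intro homotopic_paths_trans[OF homotopic_paths_join that(3)]) (auto simp: loops_at_def)
  moreover have "p \<in> Collect (homotopic_paths X p)" "q \<in> Collect (homotopic_paths X q)"
    using assms by (auto simp: loops_at_def)
  ultimately show ?thesis
    unfolding fundamental_group_def monoid.simps set_eq_iff mem_Collect_eq by blast
qed

lemma group_fundamental_group:
  assumes "x \<in> X"
  shows "group (fundamental_group X x)"
proof -
  let ?G = "fundamental_group X x" and ?c = "\<lambda>p. Collect (homotopic_paths X p)"
  have join: "p +++ q \<in> loops_at X x" if "p \<in> loops_at X x" "q \<in> loops_at X x" for p q
    using that by (auto simp: loops_at_def path_image_join)
  have const: "linepath x x \<in> loops_at X x"
    using assms by (auto simp: loops_at_def)
  have rev: "reversepath p \<in> loops_at X x" if "p \<in> loops_at X x" for p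
    using that by (auto simp: loops_at_def)
  have one: "\<one>\<^bsub>?G\<^esub> = ?c (linepath x x)"
    by (simp add: fundamental_group_def)
  show ?thesis
  proof (rule groupI)
    fix A B assume "A \<in> carrier ?G" "B \<in> carrier ?G"
    then show "A \<otimes>\<^bsub>?G\<^esub> B \<in> carrier ?G"
      using join by (auto simp: carrier_fundamental_group mult_fundamental_group)
  next
    show "\<one>\<^bsub>?G\<^esub> \<in> carrier ?G"
      using const by (auto simp: one carrier_fundamental_group)
  next
    fix A B C assume "A \<in> carrier ?G" "B \<in> carrier ?G" "C \<in> carrier ?G"
    then obtain p q r where pqr: "p \<in> loops_at X x" "q \<in> loops_at X x" "r \<in> loops_at X x"
      and eq: "A = ?c p" "B = ?c q" "C = ?c r"
      by (auto simp: carrier_fundamental_group)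
    have "homotopic_paths X ((p +++ q) +++ r) (p +++ (q +++ r))"
      using pqr by (intro homotopic_paths_sym[OF homotopic_paths_assoc]) (auto simp: loops_at_def)
    then show "A \<otimes>\<^bsub>?G\<^esub> B \<otimes>\<^bsub>?G\<^esub> C = A \<otimes>\<^bsub>?G\<^esub> (B \<otimes>\<^bsub>?G\<^esub> C)"
      using pqr join
      by (simp add: eq mult_fundamental_group homotopic_class_eq_iff[where x = x])
  next
    fix A assume "A \<in> carrier ?G"
    then obtain p where p: "p \<in> loops_at X x" and eq: "A = ?c p"
      by (auto simp: carrier_fundamental_group)
    have "homotopic_paths X (linepath x x +++ p) p"
      using p by (intro homotopic_paths_lid') (auto simp: loops_at_def)
    then show "\<one>\<^bsub>?G\<^esub> \<otimes>\<^bsub>?G\<^esub> A = A"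
      using p const join
      by (simp add: eq one mult_fundamental_group homotopic_class_eq_iff[where x = x])
    have "homotopic_paths X (reversepath p +++ p) (linepath x x)"
      using p homotopic_paths_linv[of p X] by (auto simp: loops_at_def)
    then have "?c (reversepath p) \<otimes>\<^bsub>?G\<^esub> A = \<one>\<^bsub>?G\<^esub>"
      using p rev join
      by (simp add: eq one mult_fundamental_group homotopic_class_eq_iff[where x = x])
    then show "\<exists>B\<in>carrier ?G. B \<otimes>\<^bsub>?G\<^esub> A = \<one>\<^bsub>?G\<^esub>"
      using rev[OF p] by (auto simp: carrier_fundamental_group)
  qed
qed

section \<open>Knots in the 3-sphere\<close>

abbreviation S1 :: "complex set" where
  "S1 \<equiv> sphere 0 1"

abbreviation S3 :: "(real ^ 4) set" where
  "S3 \<equiv> sphere 0 1"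

definition knot :: "(real ^ 4) set \<Rightarrow> bool" where
  "knot K \<longleftrightarrow> K \<subseteq> S3 \<and> K homeomorphic S1"

text \<open>
  The normal bundle of a knot in the orientable manifold \<open>S3\<close> is trivial, so a tubular neighborhood
  is an embedding \<open>h\<close> of the plane bundle \<open>S1 \<times> \<complex>\<close> with zero section \<open>K\<close>, and the open tubular
  neighborhood \<open>N\<close> is the image of the open unit disc bundle. Since \<open>h\<close> is defined beyond the closed
  disc bundle, the frontier torus of \<open>N\<close> is bicollared, hence \<open>S3 - N\<close> is a compact manifold with
  torus boundary. Wild knots have no such neighborhood; the knots that have one are exactly the tame
  ones.
\<close>

definition open_tubular_neighborhood :: "(real ^ 4) set \<Rightarrow> (real ^ 4) set \<Rightarrow> bool" where
  "open_tubular_neighborhood K N \<longleftrightarrow>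
     (\<exists>h h' V. V \<subseteq> S3 \<and> homeomorphism (S1 \<times> (UNIV :: complex set)) V h h' \<and>
        h ` (S1 \<times> {0}) = K \<and> h ` (S1 \<times> ball 0 1) = N)"

definition is_exterior :: "(real ^ 4) set \<Rightarrow> (real ^ 4) set \<Rightarrow> bool" where
  "is_exterior E K \<longleftrightarrow> (\<exists>N. open_tubular_neighborhood K N \<and> E = S3 - N)"

section \<open>Groups with unique roots\<close>

definition R_group :: "('a, 'b) monoid_scheme \<Rightarrow> bool" where
  "R_group G \<longleftrightarrow> group G \<and>
     (\<forall>x\<in>carrier G. \<forall>y\<in>carrier G. \<forall>n::int.
        n \<noteq> 0 \<longrightarrow> x [^]\<^bsub>G\<^esub> n = y [^]\<^bsub>G\<^esub> n \<longrightarrow> x = y)"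

definition torsion_free :: "('a, 'b) monoid_scheme \<Rightarrow> bool" where
  "torsion_free G \<longleftrightarrow>
     (\<forall>x\<in>carrier G. \<forall>n::nat. n > 0 \<longrightarrow> x [^]\<^bsub>G\<^esub> n = \<one>\<^bsub>G\<^esub> \<longrightarrow> x = \<one>\<^bsub>G\<^esub>)"

definition isolator :: "('a, 'b) monoid_scheme \<Rightarrow> 'a \<Rightarrow> 'a set" where
  "isolator G x = {g \<in> carrier G. \<exists>n::nat. n > 0 \<and> g [^]\<^bsub>G\<^esub> n \<in> generate G {x}}"

definition centralizer :: "('a, 'b) monoid_scheme \<Rightarrow> 'a set \<Rightarrow> 'a set" where
  "centralizer G A = {g \<in> carrier G. \<forall>a\<in>A. g \<otimes>\<^bsub>G\<^esub> a = a \<otimes>\<^bsub>G\<^esub> g}"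

definition Rbar_group :: "('a, 'b) monoid_scheme \<Rightarrow> bool" where
  "Rbar_group G \<longleftrightarrow> group G \<and> torsion_free G \<and>
     (\<forall>x\<in>carrier G. normalizer G (isolator G x) = centralizer G (isolator G x))"

text \<open>The isolator need not be a subgroup, and the library's \<open>normalizer\<close> does not require one.\<close>

lemma (in group) normalizer_isolator:
  "normalizer G (isolator G x) =
     {g \<in> carrier G. (\<lambda>a. g \<otimes> a \<otimes> inv g) ` isolator G x = isolator G x}"
proof -
  have "isolator G x \<subseteq> carrier G"
    by (auto simp: isolator_def)
  moreover have "g <# A #> inv g = (\<lambda>a. g \<otimes> a \<otimes> inv g) ` A" for g A
    by (auto simp: l_coset_def r_coset_def)
  ultimately show ?thesis
    by (simp add: normalizer_def stabilizer_def)
qed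

end

(*
  Suppose that G = G(K) is an R-group but not an Rbar-group. The Fay-Walls criterion gives a relation
  t y^m t^-1 = y^n with 0 < m < n; put mu = n/m. The isolator A of y is then abelian of rank one, so
  H = A<t> carries a homomorphism kappa : H -> Z with kernel A and a map v : H -> R with
  v(gh) = v g + mu^(kappa g) v h.

  The exterior is a retract of an open subset of R^3 (stereographic projection), so a fine cubical lattice
  near it has a covering with group G whose loops bound. Summing over H, with weights mu^kappa, a
  2-chain that bounds the relator gives a 2-cycle, or dually a closed function Z on the edges of the
  covering. Since the covering is simply connected, Z is the gradient of a function f, and since
  mu^2 <> 1 the constant can be chosen such that f(h x) = mu^(-kappa h) f(x).
  Truncating f to the fundamental domain 1 <= |f| < mu of multiplication by mu shows that Z is already
  the sum of the translates by powers of t of a cycle on the quotient by A, on which kappa is a function.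
  Hence the cocycle kappa(g) v(h) pairs to zero with Z. On the relator, however, it evaluates to n.
*)

theory Submission
  imports Defs
begin

section \<open>Lattice words and lattice coverings\<close>

text \<open>The obstacle is that \<open>\<theta>\<close> is K dp, and \<open>K\<close> is not a
  function on the quotient by \<open>H\<close>: translation by \<open>t\<close> adds a multiple of
  dp. So \<open>\<theta>\<close> cannot be paired directly with the twisted cycle there. On the
  quotient by the kernel of \<open>\<kappa>\<close> it is an invariant cochain, but lifting
  \<open>Z\<close> to that quotient destroys the finiteness of its support, and with it summation by
  parts. Truncation is the remedy: the gradient of the truncated potential is still closed and has
  finite support modulo the kernel, while the exact scaling of the potential recovers
  \<open>Z\<close> from it. Three dimensions enter through duality: squares are dual to edges, so a
  2-cycle becomes a closed 1-cochain and can have a potential. Duality also inverts the weight,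
  which is why \<mu>^2 and not \<mu> decides. A second obstacle: a filling of a loop may leave the
  neighbourhood of the exterior in which the loop runs. So the relator, its filling, the potential
  and the fillings behind its path independence need four regions of increasing size.\<close>

abbreviation unit_vec :: "3 \<Rightarrow> int^3" where
  "unit_vec i \<equiv> axis i 1"

type_synonym lattice_word = "(3 \<times> bool) list"

definition step_vec :: "3 \<times> bool \<Rightarrow> int^3" where
  "step_vec s = (if snd s then unit_vec (fst s) else - unit_vec (fst s))"

fun stays :: "(int^3) set \<Rightarrow> int^3 \<Rightarrow> lattice_word \<Rightarrow> bool" where
  "stays P q [] \<longleftrightarrow> q \<in> P"
| "stays P q (s # w) \<longleftrightarrow> q \<in> P \<and> stays P (q + step_vec s) w"

definition displacement :: "lattice_word \<Rightarrow> int^3" where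
  "displacement w = sum_list (map step_vec w)"

definition word_inv :: "lattice_word \<Rightarrow> lattice_word" where
  "word_inv w = rev (map (\<lambda>(i, b). (i, \<not> b)) w)"

text \<open>A square is named by its normal direction. Arithmetic in type \<open>3\<close> is
  cyclic, so \<open>k+1\<close>, \<open>k+2\<close> is the positively oriented pair of edge
  directions and one formula serves all three orientations.\<close>

definition square_in :: "(int^3) set \<Rightarrow> 3 \<Rightarrow> int^3 \<Rightarrow> bool" where
  "square_in Q k q \<longleftrightarrow> q \<in> Q \<and> q + unit_vec (k+1) \<in> Q \<and> q + unit_vec (k+2) \<in> Q
     \<and> q + unit_vec (k+1) + unit_vec (k+2) \<in> Q"

lemma axes_mod_3:
  fixes i :: 3
  shows "i + 1 + 1 = i + 2" "i + 1 + 2 = i" "i + 2 + 1 = i" "i + 2 + 2 = i + 1"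
    "i \<noteq> i + 1" "i \<noteq> i + 2" "i + 1 \<noteq> i" "i + 2 \<noteq> i" "i + 1 \<noteq> i + 2" "i + 2 \<noteq> i + 1"
  by (simp_all add: add.assoc)

lemma sum_axes: "(\<Sum>i\<in>UNIV. f i) = f k + f (k+1) + f (k+2)" for f :: "3 \<Rightarrow> real"
proof -
  have "(UNIV :: 3 set) = {k, k+1, k+2}"
    by (rule card_seteq[symmetric]) (simp_all add: axes_mod_3)
  then have "(\<Sum>i\<in>UNIV. f i) = (\<Sum>i\<in>{k, k+1, k+2}. f i)"
    by (rule arg_cong)
  then show ?thesis by (simp add: axes_mod_3)
qed

lemma stays_start: "stays P q w \<Longrightarrow> q \<in> P"
  by (cases w) auto

lemma stays_append: "stays P q (u @ w) \<longleftrightarrow> stays P q u \<and> stays P (q + displacement u) w"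
  by (induction u arbitrary: q) (auto simp: displacement_def algebra_simps dest: stays_start)

lemma stays_mono: "stays P q w \<Longrightarrow> P \<subseteq> Q \<Longrightarrow> stays Q q w"
  by (induction w arbitrary: q) auto

lemma word_inv_simps [simp]:
  "word_inv [] = []" "word_inv (s # w) = word_inv w @ [(fst s, \<not> snd s)]"
  by (auto simp: word_inv_def split: prod.split)

lemma displacement_simps [simp]:
  "displacement [] = 0" "displacement (s # w) = step_vec s + displacement w"
  "displacement (u @ w) = displacement u + displacement w"
  by (simp_all add: displacement_def)

lemma displacement_word_inv [simp]: "displacement (word_inv w) = - displacement w"
  by (induction w) (auto simp: step_vec_def)

lemma stays_word_inv: "stays P q w \<Longrightarrow> stays P (q + displacement w) (word_inv w)"
proof (induction w arbitrary: q)
  case (Cons s w)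
  have "stays P (q + step_vec s + displacement w) (word_inv w)"
    using Cons by simp
  then show ?case
    using Cons.prems by (auto simp: stays_append algebra_simps step_vec_def dest: stays_start)
qed simp

lemma stays_end: "stays P q w \<Longrightarrow> q + displacement w \<in> P"
  by (metis append_Nil2 stays_append stays_start)

section \<open>Cochains on the covering defined by group labels on the lattice edges\<close>

type_synonym 'g vertex = "(int^3) \<times> 'g"
type_synonym 'g cochain = "3 \<Rightarrow> 'g vertex \<Rightarrow> real"

locale lattice_cover = group G for G :: "('g, 'm) monoid_scheme" (structure) +
  fixes l :: "3 \<Rightarrow> int^3 \<Rightarrow> 'g"
  assumes l_closed [simp]: "l i q \<in> carrier G"
begin

text \<open>The vertices lie over the whole lattice; regions enter only through \<open>stays\<close>
  and \<open>square_in\<close>. This keeps \<open>fwd\<close>, \<open>bwd\<close> and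
  \<open>shift\<close> total.\<close>

definition X :: "'g vertex set" where
  "X = {x. snd x \<in> carrier G}"

definition base :: "'g vertex" where
  "base = (0, \<one>)"

definition fwd :: "3 \<Rightarrow> 'g vertex \<Rightarrow> 'g vertex" where
  "fwd i x = (fst x + unit_vec i, snd x \<otimes> l i (fst x))"

definition bwd :: "3 \<Rightarrow> 'g vertex \<Rightarrow> 'g vertex" where
  "bwd i x = (fst x - unit_vec i, snd x \<otimes> inv (l i (fst x - unit_vec i)))"

text \<open>Deck transformations multiply on the left while edges multiply on the right, so the two
  commute by associativity.\<close>

definition shift :: "'g \<Rightarrow> 'g vertex \<Rightarrow> 'g vertex" where
  "shift h x = (fst x, h \<otimes> snd x)"

definition move :: "3 \<times> bool \<Rightarrow> 'g vertex \<Rightarrow> 'g vertex" where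
  "move s x = (if snd s then fwd (fst s) x else bwd (fst s) x)"

fun lift_end :: "'g vertex \<Rightarrow> lattice_word \<Rightarrow> 'g vertex" where
  "lift_end x [] = x"
| "lift_end x (s # w) = lift_end (move s x) w"

fun path_sum :: "'g cochain \<Rightarrow> 'g vertex \<Rightarrow> lattice_word \<Rightarrow> real" where
  "path_sum \<beta> x [] = 0"
| "path_sum \<beta> x (s # w) = (if snd s then \<beta> (fst s) x else - \<beta> (fst s) (bwd (fst s) x))
     + path_sum \<beta> (move s x) w"

text \<open>The coboundary, i.e. the circulation around the square over \<open>x\<close> normal to
  \<open>k\<close>. The square closes up only where the labels are flat
  (\<open>fwd_commute\<close>).\<close>

definition curl :: "'g cochain \<Rightarrow> 'g cochain" where
  "curl \<beta> k x = \<beta> (k+2) (fwd (k+1) x) - \<beta> (k+2) x - \<beta> (k+1) (fwd (k+2) x) + \<beta> (k+1) x"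

definition flat_on :: "(int^3) set \<Rightarrow> bool" where
  "flat_on Q \<longleftrightarrow> (\<forall>k q. square_in Q k q \<longrightarrow>
     l (k+1) q \<otimes> l (k+2) (q + unit_vec (k+1)) = l (k+2) q \<otimes> l (k+1) (q + unit_vec (k+2)))"

text \<open>The equation of real 1-chains "\<open>w\<close> is the boundary of \<open>rs\<close>" is
  expressed by testing against every cochain. No chain module has to be built, and each use is an
  instance of Stokes' formula.\<close>

definition bounding :: "(int^3) set \<Rightarrow> (int^3) set \<Rightarrow> bool" where
  "bounding P Q \<longleftrightarrow> (\<forall>w. stays P 0 w \<and> lift_end base w = base \<longrightarrow>
     (\<exists>rs :: (real \<times> 3 \<times> 'g vertex) list.
        (\<forall>(s, k, x) \<in> set rs. x \<in> X \<and> square_in Q k (fst x)) \<and>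
        (\<forall>\<beta>. path_sum \<beta> base w = (\<Sum>(s, k, x)\<leftarrow>rs. s * curl \<beta> k x))))"

definition full_holonomy :: "(int^3) set \<Rightarrow> bool" where
  "full_holonomy P \<longleftrightarrow> (\<forall>g\<in>carrier G. \<exists>w. stays P 0 w \<and> lift_end base w = (0, g))"

lemma base_in [simp]: "base \<in> X" by (simp add: base_def X_def)
lemma fwd_in [simp]: "x \<in> X \<Longrightarrow> fwd i x \<in> X" by (simp add: fwd_def X_def)
lemma bwd_in [simp]: "x \<in> X \<Longrightarrow> bwd i x \<in> X" by (simp add: bwd_def X_def)
lemma shift_in [simp]: "x \<in> X \<Longrightarrow> h \<in> carrier G \<Longrightarrow> shift h x \<in> X" by (simp add: shift_def X_def)
lemma move_in [simp]: "x \<in> X \<Longrightarrow> move s x \<in> X" by (simp add: move_def)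
lemma lift_end_in [simp]: "x \<in> X \<Longrightarrow> lift_end x w \<in> X" by (induction w arbitrary: x) auto

lemma bwd_fwd [simp]: "x \<in> X \<Longrightarrow> bwd i (fwd i x) = x"
  by (cases x) (simp add: fwd_def bwd_def X_def m_assoc)

lemma fwd_bwd [simp]: "x \<in> X \<Longrightarrow> fwd i (bwd i x) = x"
  by (cases x) (simp add: fwd_def bwd_def X_def m_assoc)

lemma shift_shift [simp]: "x \<in> X \<Longrightarrow> h \<in> carrier G \<Longrightarrow> k \<in> carrier G \<Longrightarrow> shift h (shift k x) = shift (h \<otimes> k) x"
  by (simp add: shift_def X_def m_assoc)

lemma shift_one [simp]: "x \<in> X \<Longrightarrow> shift \<one> x = x"
  by (cases x) (simp add: shift_def X_def)

lemma fwd_shift: "x \<in> X \<Longrightarrow> h \<in> carrier G \<Longrightarrow> fwd i (shift h x) = shift h (fwd i x)"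
  by (simp add: shift_def fwd_def X_def m_assoc)

lemma bwd_shift: "x \<in> X \<Longrightarrow> h \<in> carrier G \<Longrightarrow> bwd i (shift h x) = shift h (bwd i x)"
  by (simp add: shift_def bwd_def X_def m_assoc)

lemma move_shift: "x \<in> X \<Longrightarrow> h \<in> carrier G \<Longrightarrow> move s (shift h x) = shift h (move s x)"
  by (simp add: move_def fwd_shift bwd_shift)

lemma lift_end_shift: "x \<in> X \<Longrightarrow> h \<in> carrier G \<Longrightarrow> lift_end (shift h x) w = shift h (lift_end x w)"
  by (induction w arbitrary: x) (auto simp: move_shift)

lemma fst_simps [simp]:
  "fst (fwd i x) = fst x + unit_vec i" "fst (bwd i x) = fst x - unit_vec i" "fst (shift h x) = fst x"
  "fst base = 0" "fst (move s x) = fst x + step_vec s"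
  by (simp_all add: fwd_def bwd_def shift_def base_def move_def step_vec_def)

lemma fst_lift_end [simp]: "fst (lift_end x w) = fst x + displacement w"
  by (induction w arbitrary: x) (auto simp: algebra_simps)

lemma lift_end_append [simp]: "lift_end x (u @ w) = lift_end (lift_end x u) w"
  by (induction u arbitrary: x) auto

lemma path_sum_append: "path_sum \<beta> x (u @ w) = path_sum \<beta> x u + path_sum \<beta> (lift_end x u) w"
  by (induction u arbitrary: x) auto

lemma move_flip [simp]: "x \<in> X \<Longrightarrow> move (fst s, \<not> snd s) (move s x) = x"
  by (simp add: move_def)

lemma lift_end_word_inv [simp]: "x \<in> X \<Longrightarrow> lift_end (lift_end x w) (word_inv w) = x"
  by (induction w arbitrary: x) auto

lemma path_sum_word_inv: "x \<in> X \<Longrightarrow> path_sum \<beta> (lift_end x w) (word_inv w) = - path_sum \<beta> x w"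
proof (induction w arbitrary: x)
  case (Cons s w)
  then show ?case
    by (simp add: path_sum_append) (auto simp: move_def)
qed simp

lemma path_sum_equivariant:
  assumes "\<And>i x. x \<in> X \<Longrightarrow> \<beta> i (shift h x) = c * \<beta> i x" and "h \<in> carrier G" "x \<in> X"
  shows "path_sum \<beta> (shift h x) w = c * path_sum \<beta> x w"
  using assms(3)
  by (induction w arbitrary: x) (auto simp: assms(1,2) move_shift bwd_shift algebra_simps)

lemma fwd_commute:
  assumes "flat_on Q" "square_in Q k (fst x)" "x \<in> X"
  shows "fwd (k+2) (fwd (k+1) x) = fwd (k+1) (fwd (k+2) x)"
proof -
  have "l (k+1) (fst x) \<otimes> l (k+2) (fst x + unit_vec (k+1)) = l (k+2) (fst x) \<otimes> l (k+1) (fst x + unit_vec (k+2))"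
    using assms by (simp add: flat_on_def)
  then show ?thesis
    using assms(3) by (simp add: fwd_def X_def m_assoc add.assoc add.commute[of "unit_vec (k+1)"])
qed

end

section \<open>Distorted subgroups\<close>

context group
begin

lemma inv_mult_cancel:
  assumes "g \<in> carrier G" "b \<in> carrier G"
  shows "inv g \<otimes> (g \<otimes> b) = b" "g \<otimes> (inv g \<otimes> b) = b"
  using assms by (simp_all flip: m_assoc)

lemma int_pow_conj:
  assumes "g \<in> carrier G" "a \<in> carrier G"
  shows "(g \<otimes> a \<otimes> inv g) [^] (k::int) = g \<otimes> a [^] k \<otimes> inv g"
proof -
  have nat: "(g \<otimes> a \<otimes> inv g) [^] (k::nat) = g \<otimes> a [^] k \<otimes> inv g" for k
  proof (induction k)
    case (Suc k)
    then show ?case using assms by (simp add: m_assoc inv_mult_cancel)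
  qed (use assms in simp)
  show ?thesis
    by (cases k rule: int_cases2) (use assms in \<open>simp_all add: int_pow_int int_pow_neg_int nat, simp add: inv_mult_group m_assoc\<close>)
qed

text \<open>Conjugation by x fixes the powers of x, so x normalizes its own isolator and therefore
  centralizes it. If x^n = y^n, then y lies in this isolator; x and y commute, and x y^-1 is a
  torsion element.\<close>

lemma Rbar_imp_R:
  assumes "Rbar_group G"
  shows "R_group G"
proof -
  have tf: "torsion_free G" using assms by (simp add: Rbar_group_def)
  have tfi: "a = \<one>" if "a \<in> carrier G" "a [^] (n::int) = \<one>" "n \<noteq> 0" for a n
  proof -
    have "a [^] nat \<bar>n\<bar> = \<one>"
    proof (cases "n \<ge> 0")
      case True
      then show ?thesis using that by (simp flip: int_pow_int)
    next
      case False
      then have "int (nat \<bar>n\<bar>) = - n" by simp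
      then show ?thesis using that by (simp add: int_pow_neg flip: int_pow_int)
    qed
    then show ?thesis using tf that unfolding torsion_free_def by (metis zero_less_abs_iff zero_less_nat_eq)
  qed
  have "x = y" if x: "x \<in> carrier G" and y: "y \<in> carrier G" and n: "n \<noteq> 0" and eq: "x [^] n = y [^] n" for x y and n :: int
  proof -
    have gen: "generate G {x} = {x [^] (k::int) | k. k \<in> UNIV}"
      using x by (rule generate_pow)
    have "y [^] nat \<bar>n\<bar> \<in> generate G {x}"
    proof (cases "n \<ge> 0")
      case True
      then show ?thesis using eq by (auto simp: gen intro!: exI[of _ n] simp flip: int_pow_int)
    next
      case False
      then have "int (nat \<bar>n\<bar>) = - n" by simp
      have "y [^] nat \<bar>n\<bar> = y [^] int (nat \<bar>n\<bar>)" by (simp only: int_pow_int)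
      also have "\<dots> = x [^] (- n)" unfolding \<open>int (nat \<bar>n\<bar>) = - n\<close> using x y eq by (simp add: int_pow_neg)
      finally have "y [^] nat \<bar>n\<bar> = x [^] (- n)" .
      then show ?thesis by (auto simp: gen)
    qed
    then have yI: "y \<in> isolator G x" using y n by (auto simp: isolator_def intro!: exI[of _ "nat \<bar>n\<bar>"])
    \<comment> \<open>The case \<open>inv x\<close> supplies the reverse inclusion: the normalizer
      asks for an equality of sets.\<close>
    have conj_in: "g \<otimes> a \<otimes> inv g \<in> isolator G x" if aI: "a \<in> isolator G x" and g': "g = x \<or> g = inv x" for a g
    proof -
      have g: "g \<in> carrier G" using that x by auto
      obtain e :: int where e: "g = x [^] e"
        using g' x int_pow_neg[of x 1] by (metis int_pow_1)
      have gcomm: "g \<otimes> x [^] k = x [^] k \<otimes> g" for k :: int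
        unfolding e int_pow_mult[OF x, symmetric] by (simp only: add.commute)
      obtain k :: nat and j :: int where kj: "a \<in> carrier G" "k > 0" "a [^] k = x [^] j"
        using aI by (auto simp: isolator_def gen)
      have "(g \<otimes> a \<otimes> inv g) [^] k = g \<otimes> x [^] j \<otimes> inv g"
        using int_pow_conj[of g a "int k"] g kj by (simp add: int_pow_int)
      also have "\<dots> = x [^] j" using gcomm g x by (simp add: m_assoc)
      finally show ?thesis using kj g by (auto simp: isolator_def gen)
    qed
    have "x \<in> normalizer G (isolator G x)"
    proof -
      have "(\<lambda>a. x \<otimes> a \<otimes> inv x) ` isolator G x = isolator G x"
      proof
        show "isolator G x \<subseteq> (\<lambda>a. x \<otimes> a \<otimes> inv x) ` isolator G x"
        proof
          fix a assume a: "a \<in> isolator G x"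
          then have "a \<in> carrier G" by (simp add: isolator_def)
          then have "a = x \<otimes> (inv x \<otimes> a \<otimes> inv (inv x)) \<otimes> inv x"
            using x by (simp add: m_assoc inv_mult_cancel)
          then show "a \<in> (\<lambda>a. x \<otimes> a \<otimes> inv x) ` isolator G x"
            using conj_in[OF a, of "inv x"] by blast
        qed
      qed (use conj_in in auto)
      then show ?thesis using x by (simp add: normalizer_isolator)
    qed
    then have "x \<in> centralizer G (isolator G x)" using assms x by (simp add: Rbar_group_def)
    then have xy: "x \<otimes> y = y \<otimes> x" using yI by (simp add: centralizer_def)
    have "x \<otimes> inv y = inv y \<otimes> x"
    proof -
      have "inv y \<otimes> x = inv y \<otimes> (x \<otimes> y) \<otimes> inv y" using x y by (simp add: m_assoc)
      also have "\<dots> = x \<otimes> inv y" unfolding xy using x y by (simp add: m_assoc inv_mult_cancel)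
      finally show ?thesis by simp
    qed
    then have "(x \<otimes> inv y) [^] n = x [^] n \<otimes> (inv y) [^] n"
      using x y by (intro int_pow_mult_distrib) auto
    also have "\<dots> = \<one>" using x y eq by (simp add: int_pow_inv)
    finally have "x \<otimes> inv y = \<one>" using tfi[of "x \<otimes> inv y" n] x y n by simp
    then show "x = y" using x y inv_solve_right[of \<one> x y] by simp
  qed
  then show ?thesis using is_group unfolding R_group_def by blast
qed

end

text \<open>The pair (\<open>v\<close>, \<open>\<kappa>\<close>) lets h act on the line by r
  \<mapsto> v h + \<mu>^(\<kappa> h) r, and \<open>v_mult\<close> is composition of these affine
  maps. Here \<open>t\<close> is the dilation by \<open>\<mu>\<close>, \<open>y\<close> the unit
  translation, and the kernel of \<open>\<kappa>\<close> acts faithfully by translations.\<close>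

locale distorted_subgroup = group G for G (structure) +
  fixes H :: "'a set" and \<kappa> :: "'a \<Rightarrow> int" and v :: "'a \<Rightarrow> real" and \<mu> :: real
    and t y :: 'a and m n :: nat
  assumes H: "subgroup H G"
    and \<kappa>_mult: "\<And>g h. g \<in> H \<Longrightarrow> h \<in> H \<Longrightarrow> \<kappa> (g \<otimes> h) = \<kappa> g + \<kappa> h"
    and v_mult: "\<And>g h. g \<in> H \<Longrightarrow> h \<in> H \<Longrightarrow> v (g \<otimes> h) = v g + \<mu> powi \<kappa> g * v h"
    and v_inj: "\<And>h. h \<in> H \<Longrightarrow> \<kappa> h = 0 \<Longrightarrow> v h = 0 \<Longrightarrow> h = \<one>"
    and root: "\<And>h. h \<in> H \<Longrightarrow> \<kappa> h = 0 \<Longrightarrow> \<exists>(k::nat) (j::int). k > 0 \<and> h [^] k = y [^] j"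
    and t: "t \<in> H" "\<kappa> t = 1" "v t = 0"
    and y: "y \<in> H" "\<kappa> y = 0" "v y = 1"
    and rel: "t \<otimes> y [^] m = y [^] n \<otimes> t"
    and m: "m > 0" and \<mu>: "\<mu> = real n / real m" "\<mu> > 1"

section \<open>The affine action on the subgroup generated by an isolator and a distorting
  element\<close>

locale R_group_with_distortion = group G for G (structure) +
  fixes t x :: 'a and m n :: nat
  assumes R: "R_group G"
    and x: "x \<in> carrier G" "x \<noteq> \<one>" and t: "t \<in> carrier G"
    and rel: "t \<otimes> x [^] m = x [^] n \<otimes> t"
    and m: "m > 0" and mn: "m < n"
begin

lemma roots_unique: "a \<in> carrier G \<Longrightarrow> b \<in> carrier G \<Longrightarrow> (k::int) \<noteq> 0 \<Longrightarrow> a [^] k = b [^] k \<Longrightarrow> a = b"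
  using R unfolding R_group_def by blast

lemma x_pow_inj: "x [^] (j::int) = x [^] (k::int) \<Longrightarrow> j = k"
proof (rule ccontr)
  assume "x [^] j = x [^] k" "j \<noteq> k"
  then have "x [^] (j - k) = \<one> [^] (j - k)" using x by (simp add: int_pow_diff)
  then show False using roots_unique[of x \<one> "j - k"] x \<open>j \<noteq> k\<close> by simp
qed

definition A :: "'a set" where
  "A = {a \<in> carrier G. \<exists>(k::int) (j::int). k > 0 \<and> a [^] k = x [^] j}"

definition \<mu> :: real where "\<mu> = real n / real m"

text \<open>Formally a = x^(j/k). Since x has infinite order the quotient does not depend on the
  exponents, and unique roots make \<open>ratio\<close> an embedding of \<open>A\<close> in the
  additive group of rationals.\<close>

definition is_ratio :: "'a \<Rightarrow> real \<Rightarrow> bool" where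
  "is_ratio a r \<longleftrightarrow> (\<exists>(k::int) (j::int). k > 0 \<and> a [^] k = x [^] j \<and> r = of_int j / of_int k)"

definition ratio :: "'a \<Rightarrow> real" where
  "ratio a = (THE r. is_ratio a r)"

lemma \<mu>_gt_1: "\<mu> > 1" using m mn by (simp add: \<mu>_def)

lemma A_carrier [simp]: "a \<in> A \<Longrightarrow> a \<in> carrier G" by (simp add: A_def)

lemma pow_multiple:
  assumes "a \<in> carrier G" "a [^] (k::int) = x [^] (j::int)"
  shows "a [^] (k * i) = x [^] (j * i)" "a [^] (i * k) = x [^] (i * j)"
proof -
  have 1: "a [^] (k * i) = (a [^] k) [^] i" by (simp only: int_pow_pow[OF assms(1)])
  have 2: "(x [^] j) [^] i = x [^] (j * i)" by (simp only: int_pow_pow[OF x(1)])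
  show "a [^] (k * i) = x [^] (j * i)" by (simp only: 1 2 assms(2))
  then show "a [^] (i * k) = x [^] (i * j)" by (simp only: mult.commute)
qed

lemma is_ratio_unique:
  assumes "a \<in> carrier G" "is_ratio a r" "is_ratio a r'"
  shows "r = r'"
proof -
  obtain k j k' j' :: int where kj: "k > 0" "a [^] k = x [^] j" "r = of_int j / of_int k"
     "k' > 0" "a [^] k' = x [^] j'" "r' = of_int j' / of_int k'"
    using assms(2,3) unfolding is_ratio_def by blast
  have "x [^] (j * k') = x [^] (j' * k)"
    using pow_multiple(1)[OF assms(1) kj(2), of k'] pow_multiple(2)[OF assms(1) kj(5), of k] by (simp add: mult.commute)
  then have "j * k' = j' * k" by (rule x_pow_inj)
  then have "real_of_int j * of_int k' = of_int j' * of_int k" by (metis of_int_mult)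
  moreover have "real_of_int k \<noteq> 0" "real_of_int k' \<noteq> 0" using kj(1,4) by simp_all
  ultimately have "real_of_int j / of_int k = of_int j' / of_int k'"
    using frac_eq_eq[of "real_of_int k" "real_of_int k'" "real_of_int j" "real_of_int j'"] by blast
  then show ?thesis by (simp only: kj(3,6))
qed

lemma ratio_eq: "a \<in> carrier G \<Longrightarrow> is_ratio a r \<Longrightarrow> ratio a = r"
  unfolding ratio_def by (rule the_equality, assumption, rule is_ratio_unique)

lemma is_ratio_ratio: "a \<in> A \<Longrightarrow> is_ratio a (ratio a)"
proof -
  assume a: "a \<in> A"
  then obtain r where r: "is_ratio a r" unfolding A_def is_ratio_def by blast
  then show ?thesis using ratio_eq[OF A_carrier[OF a] r] by simp
qed

lemma is_ratio_A: "a \<in> carrier G \<Longrightarrow> is_ratio a r \<Longrightarrow> a \<in> A"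
  unfolding A_def is_ratio_def by blast

lemma conj_eq_iff: "a \<in> carrier G \<Longrightarrow> g \<in> carrier G \<Longrightarrow> g \<otimes> a \<otimes> inv g = a \<longleftrightarrow> g \<otimes> a = a \<otimes> g"
  using inv_solve_right[of a "g \<otimes> a" g] by auto

text \<open>The elements g a g^-1 and a have the same k-th power, so unique roots identify them.
  Applied twice, this makes \<open>A\<close> abelian.\<close>

lemma commute_root:
  assumes "g \<in> carrier G" "a \<in> carrier G" "(k::int) \<noteq> 0" "g \<otimes> a [^] k = a [^] k \<otimes> g"
  shows "g \<otimes> a = a \<otimes> g"
proof -
  have "g \<otimes> a \<otimes> inv g = a"
    using assms by (intro roots_unique[of _ a k]) (simp_all add: int_pow_conj, simp add: m_assoc)
  then show ?thesis using assms by (simp add: conj_eq_iff)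
qed

lemma x_pow_commute: "x \<otimes> x [^] (j::int) = x [^] j \<otimes> x"
  using x int_pow_mult[of x 1 j] int_pow_mult[of x j 1] by (simp add: add.commute)

lemma commute_pow:
  assumes "g \<in> carrier G" "a \<in> carrier G" "g \<otimes> a = a \<otimes> g"
  shows "g \<otimes> a [^] (j::int) = a [^] j \<otimes> g"
  using assms int_pow_conj[of g a j] conj_eq_iff[of a g] conj_eq_iff[of "a [^] j" g] by simp

lemma A_commute:
  assumes "a \<in> A" "b \<in> A"
  shows "a \<otimes> b = b \<otimes> a"
proof -
  have ax: "a \<otimes> x = x \<otimes> a" if a: "a \<in> A" for a
  proof -
    obtain k j :: int where kj: "k > 0" "a [^] k = x [^] j" using a unfolding A_def by blast
    have "x \<otimes> a [^] k = a [^] k \<otimes> x" using kj x_pow_commute by simp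
    then show ?thesis using commute_root[of x a k] kj that x by simp
  qed
  obtain k j :: int where kj: "k > 0" "b [^] k = x [^] j" using assms(2) unfolding A_def by blast
  have "a \<otimes> b [^] k = b [^] k \<otimes> a" using kj ax[OF assms(1)] commute_pow[of a x j] assms x by simp
  then show ?thesis using commute_root[of a b k] kj assms by simp
qed

lemma is_ratio_mult:
  assumes "a \<in> A" "b \<in> A"
  shows "is_ratio (a \<otimes> b) (ratio a + ratio b)"
proof -
  obtain k j :: int where kj: "k > 0" "a [^] k = x [^] j" "ratio a = of_int j / of_int k"
    using is_ratio_ratio[OF assms(1)] unfolding is_ratio_def by blast
  obtain k' j' :: int where kj': "k' > 0" "b [^] k' = x [^] j'" "ratio b = of_int j' / of_int k'"
    using is_ratio_ratio[OF assms(2)] unfolding is_ratio_def by blast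
  have "(a \<otimes> b) [^] (k * k') = a [^] (k * k') \<otimes> b [^] (k * k')"
    using assms A_commute by (intro int_pow_mult_distrib) auto
  also have "\<dots> = x [^] (j * k') \<otimes> x [^] (j' * k)"
    using pow_multiple(1)[OF _ kj(2), of k'] pow_multiple(2)[OF _ kj'(2), of k] assms by (simp add: mult.commute)
  also have "\<dots> = x [^] (j * k' + j' * k)" using x by (simp add: int_pow_mult)
  finally show ?thesis
    unfolding is_ratio_def using kj kj'
    by (intro exI[of _ "k * k'"] exI[of _ "j * k' + j' * k"]) (simp add: field_simps)
qed

lemma A_mult: "a \<in> A \<Longrightarrow> b \<in> A \<Longrightarrow> a \<otimes> b \<in> A"
  by (rule is_ratio_A[OF _ is_ratio_mult]) simp_all

lemma ratio_mult: "a \<in> A \<Longrightarrow> b \<in> A \<Longrightarrow> ratio (a \<otimes> b) = ratio a + ratio b"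
  by (rule ratio_eq[OF _ is_ratio_mult]) simp_all

lemma A_inv: "a \<in> A \<Longrightarrow> inv a \<in> A"
proof -
  assume a: "a \<in> A"
  then obtain k j :: int where kj: "k > 0" "a [^] k = x [^] j" unfolding A_def by blast
  then have "inv a [^] k = x [^] (- j)" using a x by (simp add: int_pow_inv int_pow_neg)
  then show ?thesis using a kj unfolding A_def by blast
qed

lemma x_A: "x \<in> A" "ratio x = 1" and one_A: "\<one> \<in> A"
proof -
  have "is_ratio x 1" unfolding is_ratio_def by (intro exI[of _ 1]) simp
  then show "x \<in> A" "ratio x = 1" using x is_ratio_A ratio_eq by auto
  have "\<one> [^] (1::int) = x [^] (0::int)" by simp
  then show "\<one> \<in> A" unfolding A_def using zero_less_one by blast
qed

lemma ratio_inj: "a \<in> A \<Longrightarrow> ratio a = 0 \<Longrightarrow> a = \<one>"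
proof -
  assume a: "a \<in> A" "ratio a = 0"
  then obtain k j :: int where kj: "k > 0" "a [^] k = x [^] j" "0 = real_of_int j / of_int k"
    using is_ratio_ratio[of a] unfolding is_ratio_def by metis
  then have "a [^] k = \<one> [^] k" using x by simp
  then show ?thesis using roots_unique[of a \<one> k] a kj by simp
qed

lemma conj_x: "t \<otimes> x [^] (int m * j) \<otimes> inv t = x [^] (int n * j)"
proof -
  have "t \<otimes> x [^] m \<otimes> inv t = x [^] n" using rel t x by (simp add: m_assoc)
  then have "(t \<otimes> x [^] m \<otimes> inv t) [^] j = (x [^] n) [^] j" by simp
  then show ?thesis using t x by (simp add: int_pow_conj int_pow_pow flip: int_pow_int)
qed

text \<open>From a^k = x^j follows a^(k m) = (x^m)^j, a power on which conjugation by t is known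
  from the relation.\<close>

lemma conj_t:
  assumes "a \<in> A"
  shows "t \<otimes> a \<otimes> inv t \<in> A" "ratio (t \<otimes> a \<otimes> inv t) = \<mu> * ratio a"
proof -
  obtain k j :: int where kj: "k > 0" "a [^] k = x [^] j" "ratio a = of_int j / of_int k"
    using is_ratio_ratio[OF assms] unfolding is_ratio_def by blast
  have "(t \<otimes> a \<otimes> inv t) [^] (int m * k) = t \<otimes> a [^] (k * int m) \<otimes> inv t"
    using t assms by (simp add: int_pow_conj mult.commute)
  also have "a [^] (k * int m) = x [^] (int m * j)"
    unfolding pow_multiple(1)[OF A_carrier[OF assms] kj(2)] by (simp only: mult.commute)
  finally have "(t \<otimes> a \<otimes> inv t) [^] (int m * k) = x [^] (int n * j)" by (simp add: conj_x)
  then have "is_ratio (t \<otimes> a \<otimes> inv t) (\<mu> * ratio a)"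
    unfolding is_ratio_def \<mu>_def using kj m by (intro exI[of _ "int m * k"] exI[of _ "int n * j"]) simp
  then show "t \<otimes> a \<otimes> inv t \<in> A" "ratio (t \<otimes> a \<otimes> inv t) = \<mu> * ratio a"
    using is_ratio_A ratio_eq t assms by (simp_all add: is_ratio_A ratio_eq)
qed

lemma conj_t_inv:
  assumes "a \<in> A"
  shows "inv t \<otimes> a \<otimes> t \<in> A" "ratio (inv t \<otimes> a \<otimes> t) = inverse \<mu> * ratio a"
proof -
  obtain k j :: int where kj: "k > 0" "a [^] k = x [^] j" "ratio a = of_int j / of_int k"
    using is_ratio_ratio[OF assms] unfolding is_ratio_def by blast
  have "(inv t \<otimes> a \<otimes> inv (inv t)) [^] (int n * k) = inv t \<otimes> a [^] (k * int n) \<otimes> inv (inv t)"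
    using t assms int_pow_conj[of "inv t" a] by (simp only: mult.commute inv_closed A_carrier)
  also have "a [^] (k * int n) = x [^] (int n * j)"
    unfolding pow_multiple(1)[OF A_carrier[OF assms] kj(2)] by (simp only: mult.commute)
  also have "\<dots> = t \<otimes> x [^] (int m * j) \<otimes> inv t" by (simp add: conj_x)
  finally have "(inv t \<otimes> a \<otimes> t) [^] (int n * k) = x [^] (int m * j)"
    using t x assms by (simp add: m_assoc inv_mult_cancel)
  then have "is_ratio (inv t \<otimes> a \<otimes> t) (inverse \<mu> * ratio a)"
    unfolding is_ratio_def \<mu>_def using kj m mn by (intro exI[of _ "int n * k"] exI[of _ "int m * j"]) simp
  then show "inv t \<otimes> a \<otimes> t \<in> A" "ratio (inv t \<otimes> a \<otimes> t) = inverse \<mu> * ratio a"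
    using is_ratio_A ratio_eq t assms by (simp_all add: is_ratio_A ratio_eq)
qed

lemma conj_t_pow:
  assumes "a \<in> A"
  shows "t [^] (i::int) \<otimes> a \<otimes> t [^] (- i) \<in> A \<and> ratio (t [^] i \<otimes> a \<otimes> t [^] (- i)) = \<mu> powi i * ratio a"
proof (induction i rule: int_induct[of _ 0])
  case base
  then show ?case using assms by simp
next
  case (step1 i)
  define b where "b = t [^] i \<otimes> a \<otimes> t [^] (- i)"
  have b: "b \<in> A" "ratio b = \<mu> powi i * ratio a" using step1 by (simp_all add: b_def)
  have "t [^] (i + 1) = t \<otimes> t [^] i"
    using int_pow_mult[OF t, of 1 i] unfolding int_pow_1[OF t] add.commute[of 1 i] .
  moreover have "t [^] (- (i + 1)) = t [^] (- i) \<otimes> inv t"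
  proof -
    have "- (i + 1) = - i + - 1" by simp
    then show ?thesis by (simp only: int_pow_mult[OF t] int_pow_neg[OF t, of 1] int_pow_1[OF t])
  qed
  ultimately have "t [^] (i + 1) \<otimes> a \<otimes> t [^] (- (i + 1)) = t \<otimes> b \<otimes> inv t"
    using t assms by (simp only: b_def m_assoc m_closed int_pow_closed inv_closed A_carrier)
  moreover have "\<mu> powi (i + 1) = \<mu> * \<mu> powi i" using \<mu>_gt_1 by (simp add: power_int_add)
  ultimately show ?case using conj_t[OF b(1)] b(2) by simp
next
  case (step2 i)
  define b where "b = t [^] i \<otimes> a \<otimes> t [^] (- i)"
  have b: "b \<in> A" "ratio b = \<mu> powi i * ratio a" using step2 by (simp_all add: b_def)
  have "t [^] (i - 1) = inv t \<otimes> t [^] i"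
  proof -
    have "i - 1 = - 1 + i" by simp
    then show ?thesis by (simp only: int_pow_mult[OF t] int_pow_neg[OF t, of 1] int_pow_1[OF t])
  qed
  moreover have "t [^] (- (i - 1)) = t [^] (- i) \<otimes> t"
  proof -
    have "- (i - 1) = - i + 1" by simp
    then show ?thesis by (simp only: int_pow_mult[OF t] int_pow_1[OF t])
  qed
  ultimately have "t [^] (i - 1) \<otimes> a \<otimes> t [^] (- (i - 1)) = inv t \<otimes> b \<otimes> t"
    using t assms by (simp only: b_def m_assoc m_closed int_pow_closed inv_closed A_carrier)
  moreover have "\<mu> powi (i - 1) = inverse \<mu> * \<mu> powi i"
    using \<mu>_gt_1 by (simp add: power_int_diff field_simps)
  ultimately show ?case using conj_t_inv[OF b(1)] b(2) by simp
qed

text \<open>Elements of the abelian group \<open>A\<close> fix x under conjugation, but t^i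
  multiplies its ratio by \<mu>^i. Hence the form a t^i of an element of \<open>H\<close> is unique,
  and \<open>height\<close> and \<open>coord\<close> are well defined.\<close>

lemma t_pow_A: "t [^] (i::int) \<in> A \<Longrightarrow> i = 0"
proof -
  assume i: "t [^] i \<in> A"
  have "t [^] i \<otimes> x \<otimes> t [^] (- i) = x"
    unfolding int_pow_neg[OF t] using conj_eq_iff[of x "t [^] i"] A_commute[OF i x_A(1)] t x(1) by blast
  then have "\<mu> powi i = 1" using conj_t_pow[OF x_A(1), of i] x_A by simp
  moreover obtain k where k: "i = int k \<or> i = - int k" by (cases i rule: int_cases2) auto
  ultimately have "\<mu> ^ k = 1" by (elim disjE) (simp_all add: power_int_minus)
  then have "k = 0" using one_less_power[OF \<mu>_gt_1, of k] by (cases k) simp_all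
  then show "i = 0" using k by simp
qed

definition H :: "'a set" where
  "H = {a \<otimes> t [^] i | a (i::int). a \<in> A}"

definition height :: "'a \<Rightarrow> int" where
  "height h = (THE i. \<exists>a\<in>A. h = a \<otimes> t [^] i)"

definition coord :: "'a \<Rightarrow> real" where
  "coord h = ratio (h \<otimes> t [^] (- height h))"

lemma height_eq:
  assumes "a \<in> A"
  shows "height (a \<otimes> t [^] (i::int)) = i"
  unfolding height_def
proof (rule the_equality)
  fix j :: int assume "\<exists>b\<in>A. a \<otimes> t [^] i = b \<otimes> t [^] j"
  then obtain b where b: "b \<in> A" "a \<otimes> t [^] i = b \<otimes> t [^] j" by blast
  have "t [^] (i - j) = inv a \<otimes> (a \<otimes> t [^] i) \<otimes> t [^] (- j)"
    using assms t by (simp add: m_assoc inv_mult_cancel int_pow_mult[symmetric])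
  also have "\<dots> = inv a \<otimes> b"
    unfolding b(2) using assms b t by (simp add: m_assoc int_pow_mult[symmetric])
  finally have "t [^] (i - j) \<in> A" using assms b A_inv A_mult by simp
  then show "j = i" using t_pow_A[of "i - j"] by simp
qed (rule bexI[OF refl assms])

lemma coord_eq: "a \<in> A \<Longrightarrow> coord (a \<otimes> t [^] (i::int)) = ratio a"
  using t by (simp add: coord_def height_eq m_assoc int_pow_mult[symmetric])

lemma H_mult_form:
  assumes "a \<in> A" "b \<in> A"
  shows "(a \<otimes> t [^] i) \<otimes> (b \<otimes> t [^] j) = (a \<otimes> (t [^] i \<otimes> b \<otimes> t [^] (- i))) \<otimes> t [^] (i + j :: int)"
proof -
  have "t [^] (- i) \<otimes> t [^] (i + j) = t [^] j" using t by (simp flip: int_pow_mult)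
  then show ?thesis using assms t by (simp add: m_assoc)
qed

lemma subgroup_H: "subgroup H G"
proof
  show "H \<subseteq> carrier G" using t by (auto simp: H_def)
  have "\<one> = \<one> \<otimes> t [^] (0::int)" by simp
  then show "\<one> \<in> H" unfolding H_def using one_A by blast
  fix g assume "g \<in> H"
  then obtain a i where g: "a \<in> A" "g = a \<otimes> t [^] (i::int)" unfolding H_def by blast
  have "inv g = (t [^] (- i) \<otimes> inv a \<otimes> t [^] (- (- i))) \<otimes> t [^] (- i)"
    using g t by (simp add: inv_mult_group m_assoc int_pow_neg)
  then show "inv g \<in> H" using conj_t_pow[OF A_inv[OF g(1)], of "- i"] unfolding H_def by blast
  fix h assume "h \<in> H"
  then obtain b j where h: "b \<in> A" "h = b \<otimes> t [^] (j::int)" unfolding H_def by blast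
  show "g \<otimes> h \<in> H"
  proof -
    have "a \<otimes> (t [^] i \<otimes> b \<otimes> t [^] (- i)) \<in> A" using A_mult g(1) conj_t_pow[OF h(1), of i] by blast
    then show ?thesis using H_mult_form[OF g(1) h(1), of i j] unfolding g(2) h(2) H_def by blast
  qed
qed

sublocale distorted_subgroup G H height coord \<mu> t x m n
proof (rule distorted_subgroup.intro, rule is_group, rule distorted_subgroup_axioms.intro)
  show "subgroup H G" by (rule subgroup_H)
next
  fix g h assume "g \<in> H" "h \<in> H"
  then obtain a i b j where g: "a \<in> A" "g = a \<otimes> t [^] (i::int)" and h: "b \<in> A" "h = b \<otimes> t [^] (j::int)"
    unfolding H_def by blast
  have c: "a \<otimes> (t [^] i \<otimes> b \<otimes> t [^] (- i)) \<in> A" using g h A_mult conj_t_pow by simp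
  show "height (g \<otimes> h) = height g + height h"
    unfolding g h H_mult_form[OF g(1) h(1)] height_eq[OF c] height_eq[OF g(1)] height_eq[OF h(1)] ..
  show "coord (g \<otimes> h) = coord g + \<mu> powi height g * coord h"
    unfolding g h H_mult_form[OF g(1) h(1)] coord_eq[OF c] coord_eq[OF g(1)] coord_eq[OF h(1)] height_eq[OF g(1)]
    using conj_t_pow[OF h(1), of i] g by (simp add: ratio_mult)
next
  fix h assume "h \<in> H" "height h = 0"
  then have h: "h \<in> A" "coord h = ratio h"
    using t height_eq coord_eq[of h 0] by (auto simp: H_def)
  show "coord h = 0 \<Longrightarrow> h = \<one>" using h ratio_inj by simp
  obtain k j :: int where kj: "k > 0" "h [^] k = x [^] j" using h unfolding A_def by blast
  then have "h [^] (nat k) = x [^] j" by (simp flip: int_pow_int)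
  then show "\<exists>(k::nat) (j::int). k > 0 \<and> h [^] k = x [^] j" using kj by (intro exI[of _ "nat k"]) auto
next
  have t1: "t = \<one> \<otimes> t [^] (1::int)" using t by simp
  have r1: "ratio \<one> = 0" using ratio_mult[OF one_A one_A] by simp
  show "t \<in> H" using one_A t1 unfolding H_def by blast
  show "height t = 1" using height_eq[OF one_A, of 1] t by simp
  show "coord t = 0" using coord_eq[OF one_A, of 1] t r1 by simp
  have x1: "x = x \<otimes> t [^] (0::int)" using x by simp
  show "x \<in> H" using x1 x_A unfolding H_def by blast
  show "height x = 0" using height_eq[OF x_A(1), of 0] x by simp
  show "coord x = 1" using coord_eq[OF x_A(1), of 0] x x_A by simp
qed (use rel m \<mu>_gt_1 in \<open>simp_all add: \<mu>_def\<close>)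

end

section \<open>From a failing normalizer condition to a distortion relation\<close>

context group
begin

text \<open>Some g normalizes the isolator of x without centralizing it. Then g x g^-1 is a root of
  a power of x, that is, g x^M g^-1 = x^N. Unique roots exclude |N| = M, and passing to the square
  of g makes both exponents positive.\<close>

lemma R_group_distortion:
  assumes R: "R_group G" and not_Rbar: "\<not> Rbar_group G"
  obtains t x m n where "R_group_with_distortion G t x m n"
proof -
  have roots: "a = b" if "a \<in> carrier G" "b \<in> carrier G" "(k::int) \<noteq> 0" "a [^] k = b [^] k" for a b k
    using R that unfolding R_group_def by blast
  have tf: "torsion_free G"
    unfolding torsion_free_def
  proof (intro ballI allI impI)
    fix a and k :: nat assume "a \<in> carrier G" "k > 0" "a [^] k = \<one>"
    then show "a = \<one>" by (intro roots[of a \<one> "int k"]) (simp_all add: int_pow_int)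
  qed
  obtain x where x: "x \<in> carrier G" "normalizer G (isolator G x) \<noteq> centralizer G (isolator G x)"
    using not_Rbar tf is_group unfolding Rbar_group_def by blast
  have gen: "generate G {x} = {x [^] (k::int) | k. k \<in> UNIV}"
    using x(1) by (rule generate_pow)
  have I: "a \<in> isolator G x \<longleftrightarrow> a \<in> carrier G \<and> (\<exists>(k::nat) (j::int). k > 0 \<and> a [^] k = x [^] j)" for a
    unfolding isolator_def gen by blast
  have conj_id: "g \<otimes> a \<otimes> inv g = a \<longleftrightarrow> g \<otimes> a = a \<otimes> g" if "g \<in> carrier G" "a \<in> carrier G" for g a
    using inv_solve_right[of a "g \<otimes> a" g] that by auto
  have "centralizer G (isolator G x) \<subseteq> normalizer G (isolator G x)"
  proof
    fix g assume g: "g \<in> centralizer G (isolator G x)"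
    then have gc: "g \<in> carrier G" by (simp add: centralizer_def)
    have "g \<otimes> a \<otimes> inv g = a" if "a \<in> isolator G x" for a
      using g that gc I[of a] conj_id[of g a] by (simp add: centralizer_def)
    then show "g \<in> normalizer G (isolator G x)" using gc by (simp add: normalizer_isolator)
  qed
  then obtain g where g: "g \<in> normalizer G (isolator G x)" "g \<notin> centralizer G (isolator G x)"
    using x(2) by blast
  have gc: "g \<in> carrier G" using g(1) by (simp add: normalizer_isolator)
  obtain a where a: "a \<in> isolator G x" "g \<otimes> a \<noteq> a \<otimes> g"
    using g(2) gc unfolding centralizer_def by blast
  obtain k :: nat and j :: int where kj: "a \<in> carrier G" "k > 0" "a [^] k = x [^] j"
    using a(1) I by blast
  have "x \<in> isolator G x"
    unfolding I using x(1) int_pow_int[of G x 1] by (intro conjI exI[of _ 1]) simp_all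
  then have "g \<otimes> x \<otimes> inv g \<in> isolator G x"
    using g(1) unfolding normalizer_isolator by blast
  then obtain M :: nat and N :: int where MN: "M > 0" "(g \<otimes> x \<otimes> inv g) [^] M = x [^] N"
    using I by blast
  have conj_pow: "(g \<otimes> x \<otimes> inv g) [^] (i::int) = g \<otimes> x [^] i \<otimes> inv g" for i
    using gc x(1) by (rule int_pow_conj)
  have gxM: "g \<otimes> x [^] int M \<otimes> inv g = x [^] N"
    using MN(2) conj_pow[of "int M"] by (simp add: int_pow_int)
  \<comment> \<open>If g commuted with x, then by unique roots it would commute with the root
    \<open>a\<close> of a power of x as well.\<close>
  have not_commute: "g \<otimes> x \<noteq> x \<otimes> g"
  proof
    assume "g \<otimes> x = x \<otimes> g"
    then have "g \<otimes> x \<otimes> inv g = x" using conj_id gc x(1) by blast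
    then have "g \<otimes> x [^] j \<otimes> inv g = x [^] j" using conj_pow[of j] by simp
    then have "(g \<otimes> a \<otimes> inv g) [^] int k = a [^] int k"
      using int_pow_conj[OF gc kj(1), of "int k"] kj(3) by (simp add: int_pow_int)
    then have "g \<otimes> a \<otimes> inv g = a" using roots[of "g \<otimes> a \<otimes> inv g" a "int k"] gc kj by simp
    then show False using a(2) conj_id gc kj(1) by blast
  qed
  then have x1: "x \<noteq> \<one>" using gc by auto
  have "\<bar>N\<bar> \<noteq> int M"
  proof
    assume "\<bar>N\<bar> = int M"
    then consider "N = int M" | "N = - int M" by linarith
    then show False
    proof cases
      case 1
      then have "(g \<otimes> x \<otimes> inv g) [^] int M = x [^] int M" using gxM conj_pow by simp
      then have "g \<otimes> x \<otimes> inv g = x" using roots[of "g \<otimes> x \<otimes> inv g" x "int M"] gc x(1) MN(1) by simp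
      then show False using not_commute conj_id gc x(1) by blast
    next
      case 2
      then have "(g \<otimes> x \<otimes> inv g) [^] int M = (inv x) [^] int M"
        using gxM conj_pow x(1) by (simp add: int_pow_neg int_pow_inv)
      then have "g \<otimes> x \<otimes> inv g = inv x"
        using roots[of "g \<otimes> x \<otimes> inv g" "inv x" "int M"] gc x(1) MN(1) by simp
      then have "g \<otimes> x = inv x \<otimes> g"
        using inv_solve_right[of "inv x" "g \<otimes> x" g] gc x(1) by auto
      \<comment> \<open>The Klein bottle relation: when g inverts x, the elements x g and g have the
        same square.\<close>
      then have "(x \<otimes> g) [^] (2::nat) = g [^] (2::nat)"
      proof -
        assume gx: "g \<otimes> x = inv x \<otimes> g"
        have "(x \<otimes> g) \<otimes> (x \<otimes> g) = x \<otimes> (g \<otimes> x) \<otimes> g" using gc x(1) by (simp add: m_assoc)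
        also have "\<dots> = g \<otimes> g" unfolding gx using gc x(1) by (simp add: m_assoc inv_mult_cancel)
        finally show ?thesis using gc x(1) by (simp add: numeral_2_eq_2)
      qed
      then have "(x \<otimes> g) [^] (2::int) = g [^] (2::int)"
        using int_pow_int[of G "x \<otimes> g" 2] int_pow_int[of G g 2] by simp
      then have "x \<otimes> g = g" using roots[of "x \<otimes> g" g 2] gc x(1) by simp
      then show False using x1 gc x(1) by simp
    qed
  qed
  \<comment> \<open>Conjugating twice replaces (M, N) by (M^2, N^2), which removes the sign of
    N.\<close>
  have twice: "(g \<otimes> g) \<otimes> x [^] (int M * int M) \<otimes> inv (g \<otimes> g) = x [^] (N * N)"
  proof -
    have "(g \<otimes> g) \<otimes> x [^] (int M * int M) \<otimes> inv (g \<otimes> g) = g \<otimes> (g \<otimes> (x [^] int M) [^] int M \<otimes> inv g) \<otimes> inv g"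
      using gc x(1) by (simp add: m_assoc inv_mult_group int_pow_pow)
    also have "g \<otimes> (x [^] int M) [^] int M \<otimes> inv g = (x [^] int M) [^] N"
      using int_pow_conj[OF gc int_pow_closed[OF x(1)], of "int M" "int M"] gxM x(1)
      by (simp add: int_pow_pow mult.commute)
    also have "g \<otimes> (x [^] int M) [^] N \<otimes> inv g = (x [^] N) [^] N"
      using int_pow_conj[OF gc int_pow_closed[OF x(1)], of "int M" N] gxM by simp
    finally show ?thesis using x(1) by (simp add: int_pow_pow)
  qed
  define P where "P = M * M"
  define R where "R = nat (N * N)"
  have NN: "N * N = int R" by (simp add: R_def)
  have rel: "(g \<otimes> g) \<otimes> x [^] P = x [^] R \<otimes> (g \<otimes> g)"
  proof -
    have "(g \<otimes> g) \<otimes> x [^] P \<otimes> inv (g \<otimes> g) = x [^] R"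
      using twice unfolding NN P_def by (simp flip: int_pow_int)
    then show ?thesis using inv_solve_right[of "x [^] R" "g \<otimes> g \<otimes> x [^] P" "g \<otimes> g"] gc x(1) by auto
  qed
  have "N \<noteq> 0"
  proof
    assume "N = 0"
    then have "(g \<otimes> x \<otimes> inv g) [^] int M = \<one> [^] int M" using gxM conj_pow by simp
    then have "g \<otimes> x \<otimes> inv g = \<one>" using roots[of "g \<otimes> x \<otimes> inv g" \<one> "int M"] gc x(1) MN(1) by simp
    then have "g \<otimes> x = g" using inv_solve_right[of \<one> "g \<otimes> x" g] gc x(1) by auto
    then show False using x1 gc x(1) by simp
  qed
  then have pos: "P > 0" "R > 0" using MN(1) by (auto simp: P_def R_def zero_less_mult_iff)
  have "P \<noteq> R"
  proof
    assume "P = R"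
    then have "int M * int M = N * N" using NN by (simp add: P_def flip: of_nat_mult)
    then have "\<bar>N\<bar> = int M" by (metis abs_mult_self_eq abs_of_nat abs_eq_iff' power2_eq_iff power2_eq_square)
    then show False using \<open>\<bar>N\<bar> \<noteq> int M\<close> by simp
  qed
  then consider "P < R" | "R < P" by linarith
  then show ?thesis
  proof cases
    case 1
    then have "R_group_with_distortion G (g \<otimes> g) x P R"
      using gc x(1) x1 rel pos R by unfold_locales simp_all
    then show ?thesis by (rule that)
  next
    case 2
    \<comment> \<open>The inverse of the conjugating element exchanges the exponents, so the larger
      one can always be taken as n.\<close>
    have "inv (g \<otimes> g) \<otimes> x [^] R = x [^] P \<otimes> inv (g \<otimes> g)"
    proof -
      have "inv (g \<otimes> g) \<otimes> x [^] R = inv (g \<otimes> g) \<otimes> (x [^] R \<otimes> (g \<otimes> g)) \<otimes> inv (g \<otimes> g)"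
        using gc x(1) by (simp add: m_assoc)
      also have "\<dots> = x [^] P \<otimes> inv (g \<otimes> g)"
        unfolding rel[symmetric] using gc x(1) inv_mult_cancel(1)[of "g \<otimes> g" "x [^] P"] by simp
      finally show ?thesis .
    qed
    then have "R_group_with_distortion G (inv (g \<otimes> g)) x R P"
      using gc x(1) x1 pos R 2 by unfold_locales simp_all
    then show ?thesis by (rule that)
  qed
qed

end

section \<open>The dual cocycle and its potential\<close>

lemma sum_sum_list: "(\<Sum>y\<in>A. \<Sum>z\<leftarrow>xs. g z y) = (\<Sum>z\<leftarrow>xs. \<Sum>y\<in>A. g z y :: real)"
  by (induction xs) (auto simp: sum.distrib)

text \<open>The relator runs over \<open>P0\<close> and is filled over \<open>Q0\<close>; the
  potential lives over \<open>P1\<close>, whose closed lifts are filled over \<open>Q1\<close>. The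
  margin in \<open>Q0_P1\<close> puts all squares around an edge into \<open>P1\<close> as soon as
  one of them is in \<open>Q0\<close>.\<close>

locale distorted_lattice_cover = lattice_cover G l + distorted_subgroup G H \<kappa> v \<mu> t y m n
  for G :: "('g, 'm) monoid_scheme" (structure) and l H \<kappa> v \<mu> t y m n +
  fixes P0 Q0 P1 Q1 :: "(int^3) set"
  assumes flat: "flat_on Q1"
    and bounding0: "bounding P0 Q0" and bounding1: "bounding P1 Q1"
    and full: "full_holonomy P0"
    and P0_P1: "P0 \<subseteq> P1" and P1_Q1: "P1 \<subseteq> Q1"
    and Q0_P1: "\<And>q q'. q \<in> Q0 \<Longrightarrow> (\<And>i. \<bar>q' $ i - q $ i\<bar> \<le> 2) \<Longrightarrow> q' \<in> P1"
begin

lemma H_carrier [simp]: "h \<in> H \<Longrightarrow> h \<in> carrier G"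
  using H subgroup.mem_carrier by metis

lemma H_closed [simp]: "g \<in> H \<Longrightarrow> h \<in> H \<Longrightarrow> g \<otimes> h \<in> H" "\<one> \<in> H" "h \<in> H \<Longrightarrow> inv h \<in> H"
  using H by (auto simp: subgroup_def)

lemma \<mu>_pos [simp]: "\<mu> > 0" "\<mu> \<noteq> 0" using \<mu>(2) by linarith+

lemma \<kappa>_one [simp]: "\<kappa> \<one> = 0"
  using \<kappa>_mult[of \<one> \<one>] by simp

lemma v_one [simp]: "v \<one> = 0"
  using v_mult[of \<one> \<one>] by simp

lemma \<kappa>_inv: "h \<in> H \<Longrightarrow> \<kappa> (inv h) = - \<kappa> h"
  using \<kappa>_mult[of h "inv h"] by simp

lemma v_inv: "h \<in> H \<Longrightarrow> v (inv h) = - (\<mu> powi (- \<kappa> h) * v h)"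
proof -
  assume h: "h \<in> H"
  have "0 = v (inv h) + \<mu> powi (- \<kappa> h) * v h"
    using v_mult[of "inv h" h] h by (simp add: \<kappa>_inv)
  then show ?thesis by simp
qed

lemma nat_pow_H [simp]: "h \<in> H \<Longrightarrow> h [^] (k::nat) \<in> H"
  by (induction k) auto

lemma int_pow_H [simp]: "h \<in> H \<Longrightarrow> h [^] (k::int) \<in> H"
  by (cases k rule: int_cases2) (auto simp: int_pow_int int_pow_neg_int)

lemma \<kappa>_nat_pow: "h \<in> H \<Longrightarrow> \<kappa> (h [^] (k::nat)) = int k * \<kappa> h"
  by (induction k) (auto simp: \<kappa>_mult algebra_simps)

lemma \<kappa>_int_pow: "h \<in> H \<Longrightarrow> \<kappa> (h [^] (k::int)) = k * \<kappa> h"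
  by (cases k rule: int_cases2) (auto simp: int_pow_int int_pow_neg_int \<kappa>_nat_pow \<kappa>_inv)

lemma v_t_nat_pow: "v (t [^] (k::nat)) = 0"
  by (induction k) (auto simp: v_mult t \<kappa>_nat_pow)

lemma v_t_pow [simp]: "v (t [^] (k::int)) = 0"
  by (cases k rule: int_cases2) (auto simp: int_pow_int int_pow_neg_int v_t_nat_pow v_inv t)

lemma \<kappa>_t_pow [simp]: "\<kappa> (t [^] (k::int)) = k"
  by (simp add: \<kappa>_int_pow t)

section \<open>Equivariant coordinates with respect to the distorted subgroup\<close>

definition rep :: "'g \<Rightarrow> 'g" where
  "rep g = (if g \<in> H then \<one> else SOME g'. g' \<in> H #> g)"

text \<open>Because \<open>rep\<close> is \<one> on \<open>H\<close>, this is an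
  \<open>H\<close>-equivariant retraction of the group onto \<open>H\<close>. Through it
  \<open>\<kappa>\<close> and \<open>v\<close> extend to all vertices as \<open>K\<close> and
  \<open>p\<close>.\<close>

definition \<eta> :: "'g \<Rightarrow> 'g" where
  "\<eta> g = g \<otimes> inv (rep g)"

lemma coset_shift: "g \<in> carrier G \<Longrightarrow> h \<in> H \<Longrightarrow> H #> (h \<otimes> g) = H #> g"
  using H by (metis coset_mult_assoc coset_join2 H_carrier subgroup.subset)

lemma rep_in_coset: "g \<in> carrier G \<Longrightarrow> rep g \<in> H #> g"
proof -
  assume g: "g \<in> carrier G"
  show ?thesis
  proof (cases "g \<in> H")
    case True
    then have "H #> g = H" using H coset_join2 by auto
    then show ?thesis using True by (simp add: rep_def)
  next
    case False
    have "g \<in> H #> g" using g H rcos_self by auto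
    then show ?thesis using False by (simp add: rep_def) (metis someI)
  qed
qed

lemma rep_carrier [simp]: "g \<in> carrier G \<Longrightarrow> rep g \<in> carrier G"
  using rep_in_coset[of g] by (auto simp: r_coset_def)

lemma \<eta>_in [simp]: "g \<in> carrier G \<Longrightarrow> \<eta> g \<in> H"
proof -
  assume g: "g \<in> carrier G"
  then obtain h where h: "h \<in> H" "rep g = h \<otimes> g"
    using rep_in_coset by (auto simp: r_coset_def)
  then have "\<eta> g = inv h"
    using g by (simp add: \<eta>_def inv_mult_group m_assoc[symmetric])
  then show ?thesis using h by simp
qed

lemma H_mult_iff: "g \<in> carrier G \<Longrightarrow> h \<in> H \<Longrightarrow> h \<otimes> g \<in> H \<longleftrightarrow> g \<in> H"
proof -
  assume g: "g \<in> carrier G" "h \<in> H"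
  show ?thesis
proof
  assume "h \<otimes> g \<in> H"
  then have "inv h \<otimes> (h \<otimes> g) \<in> H" using g by simp
  then show "g \<in> H" using g by (simp add: m_assoc[symmetric])
qed (use g in simp)
qed

lemma rep_shift: "g \<in> carrier G \<Longrightarrow> h \<in> H \<Longrightarrow> rep (h \<otimes> g) = rep g"
  by (simp add: rep_def coset_shift H_mult_iff)

lemma \<eta>_shift: "g \<in> carrier G \<Longrightarrow> h \<in> H \<Longrightarrow> \<eta> (h \<otimes> g) = h \<otimes> \<eta> g"
  by (simp add: \<eta>_def rep_shift m_assoc)

lemma \<eta>_id: "h \<in> H \<Longrightarrow> \<eta> h = h"
  by (simp add: \<eta>_def rep_def)

definition K :: "'g vertex \<Rightarrow> int" where "K x = \<kappa> (\<eta> (snd x))"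
definition p :: "'g vertex \<Rightarrow> real" where "p x = v (\<eta> (snd x))"

lemma K_shift [simp]: "x \<in> X \<Longrightarrow> h \<in> H \<Longrightarrow> K (shift h x) = \<kappa> h + K x"
  by (simp add: K_def shift_def X_def \<eta>_shift \<kappa>_mult)

lemma p_shift [simp]: "x \<in> X \<Longrightarrow> h \<in> H \<Longrightarrow> p (shift h x) = v h + \<mu> powi \<kappa> h * p x"
  by (simp add: p_def shift_def X_def \<eta>_shift v_mult)

definition same_orbit :: "'g vertex \<Rightarrow> 'g vertex \<Rightarrow> bool" where
  "same_orbit x z \<longleftrightarrow> (\<exists>h\<in>H. x = shift h z)"

lemma shift_inv_cancel [simp]: "x \<in> X \<Longrightarrow> h \<in> carrier G \<Longrightarrow> shift (inv h) (shift h x) = x"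
  by simp

lemma same_orbit_sym:
  assumes "z \<in> X" "same_orbit x z"
  shows "same_orbit z x"
proof -
  obtain h where h: "h \<in> H" "x = shift h z" using assms by (auto simp: same_orbit_def)
  then have "z = shift (inv h) x" using assms by simp
  then show ?thesis using h by (auto simp: same_orbit_def)
qed

lemma same_orbit_shift2:
  assumes "z \<in> X" "h \<in> H"
  shows "same_orbit x (shift h z) \<longleftrightarrow> same_orbit x z"
proof
  assume "same_orbit x (shift h z)"
  then obtain g where "g \<in> H" "x = shift g (shift h z)" by (auto simp: same_orbit_def)
  then show "same_orbit x z" using assms by (auto simp: same_orbit_def intro!: bexI[of _ "g \<otimes> h"])
next
  assume "same_orbit x z"
  then obtain g where "g \<in> H" "x = shift g z" by (auto simp: same_orbit_def)
  then show "same_orbit x (shift h z)"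
    using assms by (auto simp: same_orbit_def m_assoc intro!: bexI[of _ "g \<otimes> inv h"])
qed

lemma same_orbit_shift: "x \<in> X \<Longrightarrow> z \<in> X \<Longrightarrow> h \<in> H \<Longrightarrow> same_orbit (shift h x) z \<longleftrightarrow> same_orbit x z"
  by (meson H_carrier same_orbit_shift2 same_orbit_sym shift_in)

lemma same_orbit_fwd:
  assumes "x \<in> X" "z \<in> X"
  shows "same_orbit (fwd i x) z \<longleftrightarrow> same_orbit x (bwd i z)"
proof
  assume "same_orbit (fwd i x) z"
  then obtain g where g: "g \<in> H" "fwd i x = shift g z" by (auto simp: same_orbit_def)
  then have "x = bwd i (shift g z)" using assms bwd_fwd by metis
  then show "same_orbit x (bwd i z)" using g assms by (auto simp: same_orbit_def bwd_shift)
next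
  assume "same_orbit x (bwd i z)"
  then obtain g where g: "g \<in> H" "x = shift g (bwd i z)" by (auto simp: same_orbit_def)
  then have "fwd i x = shift g z" using assms by (simp add: fwd_shift)
  then show "same_orbit (fwd i x) z" using g by (auto simp: same_orbit_def)
qed

text \<open>The sum over h in \<open>H\<close> of \<mu>^(\<kappa> h) times the indicator of x = h z.
  The action is free, so at most one h contributes, and for it \<kappa> h = K x - K z.\<close>

definition weight :: "'g vertex \<Rightarrow> 'g vertex \<Rightarrow> real" where
  "weight x z = (if same_orbit x z then \<mu> powi (K x - K z) else 0)"

lemma weight_fwd: "x \<in> X \<Longrightarrow> z \<in> X \<Longrightarrow> weight (fwd i x) z = weight x (bwd i z)"
proof -
  assume x: "x \<in> X" and z: "z \<in> X"
  have "K (fwd i x) - K z = K x - K (bwd i z)" if "same_orbit x (bwd i z)"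
    using that x z by (auto simp: same_orbit_def fwd_shift)
  then show ?thesis using x z by (simp add: weight_def same_orbit_fwd)
qed

lemma weight_shift: "x \<in> X \<Longrightarrow> z \<in> X \<Longrightarrow> h \<in> H \<Longrightarrow> weight (shift h x) z = \<mu> powi \<kappa> h * weight x z"
  by (simp add: weight_def same_orbit_shift) (simp add: add_diff_eq[symmetric] power_int_add)

lemma weight_shift2: "x \<in> X \<Longrightarrow> z \<in> X \<Longrightarrow> h \<in> H \<Longrightarrow> weight x (shift h z) = \<mu> powi (- \<kappa> h) * weight x z"
proof -
  assume "x \<in> X" "z \<in> X" "h \<in> H"
  moreover have "\<mu> powi (K x - (\<kappa> h + K z)) = \<mu> powi (- \<kappa> h) * \<mu> powi (K x - K z)"
    by (subst power_int_add[symmetric]) (simp_all add: algebra_simps)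
  ultimately show ?thesis by (simp add: weight_def same_orbit_shift2)
qed

section \<open>The relator as a lattice word, and the values of cochains on it\<close>

lemma word_power:
  assumes "lift_end base w = (0, g)" "g \<in> carrier G"
  shows "lift_end base (concat (replicate k w)) = (0, g [^] (k::nat))"
proof (induction k)
  case (Suc k)
  have w: "lift_end base w = shift g base"
    using assms by (simp add: base_def shift_def)
  have "lift_end base (concat (replicate (Suc k) w)) = lift_end (lift_end base w) (concat (replicate k w))"
    by simp
  also have "\<dots> = shift g (lift_end base (concat (replicate k w)))"
    unfolding w using assms by (simp add: lift_end_shift)
  also have "\<dots> = (0, g [^] Suc k)"
    unfolding nat_pow_Suc2[OF assms(2)] using Suc assms by (simp add: shift_def)
  finally show ?case .
qed (simp add: base_def)

lemma stays_power:
  assumes "stays P 0 w" "displacement w = 0"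
  shows "stays P 0 (concat (replicate k w)) \<and> displacement (concat (replicate k w)) = 0"
  using assms by (induction k) (auto simp: stays_append dest: stays_start)

definition word_of :: "'g \<Rightarrow> lattice_word" where
  "word_of g = (SOME w. stays P0 0 w \<and> lift_end base w = (0, g))"

lemma word_of:
  assumes "g \<in> carrier G"
  shows "stays P0 0 (word_of g)" "lift_end base (word_of g) = (0, g)" "displacement (word_of g) = 0"
proof -
  have "\<exists>w. stays P0 0 w \<and> lift_end base w = (0, g)"
    using full assms by (simp add: full_holonomy_def)
  from someI_ex[OF this] show *: "stays P0 0 (word_of g)" "lift_end base (word_of g) = (0, g)"
    by (auto simp: word_of_def)
  then show "displacement (word_of g) = 0"
    by (metis add_0 fst_conv fst_lift_end fst_simps(4))
qed

definition left_word :: lattice_word where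
  "left_word = word_of t @ concat (replicate m (word_of y))"

definition right_word :: lattice_word where
  "right_word = concat (replicate n (word_of y)) @ word_of t"

definition rel_word :: lattice_word where
  "rel_word = left_word @ word_inv right_word"

lemma zero_eq_shift: "g \<in> carrier G \<Longrightarrow> (0, g) = shift g base"
  by (simp add: shift_def base_def)

lemma lift_end_left: "lift_end base left_word = (0, t \<otimes> y [^] m)"
  unfolding left_word_def lift_end_append word_of(2)[OF H_carrier[OF t(1)]]
    zero_eq_shift[OF H_carrier[OF t(1)]]
  by (simp add: lift_end_shift t y word_power[OF word_of(2)]) (simp add: shift_def)

lemma lift_end_right: "lift_end base right_word = (0, y [^] n \<otimes> t)"
  unfolding right_word_def lift_end_append word_power[OF word_of(2)[OF H_carrier[OF y(1)]] H_carrier[OF y(1)]]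
  by (subst zero_eq_shift) (simp_all add: lift_end_shift t y word_of, simp add: shift_def)

lemma rel_word_closed: "lift_end base rel_word = base"
  by (metis base_in lift_end_append lift_end_left lift_end_right lift_end_word_inv rel rel_word_def)

lemma stays_rel_word: "stays P0 0 rel_word"
proof -
  have "stays P0 0 left_word" "displacement left_word = 0"
    unfolding left_word_def using word_of[of t] word_of[of y] stays_power[OF word_of(1,3), of y m] t y
    by (auto simp: stays_append)
  moreover have "stays P0 0 right_word" "displacement right_word = 0"
    unfolding right_word_def using word_of[of t] word_of[of y] stays_power[OF word_of(1,3), of y n] t y
    by (auto simp: stays_append)
  ultimately show ?thesis
    using stays_word_inv[of P0 0 right_word] by (simp add: rel_word_def stays_append)
qed

lemma path_sum_rel_word:
  "path_sum \<beta> base rel_word = path_sum \<beta> base left_word - path_sum \<beta> base right_word"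
  using path_sum_word_inv[of base \<beta> right_word]
  by (simp add: rel_word_def path_sum_append lift_end_left lift_end_right rel)

lemma path_sum_power:
  assumes "\<And>i x. x \<in> X \<Longrightarrow> \<beta> i (shift y x) = \<beta> i x"
  shows "path_sum \<beta> base (concat (replicate k (word_of y))) = real k * path_sum \<beta> base (word_of y)"
proof (induction k)
  case (Suc k)
  have "path_sum \<beta> base (concat (replicate (Suc k) (word_of y))) =
     path_sum \<beta> base (word_of y) + path_sum \<beta> (shift y base) (concat (replicate k (word_of y)))"
    using y by (simp add: path_sum_append word_of flip: zero_eq_shift)
  then show ?case
    using Suc y path_sum_equivariant[of \<beta> y 1 base] assms by (simp add: algebra_simps)
qed simp

text \<open>Both sides of the relator contain the word of t once. The left side has m copies of the
  word of y scaled by \<mu>, the right side n unscaled ones, and \<mu> m = n. This is why a filling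
  of the relator becomes a cycle after the weighted sum.\<close>

lemma path_sum_rel_word_equivariant:
  assumes "\<And>i x h. x \<in> X \<Longrightarrow> h \<in> H \<Longrightarrow> \<beta> i (shift h x) = \<mu> powi \<kappa> h * \<beta> i x"
  shows "path_sum \<beta> base rel_word = 0"
proof -
  have inv: "\<beta> i (shift (y [^] k) x) = \<beta> i x" if "x \<in> X" for i x and k :: nat
    using assms[OF that, of "y [^] (k::nat)"] y by (simp add: \<kappa>_nat_pow)
  have inv1: "\<beta> i (shift y x) = \<beta> i x" if "x \<in> X" for i x
    using assms[OF that, of y] y by simp
  have "path_sum \<beta> base left_word = path_sum \<beta> base (word_of t) + \<mu> * (real m * path_sum \<beta> base (word_of y))"
    using t path_sum_equivariant[of \<beta> t \<mu> base] assms[of _ t]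
    by (simp add: left_word_def path_sum_append word_of zero_eq_shift path_sum_power inv1)
  moreover have "path_sum \<beta> base right_word = real n * path_sum \<beta> base (word_of y) + path_sum \<beta> base (word_of t)"
    using y path_sum_equivariant[of \<beta> "y [^] n" 1 base] inv[of _ _ n]
    by (simp add: right_word_def path_sum_append word_power[OF word_of(2)] zero_eq_shift path_sum_power inv1)
  ultimately show ?thesis
    using m \<mu>(1) by (simp add: path_sum_rel_word)
qed

text \<open>The group cocycle \<open>(g, h) \<mapsto> \<kappa> g \<cdot> v h\<close>, evaluated on the relator.\<close>

definition \<theta> :: "'g cochain" where
  "\<theta> i x = of_int (K x) * (p (fwd i x) - p x)"

text \<open>The additional multiple of dp is the failure of equivariance. It vanishes for h in the
  kernel of \<open>\<kappa>\<close>.\<close>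

lemma \<theta>_shift:
  "x \<in> X \<Longrightarrow> h \<in> H \<Longrightarrow> \<theta> i (shift h x) = \<mu> powi \<kappa> h * (\<theta> i x + \<kappa> h * (p (fwd i x) - p x))"
  by (simp add: \<theta>_def fwd_shift algebra_simps)

lemma path_sum_\<theta>_shift:
  assumes "x \<in> X" "h \<in> H"
  shows "path_sum \<theta> (shift h x) w = \<mu> powi \<kappa> h * (path_sum \<theta> x w + \<kappa> h * (p (lift_end x w) - p x))"
  using assms(1)
proof (induction w arbitrary: x)
  case (Cons s w)
  have *: "path_sum \<theta> (shift h (move s x)) w =
     \<mu> powi \<kappa> h * (path_sum \<theta> (move s x) w + \<kappa> h * (p (lift_end (move s x) w) - p (move s x)))"
    using Cons by simp
  show ?case
  proof (cases "snd s")
    case True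
    then have "move s x = fwd (fst s) x" by (simp add: move_def)
    then show ?thesis using Cons.prems True * assms(2)
      by (simp add: move_shift \<theta>_shift algebra_simps)
  next
    case False
    then have "move s x = bwd (fst s) x" by (simp add: move_def)
    then show ?thesis using Cons.prems False * assms(2)
      by (simp add: move_shift \<theta>_shift bwd_shift algebra_simps)
  qed
qed simp

text \<open>The path sums over the words of t and y cancel as for an equivariant cochain. What
  remains is the defect of the copies of y that are traversed after t, namely \<mu> v(y^m) = \<mu>
  m.\<close>

lemma path_sum_rel_word_\<theta>: "path_sum \<theta> base rel_word = real n"
proof -
  have pb: "p base = 0" "p (shift h base) = v h" if "h \<in> H" for h
    using that by (simp_all add: p_def base_def \<eta>_id shift_def)
  have y_inv: "\<theta> i (shift y x) = \<theta> i x" if "x \<in> X" for i x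
    using \<theta>_shift[OF that, of y] y by simp
  have vy: "v (y [^] k) = real k" for k :: nat
    by (induction k) (auto simp: v_mult y \<kappa>_nat_pow)
  have yy: "path_sum \<theta> base (concat (replicate k (word_of y))) = real k * path_sum \<theta> base (word_of y)" for k
    by (rule path_sum_power) (rule y_inv)
  have "path_sum \<theta> base left_word = path_sum \<theta> base (word_of t) + path_sum \<theta> (shift t base) (concat (replicate m (word_of y)))"
    using t by (simp add: left_word_def path_sum_append word_of flip: zero_eq_shift)
  also have "\<dots> = path_sum \<theta> base (word_of t) + \<mu> * (real m * path_sum \<theta> base (word_of y) + real m)"
    using t y pb
    by (simp add: path_sum_\<theta>_shift yy word_power[OF word_of(2)] zero_eq_shift vy)
  finally have 1: "path_sum \<theta> base left_word = \<dots>" .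
  have "path_sum \<theta> base right_word = real n * path_sum \<theta> base (word_of y) + path_sum \<theta> (shift (y [^] n) base) (word_of t)"
    using y by (simp add: right_word_def path_sum_append word_power[OF word_of(2)] yy flip: zero_eq_shift)
  also have "\<dots> = real n * path_sum \<theta> base (word_of y) + path_sum \<theta> base (word_of t)"
    using y by (simp add: path_sum_\<theta>_shift \<kappa>_nat_pow)
  finally show ?thesis
    using 1 m \<mu>(1) by (simp add: path_sum_rel_word algebra_simps)
qed

section \<open>The component of the base vertex and the dual cochain on it\<close>

definition Y :: "'g vertex set" where
  "Y = {x. \<exists>w. stays P1 0 w \<and> lift_end base w = x}"

lemma Q0_subset: "q \<in> Q0 \<Longrightarrow> q \<in> P1"
  by (rule Q0_P1) auto

lemma Y_in: "x \<in> Y \<Longrightarrow> x \<in> X" "x \<in> Y \<Longrightarrow> fst x \<in> P1"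
  by (auto simp: Y_def dest: stays_end)

lemma lift_end_Y: "x \<in> Y \<Longrightarrow> stays P1 (fst x) w \<Longrightarrow> lift_end x w \<in> Y"
proof -
  assume x: "x \<in> Y" and w: "stays P1 (fst x) w"
  then obtain u where u: "stays P1 0 u" "lift_end base u = x" by (auto simp: Y_def)
  then have "fst x = displacement u" by auto
  then have "stays P1 0 (u @ w)" using u w by (simp add: stays_append)
  then show ?thesis using u by (auto simp: Y_def intro!: exI[of _ "u @ w"])
qed

lemma Y_fwd: "x \<in> Y \<Longrightarrow> fst x + unit_vec i \<in> P1 \<Longrightarrow> fwd i x \<in> Y"
  using lift_end_Y[of x "[(i, True)]"] by (simp add: step_vec_def move_def Y_in)

lemma Y_bwd: "x \<in> Y \<Longrightarrow> fst x - unit_vec i \<in> P1 \<Longrightarrow> bwd i x \<in> Y"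
  using lift_end_Y[of x "[(i, False)]"] by (simp add: step_vec_def move_def Y_in)

lemma Y_fwd_iff: "x \<in> X \<Longrightarrow> fst x \<in> P1 \<Longrightarrow> fst x + unit_vec i \<in> P1 \<Longrightarrow> fwd i x \<in> Y \<longleftrightarrow> x \<in> Y"
  using Y_fwd[of x i] Y_bwd[of "fwd i x" i] by auto

lemma base_Y: "base \<in> Y"
  using stays_start[OF word_of(1)[of \<one>]] P0_P1 by (auto simp: Y_def intro!: exI[of _ "[]"])

text \<open>Full holonomy over \<open>P0\<close> joins all \<open>H\<close>-translates of the base
  vertex within one component, so \<open>Y\<close> is invariant under \<open>H\<close>.\<close>

lemma shift_base_Y: "h \<in> H \<Longrightarrow> shift h base \<in> Y"
  using word_of[of h] stays_mono[OF _ P0_P1] by (auto simp: Y_def zero_eq_shift)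

lemma Y_shift1: "x \<in> Y \<Longrightarrow> h \<in> H \<Longrightarrow> shift h x \<in> Y"
proof -
  assume x: "x \<in> Y" and h: "h \<in> H"
  then obtain u where u: "stays P1 0 u" "lift_end base u = x" by (auto simp: Y_def)
  have "lift_end (shift h base) u \<in> Y"
    using shift_base_Y[OF h] u by (intro lift_end_Y) auto
  then show ?thesis using u h by (simp add: lift_end_shift)
qed

lemma Y_shift: "x \<in> X \<Longrightarrow> h \<in> H \<Longrightarrow> shift h x \<in> Y \<longleftrightarrow> x \<in> Y"
  using Y_shift1[of x h] Y_shift1[of "shift h x" "inv h"] by auto

definition restrict_Y :: "'g cochain \<Rightarrow> 'g cochain" where
  "restrict_Y \<beta> i x = (if x \<in> Y then \<beta> i x else 0)"

lemma square_in_P1: "square_in Q0 k q \<Longrightarrow> square_in P1 k q"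
  by (auto simp: square_in_def Q0_subset)

lemma square_in_Q1: "square_in P1 k q \<Longrightarrow> square_in Q1 k q"
  using P1_Q1 by (auto simp: square_in_def)

text \<open>The corners over \<open>x\<close> are joined by edges over \<open>P1\<close>, so they
  lie in \<open>Y\<close> all together or not at all.\<close>

lemma curl_restrict_Y:
  assumes "x \<in> X" "square_in P1 k (fst x)"
  shows "curl (restrict_Y \<beta>) k x = (if x \<in> Y then curl \<beta> k x else 0)"
  using assms by (auto simp: curl_def restrict_Y_def square_in_def Y_fwd_iff)

lemma path_sum_restrict_Y:
  "x \<in> Y \<Longrightarrow> stays P1 (fst x) w \<Longrightarrow> path_sum (restrict_Y \<beta>) x w = path_sum \<beta> x w"
proof (induction w arbitrary: x)
  case (Cons s w)
  then have "move s x \<in> Y"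
    using lift_end_Y[of x "[s]"] stays_start[of P1 "fst x + step_vec s" w] by (auto simp: Y_in)
  then show ?case
    using Cons by (auto simp: restrict_Y_def move_def step_vec_def split: if_splits)
qed simp

definition chain0 :: "(real \<times> 3 \<times> 'g vertex) list" where
  "chain0 = (SOME rs. (\<forall>(s, k, x) \<in> set rs. x \<in> X \<and> square_in Q0 k (fst x)) \<and>
        (\<forall>\<beta>. path_sum \<beta> base rel_word = (\<Sum>(s, k, x)\<leftarrow>rs. s * curl \<beta> k x)))"

text \<open>Squares off \<open>Y\<close> are discarded, so that \<open>Z\<close> vanishes off
  \<open>Y\<close> and the potential can be extended by zero without spoiling
  \<open>f_fwd\<close>.\<close>

definition chain :: "(real \<times> 3 \<times> 'g vertex) list" where
  "chain = filter (\<lambda>(s, k, x). x \<in> Y) chain0"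

lemma chain0:
  "(s, k, x) \<in> set chain0 \<Longrightarrow> x \<in> X \<and> square_in Q0 k (fst x)"
  "path_sum \<beta> base rel_word = (\<Sum>(s, k, x)\<leftarrow>chain0. s * curl \<beta> k x)"
proof -
  have "\<exists>rs. (\<forall>(s, k, x) \<in> set rs. x \<in> X \<and> square_in Q0 k (fst x)) \<and>
        (\<forall>\<beta>. path_sum \<beta> base rel_word = (\<Sum>(s, k, x)\<leftarrow>rs. s * curl \<beta> k x))"
    using bounding0 stays_rel_word rel_word_closed by (auto simp: bounding_def)
  from someI_ex[OF this, folded chain0_def]
  show "(s, k, x) \<in> set chain0 \<Longrightarrow> x \<in> X \<and> square_in Q0 k (fst x)"
    "path_sum \<beta> base rel_word = (\<Sum>(s, k, x)\<leftarrow>chain0. s * curl \<beta> k x)"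
    by auto
qed

lemma chain_in:
  assumes "(s, k, x) \<in> set chain"
  shows "x \<in> X" "x \<in> Y" "square_in Q0 k (fst x)"
  using assms chain0(1)[of s k x] by (auto simp: chain_def)

lemma sum_chain: "(\<Sum>(s, k, x)\<leftarrow>chain. s * curl \<beta> k x) = path_sum \<beta> base rel_word"
proof -
  have "(\<Sum>(s, k, x)\<leftarrow>chain. s * curl \<beta> k x) = (\<Sum>(s, k, x)\<leftarrow>chain0. s * curl (restrict_Y \<beta>) k x)"
    unfolding chain_def
  proof (subst sum_list_map_filter')
    show "(\<Sum>z\<leftarrow>chain0. if case z of (s, k, x) \<Rightarrow> x \<in> Y then case z of (s, k, x) \<Rightarrow> s * curl \<beta> k x else 0) =
        (\<Sum>(s, k, x)\<leftarrow>chain0. s * curl (restrict_Y \<beta>) k x)"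
    proof (rule arg_cong[of _ _ sum_list], rule map_cong[OF refl])
      fix z assume "z \<in> set chain0"
      then show "(if case z of (s, k, x) \<Rightarrow> x \<in> Y then case z of (s, k, x) \<Rightarrow> s * curl \<beta> k x else 0) =
         (case z of (s, k, x) \<Rightarrow> s * curl (restrict_Y \<beta>) k x)"
        using chain0(1)[of "fst z" "fst (snd z)" "snd (snd z)"]
        by (simp add: case_prod_unfold curl_restrict_Y square_in_P1)
    qed
  qed
  also have "\<dots> = path_sum (restrict_Y \<beta>) base rel_word"
    by (rule chain0(2)[symmetric])
  also have "\<dots> = path_sum \<beta> base rel_word"
    using base_Y stays_mono[OF stays_rel_word P0_P1] by (intro path_sum_restrict_Y) auto
  finally show ?thesis .
qed

text \<open>A square with minimal corner \<open>x\<close> and normal direction \<open>k\<close> is dual to an edge between two cubes, and a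
  cube is identified with its minimal corner: \<open>Z k x\<close> is the coefficient of the dual edge from the
  cube \<open>bwd k x\<close> to the cube \<open>x\<close>.\<close>

definition Z :: "'g cochain" where
  "Z i x = (\<Sum>(s, k, x')\<leftarrow>chain. if k = i then s * weight x' x else 0)"

lemma Z_shift: "x \<in> X \<Longrightarrow> h \<in> H \<Longrightarrow> Z i (shift h x) = \<mu> powi (- \<kappa> h) * Z i x"
  unfolding Z_def sum_list_const_mult[symmetric]
  by (rule arg_cong[of _ _ sum_list], rule map_cong[OF refl])
     (auto simp: weight_shift2 chain_in(1))

lemma Z_nonzero:
  assumes "Z i x \<noteq> 0"
  obtains s x' where "(s, i, x') \<in> set chain" "same_orbit x' x"
proof -
  have "\<exists>(s, k, x') \<in> set chain. k = i \<and> weight x' x \<noteq> 0"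
  proof (rule ccontr)
    assume "\<not> ?thesis"
    then have "Z i x = (\<Sum>z\<leftarrow>chain. 0)"
      unfolding Z_def by (intro arg_cong[of _ _ sum_list] map_cong[OF refl]) auto
    then show False using assms by simp
  qed
  then show ?thesis using that by (auto simp: weight_def split: if_splits)
qed

lemma Z_nonzero_square:
  assumes "Z i x \<noteq> 0"
  shows "square_in Q0 i (fst x)" "x \<in> X \<Longrightarrow> x \<in> Y"
proof -
  obtain s x' where x': "(s, i, x') \<in> set chain" "same_orbit x' x" by (rule Z_nonzero[OF assms])
  then show "square_in Q0 i (fst x)" using chain_in(3)[OF x'(1)] by (auto simp: same_orbit_def)
  show "x \<in> Y" if "x \<in> X" using chain_in(2)[OF x'(1)] x'(2) that by (auto simp: same_orbit_def Y_shift)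
qed

text \<open>Stokes' formula is applied to the equivariant cochain concentrated on the orbit of the
  edge at \<open>z\<close> in direction \<open>i\<close>. Its sum along the relator is zero, and its
  curl picks out the four squares that contain this edge.\<close>

lemma Z_closed:
  assumes z: "z \<in> X"
  shows "Z (i+2) z - Z (i+2) (bwd (i+1) z) + Z (i+1) (bwd (i+2) z) - Z (i+1) z = 0"
proof -
  define \<beta> where "\<beta> j x = (if j = i then weight x z else 0)" for j x
  have "\<beta> j (shift h x) = \<mu> powi \<kappa> h * \<beta> j x" if "x \<in> X" "h \<in> H" for j x h
    using that z by (simp add: \<beta>_def weight_shift)
  then have "0 = (\<Sum>(s, k, x)\<leftarrow>chain. s * curl \<beta> k x)"
    by (simp add: path_sum_rel_word_equivariant sum_chain)
  also have "\<dots> = (\<Sum>(s, k, x)\<leftarrow>chain. (if k = i+2 then s * weight x z else 0)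
       - (if k = i+2 then s * weight x (bwd (i+1) z) else 0)
       + (if k = i+1 then s * weight x (bwd (i+2) z) else 0)
       - (if k = i+1 then s * weight x z else 0))"
  proof (rule arg_cong[of _ _ sum_list], rule map_cong[OF refl], clarify)
    fix s k x assume "(s, k, x) \<in> set chain"
    then have x: "x \<in> X" by (rule chain_in)
    have "k = i \<or> k = i + 1 \<or> k = i + 2"
    proof -
      have "k \<in> {i, i+1, i+2}"
        using card_seteq[of "UNIV :: 3 set" "{i, i+1, i+2}"] by (simp add: axes_mod_3)
      then show ?thesis by simp
    qed
    then show "s * curl \<beta> k x = (if k = i+2 then s * weight x z else 0)
       - (if k = i+2 then s * weight x (bwd (i+1) z) else 0)
       + (if k = i+1 then s * weight x (bwd (i+2) z) else 0)
       - (if k = i+1 then s * weight x z else 0)"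
      using x z by (elim disjE) (auto simp: curl_def \<beta>_def axes_mod_3 weight_fwd ring_distribs)
  qed
  also have "\<dots> = Z (i+2) z - Z (i+2) (bwd (i+1) z) + Z (i+1) (bwd (i+2) z) - Z (i+1) z"
    unfolding Z_def by (simp add: case_prod_unfold sum_list_addf sum_list_subtractf)
  finally show ?thesis by simp
qed

text \<open>The offset by one indexes a dual edge by the cube at which it starts, so that
  \<open>path_sum\<close> and \<open>curl\<close> apply to dual edges unchanged.\<close>

definition Z' :: "'g cochain" where
  "Z' i x = Z i (fwd i x)"

text \<open>The four dual edges around a dual square surround one lattice edge, the one in direction
  \<open>k\<close> at the far corner \<open>z\<close>; \<open>Z_closed\<close> at \<open>z\<close>
  is the claim.\<close>

lemma curl_Z':
  assumes "x \<in> X" "square_in Q1 k (fst x)"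
  shows "curl Z' k x = 0"
proof -
  define z where "z = fwd (k+2) (fwd (k+1) x)"
  have z: "z = fwd (k+1) (fwd (k+2) x)" "z \<in> X"
    using assms fwd_commute[OF flat] by (auto simp: z_def)
  have "fwd (k+2) x = bwd (k+1) z"
    using assms by (simp add: z(1))
  moreover have "fwd (k+1) x = bwd (k+2) z"
    using assms by (simp add: z_def)
  ultimately show ?thesis
    using Z_closed[OF z(2), of k] z(1) z_def by (simp add: curl_def Z'_def)
qed

lemma path_sum_Z'_closed:
  assumes "stays P1 0 w" "lift_end base w = base"
  shows "path_sum Z' base w = 0"
proof -
  obtain rs :: "(real \<times> 3 \<times> 'g vertex) list" where
    rs: "\<forall>(s, k, x) \<in> set rs. x \<in> X \<and> square_in Q1 k (fst x)"
      "\<forall>\<beta>. path_sum \<beta> base w = (\<Sum>(s, k, x)\<leftarrow>rs. s * curl \<beta> k x)"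
    using bounding1 assms unfolding bounding_def by blast
  have "(\<Sum>(s, k, x)\<leftarrow>rs. s * curl Z' k x) = (\<Sum>z\<leftarrow>rs. 0)"
    using rs(1) curl_Z' by (intro arg_cong[of _ _ sum_list] map_cong[OF refl]) auto
  then show ?thesis using rs(2) by simp
qed

section \<open>The potential and its equivariance\<close>

definition f0 :: "'g vertex \<Rightarrow> real" where
  "f0 x = path_sum Z' base (SOME w. stays P1 0 w \<and> lift_end base w = x)"

lemma f0_eq:
  assumes "stays P1 0 w" "lift_end base w = x"
  shows "f0 x = path_sum Z' base w"
proof -
  define u where "u = (SOME w. stays P1 0 w \<and> lift_end base w = x)"
  have u: "stays P1 0 u" "lift_end base u = x"
    using someI_ex[of "\<lambda>w. stays P1 0 w \<and> lift_end base w = x"] assms by (auto simp: u_def)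
  have "displacement w = fst x" "displacement u = fst x"
    using fst_lift_end[of base w, unfolded assms(2)] fst_lift_end[of base u, unfolded u(2)] by simp_all
  then have "stays P1 0 (u @ word_inv w)"
    using u assms stays_word_inv[OF assms(1)] by (simp add: stays_append)
  moreover have "lift_end base (u @ word_inv w) = base"
    using u assms(2) by (metis base_in lift_end_append lift_end_word_inv)
  ultimately have "path_sum Z' base (u @ word_inv w) = 0"
    by (rule path_sum_Z'_closed)
  then show ?thesis
    using path_sum_word_inv[of base Z' w] u assms by (simp add: path_sum_append f0_def u_def)
qed

lemma f0_fwd:
  assumes "x \<in> Y" "fst x + unit_vec i \<in> P1"
  shows "f0 (fwd i x) = f0 x + Z i (fwd i x)"
proof -
  obtain u where u: "stays P1 0 u" "lift_end base u = x" using assms by (auto simp: Y_def)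
  have "stays P1 0 (u @ [(i, True)])"
    using u assms Y_in(2)[OF assms(1)] by (auto simp: stays_append step_vec_def)
  then have "f0 (fwd i x) = path_sum Z' base (u @ [(i, True)])"
    by (rule f0_eq) (simp add: u move_def)
  then show ?thesis using u by (simp add: path_sum_append f0_eq[OF u] Z'_def)
qed

text \<open>A path to the translate of x by h runs along the word of h and then along the translated
  path, on which \<open>Z'\<close> is scaled. The base-point term \<open>c\<close> is thus a crossed
  homomorphism.\<close>

lemma f0_shift:
  assumes "x \<in> Y" "h \<in> H"
  shows "f0 (shift h x) = f0 (shift h base) + \<mu> powi (- \<kappa> h) * f0 x"
proof -
  obtain u where u: "stays P1 0 u" "lift_end base u = x" using assms by (auto simp: Y_def)
  have w: "stays P1 0 (word_of h)" "lift_end base (word_of h) = shift h base"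
    using assms word_of[of h] stays_mono[OF _ P0_P1] by (auto simp: zero_eq_shift)
  have "f0 (shift h x) = path_sum Z' base (word_of h @ u)"
  proof (rule f0_eq)
    show "stays P1 0 (word_of h @ u)" using w u word_of(3)[of h] assms by (simp add: stays_append)
    show "lift_end base (word_of h @ u) = shift h x" using w u assms by (simp add: lift_end_shift)
  qed
  also have "\<dots> = path_sum Z' base (word_of h) + path_sum Z' (shift h base) u"
    by (simp add: path_sum_append w)
  also have "path_sum Z' (shift h base) u = \<mu> powi (- \<kappa> h) * path_sum Z' base u"
    using assms by (intro path_sum_equivariant) (auto simp: Z'_def fwd_shift Z_shift)
  finally show ?thesis by (simp add: f0_eq[OF w] f0_eq[OF u])
qed

definition c :: "'g \<Rightarrow> real" where "c h = f0 (shift h base)"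

lemma c_mult: "g \<in> H \<Longrightarrow> h \<in> H \<Longrightarrow> c (g \<otimes> h) = c g + \<mu> powi (- \<kappa> g) * c h"
  using f0_shift[of "shift h base" g] by (simp add: c_def shift_base_Y)

lemma c_one: "c \<one> = 0" using c_mult[of \<one> \<one>] by simp

lemma c_nat_pow: "h \<in> H \<Longrightarrow> \<kappa> h = 0 \<Longrightarrow> c (h [^] (k::nat)) = real k * c h"
  by (induction k) (auto simp: c_mult c_one \<kappa>_nat_pow algebra_simps)

lemma c_inv: "h \<in> H \<Longrightarrow> c (inv h) = - (\<mu> powi (\<kappa> h) * c h)"
proof -
  assume h: "h \<in> H"
  have "c (inv h) + \<mu> powi \<kappa> h * c h = 0"
    using c_mult[of "inv h" h] h by (simp add: \<kappa>_inv c_one)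
  then show ?thesis by simp
qed

text \<open>Here \<open>\<mu>\<close> acts on the first homology of the kernel of \<open>\<kappa>\<close>, but \<open>\<mu>\<inverse>\<close> on the potential;
  the two are compatible only on the zero homomorphism because \<open>\<mu>\<^sup>2 \<noteq> 1\<close>.\<close>

lemma c_kernel:
  assumes "h \<in> H" "\<kappa> h = 0"
  shows "c h = 0"
proof -
  have "c (t \<otimes> y [^] m) = c t + inverse \<mu> * (real m * c y)"
    using t y by (simp add: c_mult c_nat_pow power_int_minus)
  moreover have "c (y [^] n \<otimes> t) = real n * c y + c t"
    using t y by (simp add: c_mult c_nat_pow \<kappa>_nat_pow)
  ultimately have "real n * c y = inverse \<mu> * (real m * c y)"
    using rel by simp
  moreover have n: "real n = \<mu> * real m" using \<mu>(1) m by simp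
  ultimately have "(\<mu> * \<mu> - 1) * (real m * c y) = 0"
    by (simp add: field_simps)
  moreover have "\<mu> * \<mu> > 1" using \<mu>(2) by (simp add: less_1_mult)
  ultimately have cy: "c y = 0" using m by simp
  obtain k :: nat and j :: int where kj: "k > 0" "h [^] k = y [^] j" using root[OF assms] by blast
  have "c (y [^] j) = 0"
    by (cases j rule: int_cases2)
       (simp_all add: int_pow_int int_pow_neg_int c_inv c_nat_pow y cy)
  then have "real k * c h = 0" using kj c_nat_pow[OF assms, of k] by simp
  then show ?thesis using kj by simp
qed

text \<open>Solves c t = C (\<mu>^-1 - 1). A crossed homomorphism that vanishes on the kernel of
  \<open>\<kappa>\<close> is determined by its value at t, so \<open>c\<close> is principal
  (\<open>c_eq\<close>), and adding \<open>C\<close> to \<open>f0\<close> absorbs it.\<close>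

definition C :: real where "C = - c t / (1 - inverse \<mu>)"

lemma c_eq:
  assumes "h \<in> H"
  shows "c h = C * (\<mu> powi (- \<kappa> h) - 1)"
proof -
  define d where "d h = c h - C * (\<mu> powi (- \<kappa> h) - 1)" for h
  have d_mult: "d (g \<otimes> h) = d g + \<mu> powi (- \<kappa> g) * d h" if "g \<in> H" "h \<in> H" for g h
  proof -
    have "\<mu> powi (- (\<kappa> g + \<kappa> h)) = \<mu> powi (- \<kappa> g) * \<mu> powi (- \<kappa> h)"
      by (subst power_int_add[symmetric]) auto
    then show ?thesis using that by (simp add: d_def c_mult \<kappa>_mult algebra_simps)
  qed
  have "inverse \<mu> \<noteq> 1" using \<mu>(2) by auto
  then have dt: "d t = 0" using t by (simp add: d_def C_def power_int_minus field_simps)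
  have d1: "d \<one> = 0" by (simp add: d_def c_one)
  have dn: "d (t [^] k) = 0" for k :: nat
    by (induction k) (auto simp: d_mult d1 dt t)
  have di: "d (inv g) = 0" if "g \<in> H" "d g = 0" for g
    using d_mult[of "inv g" g] that d1 by simp
  have dz: "d (t [^] k) = 0" for k :: int
    by (cases k rule: int_cases2) (auto simp: int_pow_int int_pow_neg_int dn di t)
  define a where "a = h \<otimes> t [^] (- \<kappa> h)"
  have a: "a \<in> H" "\<kappa> a = 0" using assms t by (auto simp: a_def \<kappa>_mult)
  have "h = a \<otimes> t [^] \<kappa> h"
    using assms t by (simp add: a_def m_assoc int_pow_mult[symmetric])
  then have "d h = d a + \<mu> powi (- \<kappa> a) * d (t [^] \<kappa> h)" using a t by (metis d_mult int_pow_H)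
  moreover have "d a = 0" using a by (simp add: d_def c_kernel)
  ultimately have "d h = 0" by (simp add: dz)
  then show ?thesis by (simp add: d_def)
qed

definition f :: "'g vertex \<Rightarrow> real" where
  "f x = (if x \<in> Y then f0 x + C else 0)"

lemma f_shift: "x \<in> X \<Longrightarrow> h \<in> H \<Longrightarrow> f (shift h x) = \<mu> powi (- \<kappa> h) * f x"
  using f0_shift[of x h] c_eq[of h] by (auto simp: f_def Y_shift c_def algebra_simps)

text \<open>Off \<open>Y\<close> both sides are zero because \<open>Z\<close> is supported in
  \<open>Y\<close>.\<close>

lemma f_fwd:
  assumes "x \<in> X" "fst x \<in> P1" "fst x + unit_vec i \<in> P1"
  shows "f (fwd i x) - f x = Z i (fwd i x)"
  using assms Z_nonzero_square(2)[of i "fwd i x"] by (auto simp: f_def Y_fwd_iff f0_fwd)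

section \<open>Truncation of the potential\<close>

definition trunc :: "real \<Rightarrow> real" where
  "trunc r = (if 1 \<le> \<bar>r\<bar> \<and> \<bar>r\<bar> < \<mu> then r else 0)"

text \<open>The range in \<open>trunc\<close> is half-open, so the orbit of a nonzero r under powers
  of \<mu> meets it exactly once; the logarithm tells where.\<close>

lemma trunc_scaled:
  assumes "r \<noteq> 0"
  shows "trunc (\<mu> powi (- j) * r) = (if j = \<lfloor>log \<mu> \<bar>r\<bar>\<rfloor> then \<mu> powi (- j) * r else 0)"
proof -
  have pos: "\<bar>\<mu> powi i\<bar> = \<mu> powi i" for i :: int
    by (rule abs_of_nonneg) (rule zero_le_power_int, use \<mu>_pos(1) in linarith)
  have "1 \<le> \<bar>\<mu> powi (- j) * r\<bar> \<longleftrightarrow> \<mu> powi j \<le> \<bar>r\<bar>"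
    using pos[of j] by (simp add: abs_mult power_int_minus field_simps)
  also have "\<dots> \<longleftrightarrow> of_int j \<le> log \<mu> \<bar>r\<bar>"
    using assms \<mu>(2) by (simp add: le_log_iff powr_real_of_int')
  finally have 1: "1 \<le> \<bar>\<mu> powi (- j) * r\<bar> \<longleftrightarrow> of_int j \<le> log \<mu> \<bar>r\<bar>" .
  have "\<bar>\<mu> powi (- j) * r\<bar> < \<mu> \<longleftrightarrow> \<bar>r\<bar> < \<mu> powi (j + 1)"
    using pos[of j] by (simp add: abs_mult power_int_minus power_int_add field_simps)
  also have "\<dots> \<longleftrightarrow> log \<mu> \<bar>r\<bar> < of_int (j + 1)"
    using assms \<mu>(2) by (subst log_less_iff) (simp_all add: powr_real_of_int' del: of_int_add)
  finally have 2: "\<bar>\<mu> powi (- j) * r\<bar> < \<mu> \<longleftrightarrow> log \<mu> \<bar>r\<bar> < of_int (j + 1)" .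
  have "j = \<lfloor>log \<mu> \<bar>r\<bar>\<rfloor> \<longleftrightarrow> of_int j \<le> log \<mu> \<bar>r\<bar> \<and> log \<mu> \<bar>r\<bar> < of_int (j + 1)"
    by linarith
  then show ?thesis using 1 2 by (auto simp: trunc_def)
qed

lemma finite_trunc: "finite {j. trunc (\<mu> powi (- j) * r) \<noteq> 0}"
proof (cases "r = 0")
  case False
  have "{j. trunc (\<mu> powi (- j) * r) \<noteq> 0} \<subseteq> {\<lfloor>log \<mu> \<bar>r\<bar>\<rfloor>}"
    using False by (auto simp: trunc_scaled)
  then show ?thesis using finite_subset by blast
qed (simp add: trunc_def)

text \<open>The factor \<mu>^j undoes the scaling of the only surviving term. The set J may be
  larger than necessary, so one finite set of exponents serves all orbit representatives.\<close>

lemma sum_trunc: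
  assumes "finite J" "\<And>j. trunc (\<mu> powi (- j) * r) \<noteq> 0 \<Longrightarrow> j \<in> J"
  shows "(\<Sum>j\<in>J. \<mu> powi j * trunc (\<mu> powi (- j) * r)) = r"
proof (cases "r = 0")
  case False
  define i where "i = \<lfloor>log \<mu> \<bar>r\<bar>\<rfloor>"
  have "i \<in> J" using assms(2)[of i] False by (simp add: trunc_scaled i_def)
  have "(\<Sum>j\<in>J. \<mu> powi j * trunc (\<mu> powi (- j) * r)) = (\<Sum>j\<in>J. if j = i then r else 0)"
  proof (rule sum.cong[OF refl])
    fix j assume "j \<in> J"
    have "\<mu> powi j * (\<mu> powi (- j) * r) = r" by (simp add: power_int_minus)
    then show "\<mu> powi j * trunc (\<mu> powi (- j) * r) = (if j = i then r else 0)"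
      unfolding trunc_scaled[OF False] i_def by auto
  qed
  then show ?thesis using assms(1) \<open>i \<in> J\<close> by simp
qed (simp add: trunc_def)

text \<open>The gradient of the truncated potential, cut to the support of \<open>Z\<close>. Over
  \<open>P1\<close> the cut changes nothing, since \<open>f\<close> has equal values at both ends of
  a dual edge where \<open>Z\<close> vanishes; elsewhere it keeps the support finite modulo the
  kernel.\<close>

definition F :: "'g cochain" where
  "F k x = (if Z k x = 0 then 0 else trunc (f x) - trunc (f (bwd k x)))"

lemma F_eq:
  assumes "x \<in> X" "fst x \<in> P1" "fst x - unit_vec k \<in> P1"
  shows "F k x = trunc (f x) - trunc (f (bwd k x))"
  using f_fwd[of "bwd k x" k] assms by (auto simp: F_def)

lemma F_shift: "x \<in> X \<Longrightarrow> h \<in> H \<Longrightarrow> \<kappa> h = 0 \<Longrightarrow> F k (shift h x) = F k x"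
  by (simp add: F_def Z_shift f_shift bwd_shift)

lemma near_Q0: "q \<in> Q0 \<Longrightarrow> q' = q + d \<Longrightarrow> (\<And>i. \<bar>d $ i\<bar> \<le> 2) \<Longrightarrow> q' \<in> P1"
  by (rule Q0_P1[of q]) auto

text \<open>A gradient has zero circulation once the four cubes around the edge lie over
  \<open>P1\<close> and their dual square closes up. One nonzero value of \<open>Z\<close> among the
  four guarantees this by the margin around \<open>Q0\<close>; if all vanish, so does every
  term.\<close>

lemma F_closed:
  assumes z: "z \<in> X"
  shows "F (i+2) z - F (i+2) (bwd (i+1) z) + F (i+1) (bwd (i+2) z) - F (i+1) z = 0"
proof (cases "Z (i+2) z = 0 \<and> Z (i+2) (bwd (i+1) z) = 0 \<and> Z (i+1) (bwd (i+2) z) = 0 \<and> Z (i+1) z = 0")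
  case True
  then show ?thesis by (simp add: F_def)
next
  case False
  have Q: "fst x \<in> Q0" if "Z k x \<noteq> 0" for k x
    using Z_nonzero_square(1)[OF that] by (simp add: square_in_def)
  have "Z (i+2) z \<noteq> 0 \<or> Z (i+2) (bwd (i+1) z) \<noteq> 0 \<or> Z (i+1) (bwd (i+2) z) \<noteq> 0 \<or> Z (i+1) z \<noteq> 0"
    using False by blast
  then have "fst z \<in> Q0 \<or> fst z - unit_vec (i+1) \<in> Q0 \<or> fst z - unit_vec (i+2) \<in> Q0"
    by (elim disjE) (drule Q, simp)+
  \<comment> \<open>The square with nonzero \<open>Z\<close> may start one step behind
    \<open>z\<close>; \<open>d\<close> is this offset.\<close>
  then obtain d where d: "fst z - d \<in> Q0" "d = 0 \<or> d = unit_vec (i+1) \<or> d = unit_vec (i+2)"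
    by (metis diff_zero)
  have near: "fst z + d' \<in> P1" if "\<And>j. \<bar>(d + d') $ j\<bar> \<le> 2" for d'
    using that by (intro near_Q0[OF d(1), of _ "d + d'"]) auto
  have bound: "\<bar>d $ j\<bar> \<le> 1 \<and> (d $ j = 0 \<or> unit_vec (i+1) $ j = 1 \<and> unit_vec (i+2) $ j = 0 \<or> unit_vec (i+1) $ j = 0 \<and> unit_vec (i+2) $ j = 1)
     \<and> unit_vec (i+1) $ j \<in> {0,1} \<and> unit_vec (i+2) $ j \<in> {0,1} \<and> d $ j \<ge> 0" for j
    using d(2) by (auto simp: axis_def)
  have "\<bar>(d + 0) $ j\<bar> \<le> 2" "\<bar>(d + - unit_vec (i+1)) $ j\<bar> \<le> 2" "\<bar>(d + - unit_vec (i+2)) $ j\<bar> \<le> 2"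
      "\<bar>(d + (- unit_vec (i+1) - unit_vec (i+2))) $ j\<bar> \<le> 2" for j
    using bound[of j] by (auto simp del: axis_nth)
  from this[THEN near] have P: "fst z \<in> P1" "fst z - unit_vec (i+1) \<in> P1" "fst z - unit_vec (i+2) \<in> P1"
    "fst z - unit_vec (i+1) - unit_vec (i+2) \<in> P1"
    by (simp_all add: algebra_simps)
  define x where "x = bwd (i+1) (bwd (i+2) z)"
  have x: "x \<in> X" using z by (simp add: x_def)
  have fx: "fst x = fst z - unit_vec (i+1) - unit_vec (i+2)" by (simp add: x_def algebra_simps)
  have sq: "square_in Q1 i (fst x)"
    using P by (intro square_in_Q1) (simp add: square_in_def fx)
  have "fwd (i+1) (fwd (i+2) x) = z"
    using fwd_commute[OF flat sq x] z by (simp add: x_def)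
  then have "fwd (i+2) x = bwd (i+1) z" using x by (metis bwd_fwd fwd_in)
  then have x': "bwd (i+2) (bwd (i+1) z) = x" using x by (metis bwd_fwd)
  have "fst z - unit_vec (i+2) - unit_vec (i+1) \<in> P1"
    using P(4) by (simp add: algebra_simps)
  then show ?thesis
    using P z by (simp add: F_eq x' flip: x_def)
qed

section \<open>The quotient by the kernel of \<kappa>, and summation over it\<close>

definition T :: "'g vertex set" where "T = {x \<in> X. p x = 0}"

definition ker_part :: "'g vertex \<Rightarrow> 'g" where
  "ker_part x = \<eta> (snd x) \<otimes> t [^] (- K x)"

text \<open>The kernel acts on \<open>p\<close> by translations, and \<open>ker_part x\<close> is an
  element of it that translates by \<open>p x\<close>. So \<open>\<tau>\<close> moves every kernel
  orbit to its point in \<open>T\<close>; that point is unique because \<open>v\<close> is injective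
  on the kernel.\<close>

definition \<tau> :: "'g vertex \<Rightarrow> 'g vertex" where
  "\<tau> x = shift (inv (ker_part x)) x"

lemma ker_part:
  assumes "x \<in> X"
  shows "ker_part x \<in> H" "\<kappa> (ker_part x) = 0" "v (ker_part x) = p x"
  using assms t by (auto simp: ker_part_def X_def \<kappa>_mult v_mult K_def p_def)

lemma T_in: "x \<in> T \<Longrightarrow> x \<in> X" by (simp add: T_def)

lemma \<tau>_T [simp]: "x \<in> X \<Longrightarrow> \<tau> x \<in> T"
  using ker_part[of x] by (simp add: \<tau>_def T_def v_inv \<kappa>_inv)

lemma \<tau>_shift:
  assumes "x \<in> T" "h \<in> H" "\<kappa> h = 0"
  shows "\<tau> (shift h x) = x"
proof -
  have x: "x \<in> X" "p x = 0" using assms by (auto simp: T_def)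
  define g where "g = inv (ker_part (shift h x)) \<otimes> h"
  have k: "ker_part (shift h x) \<in> H" "\<kappa> (ker_part (shift h x)) = 0"
    using ker_part[of "shift h x"] x assms by auto
  have g: "g \<in> H" "\<kappa> g = 0" using k assms by (auto simp: g_def \<kappa>_mult \<kappa>_inv)
  have eq: "\<tau> (shift h x) = shift g x" using k x assms by (simp add: \<tau>_def g_def)
  have "p (shift g x) = 0" using \<tau>_T[of "shift h x"] eq x assms by (simp add: T_def)
  then have "v g = 0" using x g by simp
  then have "g = \<one>" using v_inj g by simp
  then show ?thesis using eq x by simp
qed

lemma \<tau>_obtain:
  assumes "x \<in> X"
  obtains h where "h \<in> H" "\<kappa> h = 0" "\<tau> x = shift h x"
  using that[of "inv (ker_part x)"] ker_part[OF assms] by (simp add: \<tau>_def \<kappa>_inv)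

lemma \<tau>_fwd_bwd: "x \<in> T \<Longrightarrow> \<tau> (fwd i (\<tau> (bwd i x))) = x"
  using \<tau>_obtain[of "bwd i x"] T_in[of x] by (metis H_carrier bwd_in fwd_bwd fwd_shift \<tau>_shift)

lemma \<tau>_bwd_fwd: "x \<in> T \<Longrightarrow> \<tau> (bwd i (\<tau> (fwd i x))) = x"
  using \<tau>_obtain[of "fwd i x"] T_in[of x] by (metis H_carrier fwd_in bwd_fwd bwd_shift \<tau>_shift)

text \<open>A forward step followed by \<open>\<tau>\<close> permutes the transversal; its inverse
  is a backward step followed by \<open>\<tau>\<close>. This is the change of variables behind
  summation by parts.\<close>

lemma infsum_T_fwd:
  assumes "\<And>x h. x \<in> X \<Longrightarrow> h \<in> H \<Longrightarrow> \<kappa> h = 0 \<Longrightarrow> \<phi> (shift h x) = \<phi> x"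
  shows "(\<Sum>\<^sub>\<infinity>x\<in>T. \<phi> (fwd i x)) = (\<Sum>\<^sub>\<infinity>x\<in>T. \<phi> x :: real)"
proof (rule infsum_reindex_bij_witness[where j = "\<lambda>x. \<tau> (fwd i x)" and i = "\<lambda>x. \<tau> (bwd i x)"])
  fix x assume "x \<in> T"
  then have "fwd i x \<in> X" by (simp add: T_in)
  then obtain h where "h \<in> H" "\<kappa> h = 0" "\<tau> (fwd i x) = shift h (fwd i x)" by (rule \<tau>_obtain)
  then show "\<phi> (\<tau> (fwd i x)) = \<phi> (fwd i x)" using assms \<open>fwd i x \<in> X\<close> by simp
qed (simp_all add: \<tau>_fwd_bwd \<tau>_bwd_fwd T_in)

text \<open>Representatives of the larger \<open>H\<close>-orbits. The transversal of the kernel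
  consists of their translates by powers of t (\<open>T_decomposition\<close>), which reduces sums
  over \<open>T\<close> to sums over exponents.\<close>

definition orbit_rep :: "'g vertex \<Rightarrow> 'g vertex" where
  "orbit_rep x = shift (inv (\<eta> (snd x))) x"

lemma X_snd [simp]: "x \<in> X \<Longrightarrow> snd x \<in> carrier G" by (simp add: X_def)

lemma orbit_rep_shift: "x \<in> X \<Longrightarrow> h \<in> H \<Longrightarrow> orbit_rep (shift h x) = orbit_rep x"
  by (simp add: orbit_rep_def shift_def \<eta>_shift inv_mult_group m_assoc) (simp flip: m_assoc)

lemma orbit_rep_in: "x \<in> X \<Longrightarrow> orbit_rep x \<in> X"
  by (simp add: orbit_rep_def)

lemma shift_orbit_rep: "x \<in> X \<Longrightarrow> shift (\<eta> (snd x)) (orbit_rep x) = x"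
  by (simp add: orbit_rep_def)

lemma orbit_rep_K: "x \<in> X \<Longrightarrow> K (orbit_rep x) = 0" "x \<in> X \<Longrightarrow> p (orbit_rep x) = 0"
  by (simp_all add: K_def p_def orbit_rep_def shift_def \<eta>_shift)

lemma T_decomposition:
  assumes "x \<in> T"
  shows "x = shift (t [^] K x) (orbit_rep x)"
proof -
  have x: "x \<in> X" "p x = 0" using assms by (auto simp: T_def)
  have "ker_part x = \<one>" using ker_part[OF x(1)] x v_inj by simp
  then have "\<eta> (snd x) \<otimes> t [^] (- K x) \<otimes> t [^] K x = t [^] K x" using t by (simp add: ker_part_def)
  then have "\<eta> (snd x) = t [^] K x"
    using x t by (simp add: m_assoc int_pow_mult[symmetric])
  then show ?thesis using shift_orbit_rep[OF x(1)] by simp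
qed

definition reps :: "'g vertex set" where
  "reps = (\<lambda>(s, k, x). orbit_rep x) ` set chain"

text \<open>All exponents at which the truncation survives at a representative or at a backward
  neighbour of one. Each nonzero value survives at a single exponent, hence the set is finite and
  \<open>window\<close> contains the support of \<open>F\<close> in \<open>T\<close>.\<close>

definition heights :: "int set" where
  "heights = (\<Union>y\<in>reps. \<Union>k. {j. trunc (\<mu> powi (- j) * f y) \<noteq> 0} \<union> {j. trunc (\<mu> powi (- j) * f (bwd k y)) \<noteq> 0})"

definition window :: "'g vertex set" where
  "window = (\<lambda>(j, y). shift (t [^] j) y) ` (heights \<times> reps)"

lemma finite_reps [simp]: "finite reps" by (simp add: reps_def)
lemma finite_heights [simp]: "finite heights" by (simp add: heights_def finite_trunc)
lemma finite_window [simp]: "finite window" by (simp add: window_def)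

lemma reps_in:
  assumes "z \<in> reps"
  shows "z \<in> X" "K z = 0" "p z = 0" "orbit_rep z = z"
proof -
  obtain s k x where x: "(s, k, x) \<in> set chain" "z = orbit_rep x" using assms by (auto simp: reps_def)
  have xX: "x \<in> X" by (rule chain_in(1)[OF x(1)])
  then show "z \<in> X" "K z = 0" "p z = 0" using x by (simp_all add: orbit_rep_in orbit_rep_K)
  have "orbit_rep (shift (inv (\<eta> (snd x))) x) = orbit_rep x"
    using xX by (intro orbit_rep_shift) simp_all
  then show "orbit_rep z = z" unfolding x(2) by (simp only: orbit_rep_def[of x, symmetric])
qed

lemma window_T: "window \<subseteq> T"
  using t by (auto simp: window_def T_def reps_in)

lemma inj_window: "inj_on (\<lambda>(j, y). shift (t [^] j) y) (heights \<times> reps)"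
proof (rule inj_onI, clarify)
  fix j j' :: int and q g q' g'
  assume r: "(q, g) \<in> reps" "(q', g') \<in> reps" and eq: "shift (t [^] j) (q, g) = shift (t [^] j') (q', g')"
  have "K (shift (t [^] j) (q, g)) = j" "K (shift (t [^] j') (q', g')) = j'"
    using r t by (simp_all add: reps_in)
  moreover have "orbit_rep (shift (t [^] j) (q, g)) = (q, g)" "orbit_rep (shift (t [^] j') (q', g')) = (q', g')"
    using r t by (simp_all add: reps_in orbit_rep_shift)
  ultimately show "j = j' \<and> (q, g) = (q', g')" using eq by metis
qed

lemma F_window:
  assumes "x \<in> T" "F k x \<noteq> 0"
  shows "x \<in> window"
proof -
  have x: "x \<in> X" using assms T_in by simp
  have "Z k x \<noteq> 0" using assms by (auto simp: F_def)
  then obtain s x' where x': "(s, k, x') \<in> set chain" "same_orbit x' x" by (rule Z_nonzero)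
  then have r: "orbit_rep x \<in> reps"
    using x by (force simp: same_orbit_def orbit_rep_shift reps_def)
  define y where "y = orbit_rep x"
  have y: "y \<in> reps" "y \<in> X" "x = shift (t [^] K x) y"
    using r orbit_rep_in[OF x] T_decomposition[OF assms(1)] unfolding y_def by blast+
  have "trunc (f x) \<noteq> 0 \<or> trunc (f (bwd k x)) \<noteq> 0"
    using assms(2) by (auto simp: F_def split: if_splits)
  moreover have "f x = \<mu> powi (- K x) * f y" "f (bwd k x) = \<mu> powi (- K x) * f (bwd k y)"
    using t y(2) by (subst y(3), simp add: f_shift bwd_shift)+
  ultimately have "K x \<in> heights" using y(1) by (auto simp: heights_def)
  then show ?thesis using y by (auto simp: window_def intro!: image_eqI[of _ _ "(K x, y)"])
qed

lemma finite_support: "finite {x \<in> T. F k x \<noteq> 0}"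
  by (rule finite_subset[OF _ finite_window]) (auto simp: F_window)

lemma finite_support_bwd: "finite {x \<in> T. F k (bwd j x) \<noteq> 0}"
proof (rule finite_subset)
  show "{x \<in> T. F k (bwd j x) \<noteq> 0} \<subseteq> (\<lambda>x. \<tau> (fwd j x)) ` {x \<in> T. F k x \<noteq> 0}"
  proof clarify
    fix q g assume x: "(q, g) \<in> T" "F k (bwd j (q, g)) \<noteq> 0"
    let ?x = "(q, g)"
    obtain h where "h \<in> H" "\<kappa> h = 0" "\<tau> (bwd j ?x) = shift h (bwd j ?x)"
      using \<tau>_obtain[of "bwd j ?x"] T_in[OF x(1)] by auto
    then have "F k (\<tau> (bwd j ?x)) \<noteq> 0" using x T_in[OF x(1)] by (simp add: F_shift)
    then show "?x \<in> (\<lambda>x. \<tau> (fwd j x)) ` {x \<in> T. F k x \<noteq> 0}"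
      using x T_in[OF x(1)] by (intro image_eqI[of _ _ "\<tau> (bwd j ?x)"]) (auto simp: \<tau>_fwd_bwd)
  qed
qed (simp add: finite_support)

text \<open>The defect of \<open>\<theta>\<close> is a multiple of dp, and dp has no curl because
  both ways around a flat square end at the same vertex.\<close>

lemma curl_\<theta>_shift:
  assumes "x \<in> X" "h \<in> H" "square_in Q1 k (fst x)"
  shows "curl \<theta> k (shift h x) = \<mu> powi \<kappa> h * curl \<theta> k x"
  using assms fwd_commute[OF flat assms(3,1)]
  by (simp add: curl_def fwd_shift \<theta>_shift algebra_simps)

text \<open>Along the t-translates of a representative y the curl contributes \<mu>^j, so
  \<open>sum_trunc\<close> resums the truncated gradients to \<open>Z k y\<close>. Unfolding the
  weights in \<open>Z\<close> then returns every square of \<open>chain\<close> with its own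
  coefficient.\<close>

lemma infsum_T_F:
  "(\<Sum>\<^sub>\<infinity>x\<in>T. curl \<theta> k x * F k x) = (\<Sum>(s, i, x)\<leftarrow>chain. if i = k then s * curl \<theta> k x else 0)"
proof -
  have col: "(\<Sum>j\<in>heights. curl \<theta> k (shift (t [^] j) y) * F k (shift (t [^] j) y)) = curl \<theta> k y * Z k y"
    if y: "y \<in> reps" for y
  proof (cases "Z k y = 0")
    case True
    then have "F k (shift (t [^] j) y) = 0" for j :: int
      using y t by (simp add: F_def Z_shift reps_in)
    then show ?thesis using True by simp
  next
    case False
    have yX: "y \<in> X" using y by (rule reps_in)
    have sq: "square_in Q0 k (fst y)" by (rule Z_nonzero_square[OF False])
    then have P: "fst y \<in> P1" "fst y - unit_vec k \<in> P1"
      by (auto simp: square_in_def axis_def intro: near_Q0[of "fst y"] Q0_P1[of "fst y"])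
    have F: "F k (shift (t [^] j) y) = trunc (\<mu> powi (- j) * f y) - trunc (\<mu> powi (- j) * f (bwd k y))" for j :: int
      using P yX t by (simp add: F_eq f_shift bwd_shift)
    have "(\<Sum>j\<in>heights. curl \<theta> k (shift (t [^] j) y) * F k (shift (t [^] j) y)) =
        (\<Sum>j\<in>heights. curl \<theta> k y * (\<mu> powi j * trunc (\<mu> powi (- j) * f y)
           - \<mu> powi j * trunc (\<mu> powi (- j) * f (bwd k y))))"
      using yX t sq unfolding F
      by (intro sum.cong) (simp_all add: curl_\<theta>_shift square_in_P1 square_in_Q1 algebra_simps)
    also have "\<dots> = curl \<theta> k y * (f y - f (bwd k y))"
    proof -
      have "(\<Sum>j\<in>heights. \<mu> powi j * trunc (\<mu> powi (- j) * f y)) = f y"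
        using y by (intro sum_trunc finite_heights) (auto simp: heights_def)
      moreover have "(\<Sum>j\<in>heights. \<mu> powi j * trunc (\<mu> powi (- j) * f (bwd k y))) = f (bwd k y)"
        using y by (intro sum_trunc finite_heights) (auto simp: heights_def)
      ultimately show ?thesis by (simp add: sum_subtractf flip: sum_distrib_left)
    qed
    also have "f y - f (bwd k y) = Z k y"
      using f_fwd[of "bwd k y" k] P yX by simp
    finally show ?thesis .
  qed
  have "(\<Sum>\<^sub>\<infinity>x\<in>T. curl \<theta> k x * F k x) = (\<Sum>\<^sub>\<infinity>x\<in>window. curl \<theta> k x * F k x)"
    using window_T F_window by (intro infsum_cong_neutral) auto
  also have "\<dots> = (\<Sum>(j, y)\<in>heights \<times> reps. curl \<theta> k (shift (t [^] j) y) * F k (shift (t [^] j) y))"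
    unfolding infsum_finite[OF finite_window]
    unfolding window_def sum.reindex[OF inj_window] by (simp add: case_prod_unfold)
  also have "\<dots> = (\<Sum>y\<in>reps. curl \<theta> k y * Z k y)"
    by (simp add: sum.cartesian_product[symmetric] sum.swap[of _ reps] col)
  also have "\<dots> = (\<Sum>y\<in>reps. \<Sum>(s, i, x)\<leftarrow>chain. if i = k then s * (weight x y * curl \<theta> k y) else 0)"
    unfolding Z_def sum_list_const_mult[symmetric]
    by (intro sum.cong arg_cong[of _ _ sum_list] map_cong refl) (auto simp: algebra_simps)
  also have "\<dots> = (\<Sum>z\<leftarrow>chain. \<Sum>y\<in>reps. case z of (s, i, x) \<Rightarrow> if i = k then s * (weight x y * curl \<theta> k y) else 0)"
    by (rule sum_sum_list)
  also have "\<dots> = (\<Sum>(s, i, x)\<leftarrow>chain. if i = k then s * curl \<theta> k x else 0)"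
  proof (rule arg_cong[of _ _ sum_list], rule map_cong[OF refl], clarify)
    fix s i q g assume z: "(s, i, q, g) \<in> set chain"
    define x where "x = (q, g)"
    have x: "x \<in> X" "square_in Q0 i (fst x)" using chain_in[OF z] by (auto simp: x_def)
    define y where "y = orbit_rep x"
    have y: "y \<in> reps" "y \<in> X" "x = shift (\<eta> (snd x)) y"
      using z x shift_orbit_rep[OF x(1)] by (force simp: y_def reps_def x_def orbit_rep_in)+
    have same: "same_orbit x y" using y x by (auto simp: same_orbit_def)
    have "weight x y' = 0" if "y' \<in> reps" "y' \<noteq> y" for y'
    proof -
      have "\<not> same_orbit x y'"
      proof
        assume "same_orbit x y'"
        then have "orbit_rep x = y'" using that(1) by (auto simp: same_orbit_def orbit_rep_shift reps_in)
        then show False using that by (simp add: y_def)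
      qed
      then show ?thesis by (simp add: weight_def)
    qed
    then have "(\<Sum>y\<in>reps. weight x y * curl \<theta> k y) = weight x y * curl \<theta> k y"
      using y(1) by (subst sum.remove[OF finite_reps y(1)]) simp
    moreover have "weight x y * curl \<theta> k y = curl \<theta> k x" if "i = k"
    proof -
      have "curl \<theta> k (shift (\<eta> (snd x)) y) = \<mu> powi \<kappa> (\<eta> (snd x)) * curl \<theta> k y"
        using x y that by (intro curl_\<theta>_shift square_in_Q1 square_in_P1) (auto simp: y_def orbit_rep_def)
      then show ?thesis using y same by (simp add: weight_def reps_in K_def[of x])
    qed
    ultimately show "(\<Sum>y\<in>reps. if i = k then s * (weight (q, g) y * curl \<theta> k y) else 0) =
        (if i = k then s * curl \<theta> k (q, g) else 0)"
      by (auto simp: x_def simp flip: sum_distrib_left)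
  qed
  finally show ?thesis .
qed

lemma sum_infsum_T_F: "(\<Sum>k\<in>UNIV. \<Sum>\<^sub>\<infinity>x\<in>T. curl \<theta> k x * F k x) = real n"
proof -
  have "(\<Sum>k\<in>UNIV. \<Sum>\<^sub>\<infinity>x\<in>T. curl \<theta> k x * F k x) =
      (\<Sum>z\<leftarrow>chain. \<Sum>k\<in>UNIV. case z of (s, i, x) \<Rightarrow> if i = k then s * curl \<theta> k x else 0)"
    unfolding infsum_T_F by (rule sum_sum_list)
  also have "\<dots> = (\<Sum>(s, i, x)\<leftarrow>chain. s * curl \<theta> i x)"
    by (intro arg_cong[of _ _ sum_list] map_cong) auto
  finally show ?thesis by (simp add: sum_chain path_sum_rel_word_\<theta>)
qed

lemma summable_finite_support:
  fixes \<phi> :: "'g vertex \<Rightarrow> real"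
  assumes "finite {x \<in> A. \<psi> x \<noteq> 0}" "\<And>x. \<psi> x = 0 \<Longrightarrow> \<phi> x = (0::real)"
  shows "\<phi> summable_on A"
proof (rule finite_nonzero_values_imp_summable_on)
  show "finite {x \<in> A. \<phi> x \<noteq> 0}"
    using assms(2) by (intro finite_subset[OF _ assms(1)]) auto
qed

lemma infsum_minus:
  fixes f g :: "'b \<Rightarrow> real"
  assumes "f summable_on A" "g summable_on A"
  shows "(\<Sum>\<^sub>\<infinity>x\<in>A. f x - g x) = infsum f A - infsum g A"
  using infsum_add[OF assms(1) summable_on_uminus[THEN iffD2, OF assms(2)]]
  by (simp add: infsum_uminus)

lemma summable_on_minus:
  fixes f g :: "'b \<Rightarrow> real"
  assumes "f summable_on A" "g summable_on A"
  shows "(\<lambda>x. f x - g x) summable_on A"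
  using summable_on_add[OF assms(1) summable_on_uminus[THEN iffD2, OF assms(2)]] by simp

text \<open>Summation by parts on the quotient by the kernel: \<open>\<theta>\<close> and
  \<open>F\<close> descend to it and \<open>F\<close> has finite support there, so the differences
  move from \<open>\<theta>\<close> to \<open>F\<close>, where \<open>F_closed\<close>
  applies.\<close>

lemma sum_infsum_T_F_zero: "(\<Sum>k\<in>UNIV. \<Sum>\<^sub>\<infinity>x\<in>T. curl \<theta> k x * F k x) = 0"
proof -
  define B where "B i k j = (\<Sum>\<^sub>\<infinity>x\<in>T. \<theta> i x * F k (bwd j x))" for i k j
  define D where "D i k = (\<Sum>\<^sub>\<infinity>x\<in>T. \<theta> i x * F k x)" for i k
  have summable1: "(\<lambda>x. g x * F k x) summable_on T" for g k
    using finite_support[of k] by (rule summable_finite_support) simp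
  have summable2: "(\<lambda>x. g x * F k (bwd j x)) summable_on T" for g k j
    using finite_support_bwd[of k j] by (rule summable_finite_support) simp
  have B: "(\<Sum>\<^sub>\<infinity>x\<in>T. \<theta> i (fwd j x) * F k x) = B i k j" for i j k
  proof -
    have "(\<Sum>\<^sub>\<infinity>x\<in>T. \<theta> i (fwd j x) * F k x) = (\<Sum>\<^sub>\<infinity>x\<in>T. \<theta> i (fwd j x) * F k (bwd j (fwd j x)))"
      by (intro infsum_cong) (simp add: T_in)
    also have "\<dots> = B i k j"
      unfolding B_def by (rule infsum_T_fwd) (simp add: \<theta>_shift bwd_shift F_shift)
    finally show ?thesis .
  qed
  have 1: "(\<Sum>\<^sub>\<infinity>x\<in>T. curl \<theta> k x * F k x) = B (k+2) k (k+1) - D (k+2) k - B (k+1) k (k+2) + D (k+1) k" for k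
    unfolding curl_def left_diff_distrib distrib_right
    by (simp add: infsum_add infsum_minus summable1 summable_on_add summable_on_minus B flip: D_def)
  have 2: "D i (i+2) - B i (i+2) (i+1) + B i (i+1) (i+2) - D i (i+1) = 0" for i
  proof -
    have "D i (i+2) - B i (i+2) (i+1) + B i (i+1) (i+2) - D i (i+1) =
       (\<Sum>\<^sub>\<infinity>x\<in>T. \<theta> i x * F (i+2) x - \<theta> i x * F (i+2) (bwd (i+1) x)
          + \<theta> i x * F (i+1) (bwd (i+2) x) - \<theta> i x * F (i+1) x)"
      by (simp add: infsum_add infsum_minus summable1 summable2 summable_on_add summable_on_minus B_def D_def)
    also have "\<dots> = (\<Sum>\<^sub>\<infinity>x\<in>T. \<theta> i x * (F (i+2) x - F (i+2) (bwd (i+1) x) + F (i+1) (bwd (i+2) x) - F (i+1) x))"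
      by (simp add: algebra_simps)
    also have "\<dots> = 0"
      by (rule infsum_0) (simp add: F_closed T_in)
    finally show ?thesis .
  qed
  \<comment> \<open>In \<open>1\<close> the terms are grouped by the normal direction of squares, in
    \<open>2\<close> by the direction of edges; both list the same twelve terms in cyclic
    order.\<close>
  show ?thesis
    unfolding 1 sum_axes[of _ 1] using 2[of 1] 2[of "1+1"] 2[of "1+2"]
    by (simp only: axes_mod_3)
qed

theorem contradiction: False
  using sum_infsum_T_F sum_infsum_T_F_zero \<mu> by simp

end

section \<open>Holonomy of continuous paths\<close>

definition real_vec :: "int^3 \<Rightarrow> real^3" where
  "real_vec q = (\<chi> i. of_int (q $ i))"

definition floor_vec :: "real^3 \<Rightarrow> int^3" where
  "floor_vec z = (\<chi> i. \<lfloor>z $ i\<rfloor>)"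

lemma real_vec_nth [simp]: "real_vec q $ i = of_int (q $ i)" by (simp add: real_vec_def)

lemma floor_real_vec [simp]: "floor_vec (real_vec q) = q" by (simp add: floor_vec_def vec_eq_iff)

text \<open>Diagonal neighbours must be allowed: the floors of two nearby points can differ in
  several coordinates at once.\<close>

definition king_adjacent :: "int^3 \<Rightarrow> int^3 \<Rightarrow> bool" where
  "king_adjacent a b \<longleftrightarrow> (\<forall>i. \<bar>a $ i - b $ i\<bar> \<le> 1)"

lemma king_adjacent_refl [simp]: "king_adjacent a a"
  by (simp add: king_adjacent_def)

lemma king_adjacent_floor:
  assumes "\<And>i. \<bar>z $ i - w $ i\<bar> < 1"
  shows "king_adjacent (floor_vec z) (floor_vec w)"
  unfolding king_adjacent_def floor_vec_def vec_lambda_beta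
proof
  fix i
  show "\<bar>\<lfloor>z $ i\<rfloor> - \<lfloor>w $ i\<rfloor>\<bar> \<le> 1" using assms[of i] by linarith
qed

definition fine_samples :: "nat \<Rightarrow> (real \<Rightarrow> real^3) \<Rightarrow> bool" where
  "fine_samples N p \<longleftrightarrow> N > 0 \<and>
     (\<forall>s\<in>{0..1}. \<forall>u\<in>{0..1}. \<bar>s - u\<bar> \<le> 1 / real N \<longrightarrow> (\<forall>i. \<bar>p s $ i - p u $ i\<bar> < 1))"

definition sample :: "nat \<Rightarrow> (real \<Rightarrow> real^3) \<Rightarrow> nat \<Rightarrow> int^3" where
  "sample N p i = floor_vec (p (real i / real N))"

lemma component_dist_less: "dist z w < 1 \<Longrightarrow> \<bar>(z::real^3) $ i - w $ i\<bar> < 1"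
  using component_le_norm_cart[of "z - w" i] by (simp add: dist_norm)

lemma fine_samples_exists:
  assumes "path p"
  shows "\<exists>N. fine_samples N p"
proof -
  have "uniformly_continuous_on {0..1} p"
    using assms by (intro compact_uniformly_continuous) (auto simp: path_def)
  then obtain d where d: "d > 0" "\<And>s u. s \<in> {0..1} \<Longrightarrow> u \<in> {0..1} \<Longrightarrow> dist s u < d \<Longrightarrow> dist (p s) (p u) < 1"
    unfolding uniformly_continuous_on_def by (metis zero_less_one)
  obtain N :: nat where N: "real N > 1 / d" using reals_Archimedean2 by blast
  have "N > 0"
  proof (rule ccontr)
    assume "\<not> N > 0"
    then show False using N d(1) by (simp add: divide_less_0_iff)
  qed
  moreover have "1 / real N < d" using N d(1) \<open>N > 0\<close> by (simp add: field_simps)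
  ultimately show ?thesis
    unfolding fine_samples_def using d
    by (intro exI[of _ N]) (auto simp: dist_real_def intro!: component_dist_less)
qed

lemma fine_samples_mono:
  assumes "fine_samples N p" "N \<le> M"
  shows "fine_samples M p"
proof -
  have "1 / real M \<le> 1 / real N" using assms by (simp add: fine_samples_def frac_le)
  then show ?thesis using assms unfolding fine_samples_def by force
qed

text \<open>Compatibility is required only on triangles of pairwise adjacent vertices, i.e. flatness
  on the flag complex of the adjacency graph. This already makes the transport along floors of
  samples invariant under refinement and homotopy.\<close>

locale king_connection =
  fixes D :: "(int^3) set" and T :: "int^3 \<Rightarrow> int^3 \<Rightarrow> 'f \<Rightarrow> 'f"
  assumes T_refl: "a \<in> D \<Longrightarrow> T a a = id"
    and T_comp: "\<lbrakk>a \<in> D; b \<in> D; c \<in> D; king_adjacent a b; king_adjacent b c; king_adjacent a c\<rbrakk>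
      \<Longrightarrow> T b c \<circ> T a b = T a c"
begin

definition C :: "(real^3) set" where "C = {w. floor_vec w \<in> D}"

fun transport :: "(nat \<Rightarrow> int^3) \<Rightarrow> nat \<Rightarrow> 'f \<Rightarrow> 'f" where
  "transport x 0 = id"
| "transport x (Suc n) = T (x n) (x (Suc n)) \<circ> transport x n"

definition hol :: "(real \<Rightarrow> real^3) \<Rightarrow> 'f \<Rightarrow> 'f" where
  "hol p = (let N = SOME N. fine_samples N p in transport (sample N p) N)"

lemma transport_add: "transport x (a + b) = transport (\<lambda>i. x (a + i)) b \<circ> transport x a"
  by (induction b) (auto simp: o_assoc)

lemma transport_cong: "(\<And>i. i \<le> n \<Longrightarrow> x i = y i) \<Longrightarrow> transport x n = transport y n"
  by (induction n) auto

lemma transport_block: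
  assumes "\<And>i. i \<le> n \<Longrightarrow> x i \<in> D" "\<And>i j. i \<le> n \<Longrightarrow> j \<le> n \<Longrightarrow> king_adjacent (x i) (x j)"
  shows "transport x n = T (x 0) (x n)"
  using assms
proof (induction n)
  case (Suc n)
  then show ?case using T_comp[of "x 0" "x n" "x (Suc n)"] by simp
qed (simp add: T_refl)

lemma sample_in_D:
  assumes "path_image p \<subseteq> C" "i \<le> N"
  shows "sample N p i \<in> D"
proof -
  have "real i / real N \<in> {0..1}" using assms(2) by (auto simp: divide_le_eq_1)
  then have "p (real i / real N) \<in> C" using assms(1) by (auto simp only: path_image_def)
  then show ?thesis by (simp add: sample_def C_def)
qed

lemma transport_refine:
  assumes p: "path_image p \<subseteq> C" and N: "fine_samples N p" and M: "M > 0"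
  shows "transport (sample (N * M) p) (N * M) = transport (sample N p) N"
proof -
  have N0: "N > 0" using N by (simp add: fine_samples_def)
  have "transport (sample (N * M) p) (k * M) = transport (sample N p) k" if "k \<le> N" for k
    using that
  proof (induction k)
    case (Suc k)
    let ?x = "\<lambda>j. sample (N * M) p (k * M + j)"
    have le: "k * M + j \<le> N * M" if "j \<le> M" for j
    proof -
      have "k * M + j \<le> Suc k * M" using that by simp
      also have "\<dots> \<le> N * M" using Suc.prems by (intro mult_le_mono1) simp
      finally show ?thesis .
    qed
    have "transport ?x M = T (?x 0) (?x M)"
    proof (rule transport_block)
      show "?x j \<in> D" if "j \<le> M" for j
        using p le[OF that] by (rule sample_in_D)
      show "king_adjacent (?x i) (?x j)" if "i \<le> M" "j \<le> M" for i j
      proof -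
        have "\<bar>real (k * M + i) / real (N * M) - real (k * M + j) / real (N * M)\<bar> = \<bar>real i - real j\<bar> / real (N * M)"
          using M N0 by (simp add: diff_divide_distrib[symmetric] abs_divide)
        also have "\<dots> \<le> real M / real (N * M)"
          using that by (intro divide_right_mono) auto
        also have "\<dots> = 1 / real N" using M by simp
        finally have "\<bar>real (k * M + i) / real (N * M) - real (k * M + j) / real (N * M)\<bar> \<le> 1 / real N" .
        moreover have "real (k * M + i) / real (N * M) \<in> {0..1}" "real (k * M + j) / real (N * M) \<in> {0..1}"
          using le[OF that(1)] le[OF that(2)] M N0 by (simp_all add: divide_le_eq_1 flip: of_nat_mult of_nat_add)
        ultimately show ?thesis
          using N unfolding sample_def fine_samples_def by (intro king_adjacent_floor) blast
      qed
    qed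
    moreover have "sample (N * M) p (k * M) = sample N p k" for k
      using M by (simp add: sample_def)
    from this[of k] this[of "Suc k"] have "?x 0 = sample N p k" "?x M = sample N p (Suc k)"
      by (simp_all add: add.commute)
    ultimately show ?case
      using Suc transport_add[of "sample (N * M) p" "k * M" M] by (simp add: add.commute)
  qed simp
  then show ?thesis by simp
qed

text \<open>Two fine samplings with N and M pieces have a common refinement with N M pieces. Inside
  a piece of either one all refined samples are pairwise adjacent, so transport depends only on its
  ends.\<close>

lemma hol_eq:
  assumes "path_image p \<subseteq> C" "fine_samples N p"
  shows "hol p = transport (sample N p) N"
proof -
  define M where "M = (SOME N. fine_samples N p)"
  have M: "fine_samples M p" using assms(2) by (auto simp: M_def intro: someI)
  have "transport (sample (N * M) p) (N * M) = transport (sample N p) N"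
    using assms M by (intro transport_refine) (auto simp: fine_samples_def)
  moreover have "transport (sample (M * N) p) (M * N) = transport (sample M p) M"
    using assms M by (intro transport_refine) (auto simp: fine_samples_def)
  ultimately show ?thesis by (simp add: hol_def M_def[symmetric] mult.commute)
qed

lemma hol_const: "z \<in> C \<Longrightarrow> hol (linepath z z) = id"
proof -
  assume z: "z \<in> C"
  have "fine_samples 1 (linepath z z)" by (simp add: fine_samples_def linepath_refl)
  then have "hol (linepath z z) = transport (sample 1 (linepath z z)) 1" using z by (intro hol_eq) auto
  then show ?thesis using z T_refl by (simp add: sample_def linepath_refl C_def)
qed

lemma hol_join:
  assumes "path p" "path q" "path_image p \<subseteq> C" "path_image q \<subseteq> C" "pathfinish p = pathstart q"
  shows "hol (p +++ q) = hol q \<circ> hol p"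
proof -
  have j: "path (p +++ q)" "path_image (p +++ q) \<subseteq> C" using assms by (auto simp: path_image_join)
  obtain N1 where N1: "fine_samples N1 p" using fine_samples_exists[OF assms(1)] ..
  obtain N2 where N2: "fine_samples N2 q" using fine_samples_exists[OF assms(2)] ..
  obtain N3 where N3: "fine_samples N3 (p +++ q)" using fine_samples_exists[OF j(1)] ..
  \<comment> \<open>Sampling the join with N + N pieces makes its break at 1/2 a sample point, and
    the two halves are sampled with N pieces each.\<close>
  define N where "N = max N1 (max N2 N3)"
  have f: "fine_samples N p" "fine_samples N q" "fine_samples (N + N) (p +++ q)"
    using fine_samples_mono[OF N1, of N] fine_samples_mono[OF N2, of N] fine_samples_mono[OF N3, of "N + N"]
    by (simp_all add: N_def)
  have N0: "N > 0" using f by (simp add: fine_samples_def)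
  have 1: "sample (N + N) (p +++ q) i = sample N p i" if "i \<le> N" for i
  proof -
    have "real i / real (N + N) \<le> 1 / 2" "2 * (real i / real (N + N)) = real i / real N"
      using that N0 by (simp_all add: field_simps)
    then show ?thesis by (simp add: sample_def joinpaths_def)
  qed
  have 2: "sample (N + N) (p +++ q) (N + i) = sample N q i" for i
  proof (cases "i = 0")
    case True
    then show ?thesis using 1[of N] N0 assms(5) by (simp add: sample_def pathfinish_def pathstart_def)
  next
    case False
    then have "\<not> real (N + i) / real (N + N) \<le> 1 / 2" "2 * (real (N + i) / real (N + N)) - 1 = real i / real N"
      using N0 by (simp_all add: field_simps)
    then show ?thesis by (simp add: sample_def joinpaths_def)
  qed
  have "hol (p +++ q) = transport (sample (N + N) (p +++ q)) (N + N)"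
    using j f by (intro hol_eq)
  also have "\<dots> = transport (sample N q) N \<circ> transport (sample N p) N"
    unfolding transport_add using 1 2 by (simp cong: transport_cong)
  finally show ?thesis using f assms by (simp add: hol_eq)
qed

text \<open>The diagonal from \<open>x i\<close> to \<open>y (Suc i)\<close> cuts each cell of the
  strip into two triangles, and \<open>T_comp\<close> is applied to each.\<close>

lemma transport_strip:
  assumes "\<And>i. i \<le> n \<Longrightarrow> x i \<in> D \<and> y i \<in> D \<and> king_adjacent (x i) (y i)"
    and "\<And>i. i < n \<Longrightarrow> king_adjacent (x i) (x (Suc i)) \<and> king_adjacent (y i) (y (Suc i)) \<and> king_adjacent (x i) (y (Suc i))"
  shows "T (x n) (y n) \<circ> transport x n = transport y n \<circ> T (x 0) (y 0)"
  using assms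
proof (induction n)
  case (Suc n)
  have "T (x (Suc n)) (y (Suc n)) \<circ> T (x n) (x (Suc n)) = T (x n) (y (Suc n))"
    using Suc.prems(1)[of n] Suc.prems(1)[of "Suc n"] Suc.prems(2)[of n] by (intro T_comp) auto
  also have "\<dots> = T (y n) (y (Suc n)) \<circ> T (x n) (y n)"
    using Suc.prems(1)[of n] Suc.prems(1)[of "Suc n"] Suc.prems(2)[of n] by (intro T_comp[symmetric]) auto
  finally have "T (x (Suc n)) (y (Suc n)) \<circ> transport x (Suc n) = T (y n) (y (Suc n)) \<circ> (T (x n) (y n) \<circ> transport x n)"
    by (simp add: o_assoc)
  also have "T (x n) (y n) \<circ> transport x n = transport y n \<circ> T (x 0) (y 0)"
    by (rule Suc.IH) (use Suc.prems in \<open>auto simp: le_Suc_eq less_Suc_eq\<close>)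
  finally show ?case by (simp add: o_assoc)
qed simp

text \<open>A fine grid cuts the homotopy into strips. Endpoints are fixed, so the transports across
  the two ends of every strip are the identity.\<close>

lemma hol_homotopic:
  assumes "homotopic_paths C p q"
  shows "hol p = hol q"
proof -
  obtain h where h: "continuous_on ({0..1} \<times> {0..1}) h" "h ` ({0..1} \<times> {0..1}) \<subseteq> C"
    "\<And>x. x \<in> {0..1} \<Longrightarrow> h (0, x) = p x" "\<And>x. x \<in> {0..1} \<Longrightarrow> h (1, x) = q x"
    "\<And>u. u \<in> {0..1::real} \<Longrightarrow> h (u, 0) = p 0 \<and> h (u, 1) = p (1::real)"
    using assms unfolding homotopic_paths by (fastforce simp: pathstart_def pathfinish_def)
  have "uniformly_continuous_on ({0..1} \<times> {0..1}) h"
    using h(1) by (intro compact_uniformly_continuous compact_Times) auto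
  then obtain d where d: "d > 0" "\<And>s u. s \<in> {0..1} \<times> {0..1} \<Longrightarrow> u \<in> {0..1} \<times> {0..1} \<Longrightarrow> dist s u < d \<Longrightarrow> dist (h s) (h u) < 1"
    unfolding uniformly_continuous_on_def by (metis zero_less_one)
  \<comment> \<open>The 2 allows a step of 1/N in both parameters at once.\<close>
  obtain N :: nat where N: "real N > 2 / d" using reals_Archimedean2 by blast
  have N0: "N > 0"
  proof (rule ccontr)
    assume "\<not> N > 0"
    then show False using N d(1) by (simp add: divide_less_0_iff)
  qed
  have Nd: "2 / real N < d" using N d(1) N0 by (simp add: field_simps)
  have close: "dist (h (u, s)) (h (u', s')) < 1"
    if "u \<in> {0..1}" "s \<in> {0..1}" "u' \<in> {0..1}" "s' \<in> {0..1}" "\<bar>u - u'\<bar> \<le> 1 / real N" "\<bar>s - s'\<bar> \<le> 1 / real N"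
    for u s u' s'
  proof -
    have "dist (u, s) (u', s') \<le> dist u u' + dist s s'"
      unfolding dist_Pair_Pair by (rule sqrt_sum_squares_le_sum) auto
    also have "\<dots> \<le> 2 / real N" using that by (simp add: dist_real_def)
    finally show ?thesis using that Nd by (intro d(2)) auto
  qed
  have fine: "fine_samples N p" "fine_samples N q"
    unfolding fine_samples_def using N0 close[of 0 _ 0] close[of 1 _ 1] h(3,4)
    by (auto intro!: component_dist_less)
  define x where "x j i = floor_vec (h (real j / real N, real i / real N))" for j i
  have frac: "real j / real N \<in> {0..1}" if "j \<le> N" for j
    using that by (auto simp: divide_le_eq_1)
  have xD: "x j i \<in> D" if "i \<le> N" "j \<le> N" for i j
  proof -
    have "h (real j / real N, real i / real N) \<in> C" using h(2) frac[OF that(1)] frac[OF that(2)] by (auto simp only:)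
    then show ?thesis by (simp add: x_def C_def)
  qed
  have adj: "king_adjacent (x j i) (x j' i')"
    if "i \<le> N" "j \<le> N" "i' \<le> N" "j' \<le> N" "\<bar>real i - real i'\<bar> \<le> 1" "\<bar>real j - real j'\<bar> \<le> 1" for i j i' j'
  proof -
    have "\<bar>real i / real N - real i' / real N\<bar> \<le> 1 / real N" "\<bar>real j / real N - real j' / real N\<bar> \<le> 1 / real N"
      using that by (simp_all add: diff_divide_distrib[symmetric] abs_divide divide_right_mono)
    then show ?thesis
      unfolding x_def using that frac by (intro king_adjacent_floor component_dist_less close) auto
  qed
  have ends: "x j 0 = x 0 0" "x j N = x 0 N" if "j \<le> N" for j
    using h(5)[OF frac[OF that]] h(5)[of 0] N0 by (simp_all add: x_def)
  have step: "transport (x (Suc j)) N = transport (x j) N" if "Suc j \<le> N" for j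
  proof -
    have "T (x j N) (x (Suc j) N) \<circ> transport (x j) N = transport (x (Suc j)) N \<circ> T (x j 0) (x (Suc j) 0)"
      using that by (intro transport_strip conjI adj xD) auto
    moreover have "x j N = x (Suc j) N" "x j 0 = x (Suc j) 0" using ends[of j] ends[of "Suc j"] that by simp_all
    ultimately show ?thesis using T_refl[OF xD[of N "Suc j"]] T_refl[OF xD[of 0 "Suc j"]] that by simp
  qed
  have "transport (x j) N = transport (x 0) N" if "j \<le> N" for j
    using that
  proof (induction j)
    case (Suc j)
    then show ?case using step[of j] by simp
  qed simp
  from this[of N] have "transport (x N) N = transport (x 0) N" by blast
  moreover have "transport (x 0) N = transport (sample N p) N"
    using frac h(3) by (intro transport_cong) (simp add: x_def sample_def)
  moreover have "transport (x N) N = transport (sample N q) N"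
    using frac h(4) N0 by (intro transport_cong) (simp add: x_def sample_def)
  moreover have "path_image p \<subseteq> C" "path_image q \<subseteq> C"
    using homotopic_paths_imp_subset[OF assms] by auto
  ultimately show ?thesis using fine by (simp add: hol_eq)
qed

lemma hol_unit_step:
  assumes "a \<in> D" "b \<in> D" "b = a + unit_vec i \<or> a = b + unit_vec i"
    and "path_image (linepath (real_vec a) (real_vec b)) \<subseteq> C"
  shows "hol (linepath (real_vec a) (real_vec b)) = T a b"
proof -
  let ?p = "linepath (real_vec a) (real_vec b)"
  have ba: "\<bar>b $ j - a $ j\<bar> \<le> 1" for j
    using assms(3) by (auto simp: axis_def)
  have "\<bar>?p s $ j - ?p u $ j\<bar> < 1" if "\<bar>s - u\<bar> \<le> 1 / 2" for s u j
  proof -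
    have "?p s $ j - ?p u $ j = (s - u) * of_int (b $ j - a $ j)"
      by (simp add: linepath_def algebra_simps)
    then have "\<bar>?p s $ j - ?p u $ j\<bar> = \<bar>s - u\<bar> * \<bar>of_int (b $ j - a $ j)\<bar>" by (simp add: abs_mult)
    also have "\<dots> \<le> (1 / 2) * 1"
      using that ba[of j] by (intro mult_mono) (simp_all flip: of_int_abs of_int_diff)
    finally show ?thesis by simp
  qed
  \<comment> \<open>One piece would not do: the coordinate changes by exactly 1, and the bound is
    strict. With two pieces the midpoint has one of the ends as its floor.\<close>
  then have "fine_samples 2 ?p" by (simp add: fine_samples_def)
  then have "hol ?p = transport (sample 2 ?p) 2" using assms(4) by (intro hol_eq)
  also have "\<dots> = T (sample 2 ?p 1) (sample 2 ?p 2) \<circ> T (sample 2 ?p 0) (sample 2 ?p 1)"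
    by (simp add: numeral_2_eq_2)
  finally have hol: "hol ?p = T (sample 2 ?p 1) (sample 2 ?p 2) \<circ> T (sample 2 ?p 0) (sample 2 ?p 1)" .
  have ends: "sample 2 ?p 0 = a" "sample 2 ?p 2 = b" by (simp_all add: sample_def linepath_def)
  have "sample 2 ?p 1 = a \<or> sample 2 ?p 1 = b"
    using assms(3)
  proof
    assume b: "b = a + unit_vec i"
    have "\<lfloor>?p (1 / 2) $ j\<rfloor> = a $ j" for j
      by (auto simp: linepath_def b axis_def algebra_simps)
    then show ?thesis by (simp add: sample_def floor_vec_def vec_eq_iff)
  next
    assume b: "a = b + unit_vec i"
    have "\<lfloor>?p (1 / 2) $ j\<rfloor> = b $ j" for j
      by (auto simp: linepath_def b axis_def algebra_simps)
    then show ?thesis by (simp add: sample_def floor_vec_def vec_eq_iff)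
  qed
  then have "T (sample 2 ?p 1) b \<circ> T a (sample 2 ?p 1) = T a b"
    using T_refl assms(1,2) by auto
  then show ?thesis by (simp add: hol ends)
qed

end

section \<open>Extending a connection along the axes to diagonal neighbours\<close>

definition vec3 :: "int \<Rightarrow> int \<Rightarrow> int \<Rightarrow> int^3" where
  "vec3 x y z = (\<chi> i. if i = 1 then x else if i = 2 then y else z)"

lemma vec3_nth [simp]: "vec3 x y z $ 1 = x" "vec3 x y z $ 2 = y" "vec3 x y z $ 3 = z"
  by (simp_all add: vec3_def)

lemma vec3_eta: "vec3 (a $ 1) (a $ 2) (a $ 3) = a"
  by (simp add: vec_eq_iff forall_3)

lemma vec3_add_unit_vec [simp]:
  "vec3 x y z + unit_vec 1 = vec3 (x + 1) y z" "vec3 x y z + unit_vec 2 = vec3 x (y + 1) z"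
  "vec3 x y z + unit_vec 3 = vec3 x y (z + 1)"
  by (simp_all add: vec_eq_iff forall_3 axis_def)

lemma numerals_mod_3: "(4::3) = 1" "(5::3) = 2"
  by simp_all

locale axis_connection =
  fixes Q :: "(int^3) set" and A :: "3 \<Rightarrow> int^3 \<Rightarrow> 'f \<Rightarrow> 'f"
  assumes bij: "bij (A i q)"
    and flat: "square_in Q k q \<Longrightarrow>
      A (k+2) (q + unit_vec (k+1)) \<circ> A (k+1) q = A (k+1) (q + unit_vec (k+2)) \<circ> A (k+2) q"
begin

lemma flat12:
  assumes "vec3 x y z \<in> Q" "vec3 (x+1) y z \<in> Q" "vec3 x (y+1) z \<in> Q" "vec3 (x+1) (y+1) z \<in> Q"
  shows "A 2 (vec3 (x+1) y z) \<circ> A 1 (vec3 x y z) = A 1 (vec3 x (y+1) z) \<circ> A 2 (vec3 x y z)"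
  using flat[of 3 "vec3 x y z"] assms by (simp add: square_in_def numerals_mod_3)

lemma flat23:
  assumes "vec3 x y z \<in> Q" "vec3 x (y+1) z \<in> Q" "vec3 x y (z+1) \<in> Q" "vec3 x (y+1) (z+1) \<in> Q"
  shows "A 3 (vec3 x (y+1) z) \<circ> A 2 (vec3 x y z) = A 2 (vec3 x y (z+1)) \<circ> A 3 (vec3 x y z)"
  using flat[of 1 "vec3 x y z"] assms by (simp add: square_in_def numerals_mod_3)

lemma flat13:
  assumes "vec3 x y z \<in> Q" "vec3 (x+1) y z \<in> Q" "vec3 x y (z+1) \<in> Q" "vec3 (x+1) y (z+1) \<in> Q"
  shows "A 3 (vec3 (x+1) y z) \<circ> A 1 (vec3 x y z) = A 1 (vec3 x y (z+1)) \<circ> A 3 (vec3 x y z)"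
  using flat[of 2 "vec3 x y z"] assms by (simp add: square_in_def numerals_mod_3)

definition one_step :: "3 \<Rightarrow> int^3 \<Rightarrow> int \<Rightarrow> 'f \<Rightarrow> 'f" where
  "one_step i a d = (if d = 1 then A i a else if d = -1 then inv_into UNIV (A i (a - unit_vec i)) else id)"

text \<open>The axes are used in the fixed order 1, 2, 3. By flatness the result is the change of
  frame within any unit block in \<open>Q\<close> (\<open>king_frame\<close>).\<close>

definition king :: "int^3 \<Rightarrow> int^3 \<Rightarrow> 'f \<Rightarrow> 'f" where
  "king a b = one_step 3 (vec3 (b $ 1) (b $ 2) (a $ 3)) (b $ 3 - a $ 3)
     \<circ> one_step 2 (vec3 (b $ 1) (a $ 2) (a $ 3)) (b $ 2 - a $ 2)
     \<circ> one_step 1 (vec3 (a $ 1) (a $ 2) (a $ 3)) (b $ 1 - a $ 1)"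

text \<open>A unit block containing a consists of neighbours of a. Demanding all neighbours in
  \<open>Q\<close> therefore makes every such block flat.\<close>

definition interior :: "(int^3) set" where
  "interior = {a. \<forall>b. king_adjacent a b \<longrightarrow> b \<in> Q}"

text \<open>Transport from the lowest corner \<open>c\<close> of a unit block: the gauge in which
  the connection on the block is trivial.\<close>

definition frame :: "int^3 \<Rightarrow> int^3 \<Rightarrow> 'f \<Rightarrow> 'f" where
  "frame c a = (if a $ 3 = c $ 3 then id else A 3 (vec3 (a $ 1) (a $ 2) (c $ 3)))
     \<circ> (if a $ 2 = c $ 2 then id else A 2 (vec3 (a $ 1) (c $ 2) (c $ 3)))
     \<circ> (if a $ 1 = c $ 1 then id else A 1 (vec3 (c $ 1) (c $ 2) (c $ 3)))"

definition block :: "int^3 \<Rightarrow> (int^3) set" where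
  "block c = {a. \<forall>i. a $ i = c $ i \<or> a $ i = c $ i + 1}"

lemma bij_frame: "bij (frame c a)"
  unfolding frame_def by (intro bij_comp) (auto simp: bij)

lemma vec3_block: "vec3 x y z \<in> block c \<longleftrightarrow>
   (x = c $ 1 \<or> x = c $ 1 + 1) \<and> (y = c $ 2 \<or> y = c $ 2 + 1) \<and> (z = c $ 3 \<or> z = c $ 3 + 1)"
  by (simp add: block_def forall_3)

text \<open>An added edge has to be slid past the steps along later axes, at the price of one flat
  square for each: up to two for axis 1, at most one for axis 2, none for axis 3.\<close>

lemma frame_edge:
  assumes Q: "block c \<subseteq> Q"
  shows "(y = c $ 2 \<or> y = c $ 2 + 1) \<Longrightarrow> (z = c $ 3 \<or> z = c $ 3 + 1) \<Longrightarrow>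
      A 1 (vec3 (c $ 1) y z) \<circ> frame c (vec3 (c $ 1) y z) = frame c (vec3 (c $ 1 + 1) y z)"
    and "(x = c $ 1 \<or> x = c $ 1 + 1) \<Longrightarrow> (z = c $ 3 \<or> z = c $ 3 + 1) \<Longrightarrow>
      A 2 (vec3 x (c $ 2) z) \<circ> frame c (vec3 x (c $ 2) z) = frame c (vec3 x (c $ 2 + 1) z)"
    and "(x = c $ 1 \<or> x = c $ 1 + 1) \<Longrightarrow> (y = c $ 2 \<or> y = c $ 2 + 1) \<Longrightarrow>
      A 3 (vec3 x y (c $ 3)) \<circ> frame c (vec3 x y (c $ 3)) = frame c (vec3 x y (c $ 3 + 1))"
proof -
  obtain o1 o2 o3 where o: "o1 = c $ 1" "o2 = c $ 2" "o3 = c $ 3" by blast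
  have inQ: "vec3 x y z \<in> Q" if "x = o1 \<or> x = o1 + 1" "y = o2 \<or> y = o2 + 1" "z = o3 \<or> z = o3 + 1" for x y z
    using Q that by (auto simp: vec3_block o)
  have f12: "A 2 (vec3 (o1+1) o2 z) \<circ> A 1 (vec3 o1 o2 z) = A 1 (vec3 o1 (o2+1) z) \<circ> A 2 (vec3 o1 o2 z)"
    if "z = o3 \<or> z = o3 + 1" for z using that by (intro flat12 inQ) auto
  have f23: "A 3 (vec3 x (o2+1) o3) \<circ> A 2 (vec3 x o2 o3) = A 2 (vec3 x o2 (o3+1)) \<circ> A 3 (vec3 x o2 o3)"
    if "x = o1 \<or> x = o1 + 1" for x using that by (intro flat23 inQ) auto
  have f13: "A 3 (vec3 (o1+1) y o3) \<circ> A 1 (vec3 o1 y o3) = A 1 (vec3 o1 y (o3+1)) \<circ> A 3 (vec3 o1 y o3)"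
    if "y = o2 \<or> y = o2 + 1" for y using that by (intro flat13 inQ) auto
  show "A 1 (vec3 (c $ 1) y z) \<circ> frame c (vec3 (c $ 1) y z) = frame c (vec3 (c $ 1 + 1) y z)"
    if yz: "(y = c $ 2 \<or> y = c $ 2 + 1)" "(z = c $ 3 \<or> z = c $ 3 + 1)"
  proof -
    consider "y = o2" "z = o3" | "y = o2 + 1" "z = o3" | "y = o2" "z = o3 + 1" | "y = o2 + 1" "z = o3 + 1"
      using yz unfolding o by blast
    then show ?thesis
    proof cases
      case 1
      then show ?thesis by (simp add: frame_def flip: o)
    next
      case 2
      then show ?thesis using f12[of o3] by (simp add: frame_def flip: o)
    next
      case 3
      then show ?thesis using f13[of o2] by (simp add: frame_def flip: o)
    next
      case 4
      have "A 1 (vec3 o1 (o2+1) (o3+1)) \<circ> (A 3 (vec3 o1 (o2+1) o3) \<circ> A 2 (vec3 o1 o2 o3))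
         = A 3 (vec3 (o1+1) (o2+1) o3) \<circ> A 1 (vec3 o1 (o2+1) o3) \<circ> A 2 (vec3 o1 o2 o3)"
        using f13[of "o2+1"] by (simp add: o_assoc)
      also have "\<dots> = A 3 (vec3 (o1+1) (o2+1) o3) \<circ> (A 2 (vec3 (o1+1) o2 o3) \<circ> A 1 (vec3 o1 o2 o3))"
        using f12[of o3] by (simp add: o_assoc[symmetric])
      finally show ?thesis using 4 by (simp add: frame_def o_assoc flip: o)
    qed
  qed
  show "A 2 (vec3 x (c $ 2) z) \<circ> frame c (vec3 x (c $ 2) z) = frame c (vec3 x (c $ 2 + 1) z)"
    if "(x = c $ 1 \<or> x = c $ 1 + 1)" "(z = c $ 3 \<or> z = c $ 3 + 1)"
  proof -
    have "A 2 (vec3 x o2 (o3+1)) \<circ> (A 3 (vec3 x o2 o3) \<circ> g) = A 3 (vec3 x (o2+1) o3) \<circ> (A 2 (vec3 x o2 o3) \<circ> g)" for g :: "'f \<Rightarrow> 'f"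
      using f23[of x] that o by (simp add: o_assoc)
    from this[of id] this[of "A 1 (vec3 o1 o2 o3)"] show ?thesis
      using that by (auto simp: frame_def o_assoc simp flip: o)
  qed
  show "A 3 (vec3 x y (c $ 3)) \<circ> frame c (vec3 x y (c $ 3)) = frame c (vec3 x y (c $ 3 + 1))"
    by (simp add: frame_def o_assoc)
qed

lemma inv_A_comp: "inv_into UNIV (A i q) \<circ> (A i q \<circ> g) = g"
  using bij[of i q] by (simp add: o_assoc bij_is_inj)

lemma king_frame:
  assumes Q: "block c \<subseteq> Q" and a: "a \<in> block c" and b: "b \<in> block c"
  shows "king a b \<circ> frame c a = frame c b"
proof -
  obtain x y z x' y' z' where v: "a = vec3 x y z" "b = vec3 x' y' z'" by (metis vec3_eta)
  have xyz: "x = c $ 1 \<or> x = c $ 1 + 1" "y = c $ 2 \<or> y = c $ 2 + 1" "z = c $ 3 \<or> z = c $ 3 + 1"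
    "x' = c $ 1 \<or> x' = c $ 1 + 1" "y' = c $ 2 \<or> y' = c $ 2 + 1" "z' = c $ 3 \<or> z' = c $ 3 + 1"
    using a b by (auto simp: v vec3_block)
  have sub: "vec3 (x + 1) y z - unit_vec 1 = vec3 x y z" "vec3 x (y + 1) z - unit_vec 2 = vec3 x y z"
    "vec3 x y (z + 1) - unit_vec 3 = vec3 x y z" for x y z
    by (simp_all flip: vec3_add_unit_vec)
  have 1: "one_step 1 (vec3 x y z) (x' - x) \<circ> frame c (vec3 x y z) = frame c (vec3 x' y z)"
    using xyz(1,4) frame_edge(1)[OF Q xyz(2,3)]
    by (auto simp: one_step_def sub inv_A_comp simp flip: frame_edge(1)[OF Q xyz(2,3)])
  have 2: "one_step 2 (vec3 x' y z) (y' - y) \<circ> frame c (vec3 x' y z) = frame c (vec3 x' y' z)"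
    using xyz(2,5) frame_edge(2)[OF Q xyz(4,3)]
    by (auto simp: one_step_def sub inv_A_comp simp flip: frame_edge(2)[OF Q xyz(4,3)])
  have 3: "one_step 3 (vec3 x' y' z) (z' - z) \<circ> frame c (vec3 x' y' z) = frame c (vec3 x' y' z')"
    using xyz(3,6) frame_edge(3)[OF Q xyz(4,5)]
    by (auto simp: one_step_def sub inv_A_comp simp flip: frame_edge(3)[OF Q xyz(4,5)])
  show ?thesis
    by (simp add: king_def v 1 2 3 o_assoc[symmetric])
qed

sublocale king_connection interior king
proof
  fix a assume "a \<in> interior"
  show "king a a = id" by (simp add: king_def one_step_def)
next
  fix a b c assume abc: "a \<in> interior" "b \<in> interior" "c \<in> interior"
    "king_adjacent a b" "king_adjacent b c" "king_adjacent a c"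
  \<comment> \<open>Pairwise adjacent vertices differ by at most 1 in each coordinate, so the
    componentwise minimum is the corner of a block containing all three.\<close>
  define m where "m = (\<chi> i. min (a $ i) (min (b $ i) (c $ i)))"
  have in_block: "a \<in> block m" "b \<in> block m" "c \<in> block m"
    using abc(4-6) unfolding block_def king_adjacent_def m_def by (simp_all add: min_def abs_le_iff) (smt (verit))+
  have "block m \<subseteq> Q"
  proof
    fix d assume d: "d \<in> block m"
    have "king_adjacent a d"
      unfolding king_adjacent_def
    proof
      fix i
      show "\<bar>a $ i - d $ i\<bar> \<le> 1"
        using in_block(1) d unfolding block_def mem_Collect_eq by (smt (verit))
    qed
    then show "d \<in> Q" using abc(1) by (simp add: interior_def)
  qed
  then have "king b c \<circ> king a b \<circ> frame m a = king a c \<circ> frame m a"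
    using in_block by (simp add: king_frame o_assoc[symmetric])
  then show "king b c \<circ> king a b = king a c"
    using bij_frame[of m a] by (metis bij_is_surj surj_fun_eq)
qed

lemma king_forward: "king a (a + unit_vec i) = A i a"
proof -
  have "i = 1 \<or> i = 2 \<or> i = 3" by (rule exhaust_3)
  then show ?thesis by (auto simp: king_def one_step_def axis_def vec3_eta)
qed

lemma king_backward: "king (a + unit_vec i) a = inv_into UNIV (A i a)"
proof -
  have s: "vec3 (x + 1) y z - unit_vec 1 = vec3 x y z" "vec3 x (y + 1) z - unit_vec 2 = vec3 x y z"
    "vec3 x y (z + 1) - unit_vec 3 = vec3 x y z" for x y z
    by (simp_all flip: vec3_add_unit_vec)
  have "i = 1 \<or> i = 2 \<or> i = 3" by (rule exhaust_3)
  moreover have "unit_vec i $ j = (if j = i then 1 else 0)" for j by (simp add: axis_def)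
  ultimately show ?thesis by (auto simp: king_def one_step_def vec3_eta s)
qed

end

section \<open>Lattice words as polygonal paths\<close>

fun word_path :: "int^3 \<Rightarrow> lattice_word \<Rightarrow> real \<Rightarrow> real^3" where
  "word_path q [] = linepath (real_vec q) (real_vec q)"
| "word_path q (s # w) = linepath (real_vec q) (real_vec (q + step_vec s)) +++ word_path (q + step_vec s) w"

lemma real_vec_unit [simp]: "real_vec (q + unit_vec i) = real_vec q + axis i 1"
  by (simp add: vec_eq_iff real_vec_def axis_def)

lemma real_vec_zero [simp]: "real_vec 0 = 0"
  by (simp add: vec_eq_iff real_vec_def)

lemma dist_real_vec_step: "dist (real_vec q) (real_vec (q + step_vec s)) = 1"
proof -
  have "real_vec (q + step_vec s) = real_vec q + (if snd s then axis (fst s) 1 else - axis (fst s) 1)"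
    by (simp add: vec_eq_iff real_vec_def axis_def step_vec_def)
  then show ?thesis by (simp add: dist_norm norm_axis_1)
qed

lemma path_word_path [simp]:
  "path (word_path q w)" "pathstart (word_path q w) = real_vec q"
  "pathfinish (word_path q w) = real_vec (q + displacement w)"
proof -
  have "path (word_path q w) \<and> pathstart (word_path q w) = real_vec q
     \<and> pathfinish (word_path q w) = real_vec (q + displacement w)"
    by (induction w arbitrary: q) (auto simp: add.assoc)
  then show "path (word_path q w)" "pathstart (word_path q w) = real_vec q"
    "pathfinish (word_path q w) = real_vec (q + displacement w)" by auto
qed

lemma segment_step: "closed_segment (real_vec q) (real_vec (q + step_vec s)) \<subseteq> cball (real_vec q) 1"
  by (intro closed_segment_subset) (auto simp: dist_real_vec_step)

lemma path_image_word_path: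
  "stays P q w \<Longrightarrow> path_image (word_path q w) \<subseteq> (\<Union>p\<in>P. cball (real_vec p) 1)"
proof (induction w arbitrary: q)
  case (Cons s w)
  have "path_image (linepath (real_vec q) (real_vec (q + step_vec s))) \<subseteq> cball (real_vec q) 1"
    using segment_step by simp
  then show ?case using Cons by (subst word_path.simps, subst path_image_join) (simp, fastforce)
next
  case Nil
  then have "real_vec q \<in> (\<Union>p\<in>P. cball (real_vec p) 1)" by (intro UN_I[of q]) auto
  then show ?case by simp
qed

context axis_connection
begin

fun word_transport :: "int^3 \<Rightarrow> lattice_word \<Rightarrow> 'f \<Rightarrow> 'f" where
  "word_transport q [] = id"
| "word_transport q (s # w) = word_transport (q + step_vec s) w \<circ>
     (if snd s then A (fst s) q else inv_into UNIV (A (fst s) (q + step_vec s)))"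

lemma hol_word_path:
  assumes "stays P q w" "\<And>q. q \<in> P \<Longrightarrow> cball (real_vec q) 1 \<subseteq> C"
  shows "hol (word_path q w) = word_transport q w"
  using assms(1)
proof (induction w arbitrary: q)
  case Nil
  then have "real_vec q \<in> C" using assms(2)[of q] by auto
  then show ?case by (simp only: word_path.simps word_transport.simps hol_const)
next
  case (Cons s w)
  let ?q = "q + step_vec s"
  have in_int: "p \<in> interior" if "p \<in> P" for p
  proof -
    have "real_vec p \<in> C" using assms(2)[OF that] by auto
    then show ?thesis by (simp add: C_def)
  qed
  have q: "q \<in> P" "?q \<in> P" "stays P ?q w" using Cons.prems by (auto dest: stays_start)
  have seg: "path_image (linepath (real_vec q) (real_vec ?q)) \<subseteq> C"
    using segment_step[of q s] assms(2)[OF q(1)] by simp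
  have "path_image (word_path ?q w) \<subseteq> C"
    using path_image_word_path[OF q(3)] assms(2) by blast
  then have "hol (word_path q (s # w)) = hol (word_path ?q w) \<circ> hol (linepath (real_vec q) (real_vec ?q))"
    using seg unfolding word_path.simps by (intro hol_join) auto
  also have "hol (linepath (real_vec q) (real_vec ?q)) = king q ?q"
    using q in_int seg by (intro hol_unit_step[of _ _ "fst s"]) (auto simp: step_vec_def)
  also have "king q ?q = (if snd s then A (fst s) q else inv_into UNIV (A (fst s) ?q))"
    using king_forward[of q "fst s"] king_backward[of ?q "fst s"] by (auto simp: step_vec_def)
  finally show ?case using Cons.IH[OF q(3)] by simp
qed

text \<open>A neighbour of the floor of w differs from w by at most 2 in each of three coordinates.
  Hence the radius 6, which recurs in \<open>pushable\<close> and \<open>collar\<close>.\<close>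

lemma in_C_if_near:
  assumes "\<And>b. dist (real_vec b) w \<le> 6 \<Longrightarrow> b \<in> Q"
  shows "w \<in> C"
proof -
  have "b \<in> Q" if "king_adjacent (floor_vec w) b" for b
  proof (rule assms)
    have "\<bar>(real_vec b - w) $ i\<bar> \<le> 2" for i
    proof -
      have "\<bar>\<lfloor>w $ i\<rfloor> - b $ i\<bar> \<le> 1" using that by (simp add: king_adjacent_def floor_vec_def)
      then show ?thesis by simp linarith
    qed
    then have "(\<Sum>i\<in>UNIV. \<bar>(real_vec b - w) $ i\<bar>) \<le> (\<Sum>i\<in>(UNIV::3 set). 2)"
      by (intro sum_mono)
    then show "dist (real_vec b) w \<le> 6"
      using norm_le_l1_cart[of "real_vec b - w"] by (simp add: dist_norm)
  qed
  then have "floor_vec w \<in> interior" by (simp add: interior_def)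
  then show ?thesis by (simp add: C_def)
qed

end

section \<open>A lattice model of the exterior\<close>

definition path_in :: "'a::real_normed_vector set \<Rightarrow> (real \<Rightarrow> 'a) \<Rightarrow> 'a \<Rightarrow> 'a \<Rightarrow> bool" where
  "path_in S p a b \<longleftrightarrow> path p \<and> path_image p \<subseteq> S \<and> pathstart p = a \<and> pathfinish p = b"

lemma path_in_join: "path_in S p a b \<Longrightarrow> path_in S q b c \<Longrightarrow> path_in S (p +++ q) a c"
  by (auto simp: path_in_def path_image_join)

lemma path_in_reverse: "path_in S p a b \<Longrightarrow> path_in S (reversepath p) b a"
  by (auto simp: path_in_def)

lemma homotopic_join:
  assumes "homotopic_paths S p p'" "homotopic_paths S q q'" "pathfinish p = pathstart q"
  shows "homotopic_paths S (p +++ q) (p' +++ q')"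
  using assms by (rule homotopic_paths_join)

lemma homotopic_assoc:
  assumes "path_in S p a b" "path_in S q b c" "path_in S r c d"
  shows "homotopic_paths S ((p +++ q) +++ r) (p +++ (q +++ r))"
  using assms by (intro homotopic_paths_sym[OF homotopic_paths_assoc]) (auto simp: path_in_def)

lemma homotopic_refl: "path_in S p a b \<Longrightarrow> homotopic_paths S p p"
  by (simp add: path_in_def)

lemma homotopic_cancel:
  assumes "path_in S d a b" "path_in S z b c"
  shows "homotopic_paths S (reversepath d +++ (d +++ z)) z"
    and "path_in S z' a c \<Longrightarrow> homotopic_paths S (d +++ (reversepath d +++ z')) z'"
proof -
  have r: "path_in S (reversepath d) b a" using assms(1) by (rule path_in_reverse)
  have gen: "homotopic_paths S (d' +++ (d'' +++ z)) z"
    if "path_in S d' b a" "path_in S d'' a b" "path_in S z b c"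
       "homotopic_paths S (d' +++ d'') (linepath b b)" for d' d'' z a b c
  proof -
    have "homotopic_paths S (d' +++ (d'' +++ z)) ((d' +++ d'') +++ z)"
      by (rule homotopic_paths_sym[OF homotopic_assoc[OF that(1-3)]])
    also have "homotopic_paths S ((d' +++ d'') +++ z) (linepath b b +++ z)"
      using that by (intro homotopic_join homotopic_refl) (auto simp: path_in_def)
    also have "homotopic_paths S (linepath b b +++ z) z"
      using that(3) by (intro homotopic_paths_lid') (auto simp: path_in_def)
    finally show ?thesis .
  qed
  show "homotopic_paths S (reversepath d +++ (d +++ z)) z"
    using assms r homotopic_paths_linv[of d S] by (intro gen) (auto simp: path_in_def)
  show "homotopic_paths S (d +++ (reversepath d +++ z')) z'" if "path_in S z' a c"
    using assms(1) r that homotopic_paths_rinv[of d S] by (intro gen) (auto simp: path_in_def)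
qed

text \<open>Up to the embedding \<open>\<sigma>\<close>, \<open>E\<close> is a retract of a region
  of space. The normalization \<open>\<sigma>_x\<close> puts the base point at a lattice
  vertex.\<close>

locale exterior_model =
  fixes E :: "'b::real_normed_vector set" and x :: 'b
    and \<sigma> :: "'b \<Rightarrow> real^3" and \<rho> :: "real^3 \<Rightarrow> 'b" and U :: "(real^3) set"
  assumes x: "x \<in> E"
    and cont_\<rho>: "continuous_on U \<rho>" and \<rho>_in: "\<And>z. z \<in> U \<Longrightarrow> \<rho> z \<in> E"
    and cont_\<sigma>: "continuous_on E \<sigma>" and \<sigma>_in: "\<And>e. e \<in> E \<Longrightarrow> \<sigma> e \<in> U"
    and \<rho>_\<sigma>: "\<And>e. e \<in> E \<Longrightarrow> \<rho> (\<sigma> e) = e"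
    and \<sigma>_x: "\<sigma> x = 0"
begin

text \<open>The straight-line homotopy from the identity to \<sigma> \<circ> \<rho>, started on any
  lattice path over \<open>P\<close>, stays where the connection over \<open>Q\<close> has a
  holonomy.\<close>

definition pushable :: "(int^3) set \<Rightarrow> (int^3) set \<Rightarrow> bool" where
  "pushable P Q \<longleftrightarrow> (\<forall>q\<in>P. \<forall>z\<in>cball (real_vec q) 1. z \<in> U \<and>
     (\<forall>w\<in>closed_segment z (\<sigma> (\<rho> z)). \<forall>b. dist (real_vec b) w \<le> 6 \<longrightarrow> b \<in> Q))"

definition collar :: "(int^3) set \<Rightarrow> bool" where
  "collar Q \<longleftrightarrow> (\<forall>e\<in>E. \<forall>b. dist (real_vec b) (\<sigma> e) \<le> 6 \<longrightarrow> b \<in> Q)"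

text \<open>The null-homotopy takes place in \<open>E\<close>, and \<open>\<sigma>\<close> carries
  it into the region of the connection. A straight-line homotopy joins the word path to its image
  under \<sigma> \<circ> \<rho>, so homotopy invariance gives the trivial transport.\<close>

lemma trivial_transport:
  assumes "axis_connection Q A" "pushable P Q" "collar Q"
    and w: "stays P 0 w" "displacement w = 0"
    and null: "homotopic_paths E (\<rho> \<circ> word_path 0 w) (linepath x x)"
  shows "axis_connection.word_transport A 0 w = id"
proof -
  interpret axis_connection Q A by fact
  have C: "cball (real_vec q) 1 \<subseteq> C" if "q \<in> P" for q
  proof
    fix z assume z: "z \<in> cball (real_vec q) 1"
    show "z \<in> C"
      using assms(2) that z ends_in_segment(1)[of z "\<sigma> (\<rho> z)"]
      unfolding pushable_def by (intro in_C_if_near) blast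
  qed
  have im: "path_image (word_path 0 w) \<subseteq> (\<Union>q\<in>P. cball (real_vec q) 1)"
    using w(1) by (rule path_image_word_path)
  then have imU: "path_image (word_path 0 w) \<subseteq> U"
    using assms(2) by (fastforce simp: pushable_def)
  have \<sigma>C: "\<sigma> ` E \<subseteq> C"
    using assms(3) by (auto simp: collar_def intro!: in_C_if_near)
  have path_\<rho>: "path (\<rho> \<circ> word_path 0 w)" "path_image (\<rho> \<circ> word_path 0 w) \<subseteq> E"
    using homotopic_paths_imp_path[OF null] homotopic_paths_imp_subset[OF null] by auto
  have path_\<sigma>\<rho>: "path (\<sigma> \<circ> (\<rho> \<circ> word_path 0 w))"
    by (rule path_continuous_image[OF path_\<rho>(1) continuous_on_subset[OF cont_\<sigma> path_\<rho>(2)]])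
  have ends: "\<sigma> (\<rho> 0) = 0" using \<rho>_\<sigma>[OF x] \<sigma>_x by simp
  have "homotopic_paths C (word_path 0 w) (\<sigma> \<circ> (\<rho> \<circ> word_path 0 w))"
  proof (rule homotopic_paths_linear)
    show "pathstart (\<sigma> \<circ> (\<rho> \<circ> word_path 0 w)) = pathstart (word_path 0 w)"
      using path_word_path(2)[of 0 w] ends by (simp add: pathstart_def)
    show "pathfinish (\<sigma> \<circ> (\<rho> \<circ> word_path 0 w)) = pathfinish (word_path 0 w)"
      using path_word_path(3)[of 0 w] w(2) ends by (simp add: pathfinish_def)
    show "closed_segment (word_path 0 w t) ((\<sigma> \<circ> (\<rho> \<circ> word_path 0 w)) t) \<subseteq> C" if "t \<in> {0..1}" for t
    proof
      fix u assume u: "u \<in> closed_segment (word_path 0 w t) ((\<sigma> \<circ> (\<rho> \<circ> word_path 0 w)) t)"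
      have "word_path 0 w t \<in> path_image (word_path 0 w)" using that by (auto simp: path_image_def)
      then obtain q where "q \<in> P" "word_path 0 w t \<in> cball (real_vec q) 1" using im by blast
      then show "u \<in> C"
        using assms(2) u unfolding pushable_def by (intro in_C_if_near) (auto simp: o_def)
    qed
  qed (use path_\<sigma>\<rho> in auto)
  moreover have "homotopic_paths C (\<sigma> \<circ> (\<rho> \<circ> word_path 0 w)) (\<sigma> \<circ> linepath x x)"
    using \<sigma>C by (intro homotopic_paths_continuous_image[OF null cont_\<sigma>]) auto
  moreover have "\<sigma> \<circ> linepath x x = linepath 0 0" by (simp add: fun_eq_iff linepath_refl \<sigma>_x)
  ultimately have "hol (word_path 0 w) = hol (linepath 0 0)"
    by (metis hol_homotopic homotopic_paths_trans)
  also have "\<dots> = id" using \<sigma>C x \<sigma>_x by (intro hol_const) auto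
  also have "hol (word_path 0 w) = word_transport 0 w" using w(1) C by (rule hol_word_path)
  finally show ?thesis .
qed

definition cls :: "(real \<Rightarrow> 'b) \<Rightarrow> (real \<Rightarrow> 'b) set" where
  "cls p = Collect (homotopic_paths E p)"

abbreviation path_from_to :: "(real \<Rightarrow> 'b) \<Rightarrow> 'b \<Rightarrow> 'b \<Rightarrow> bool" where
  "path_from_to \<equiv> path_in E"

definition lasso :: "(real \<Rightarrow> 'b) \<Rightarrow> (real \<Rightarrow> 'b) \<Rightarrow> (real \<Rightarrow> 'b) \<Rightarrow> real \<Rightarrow> 'b" where
  "lasso c s d = c +++ (s +++ reversepath d)"

abbreviation "G \<equiv> fundamental_group E x"

lemma group_G: "group G" using x by (rule group_fundamental_group)

lemma path_from_to_lasso: "path_from_to c a b \<Longrightarrow> path_from_to s b b' \<Longrightarrow> path_from_to d a b' \<Longrightarrow> path_from_to (lasso c s d) a a"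
  unfolding lasso_def by (blast intro: path_in_join path_in_reverse)

lemma loops_at_iff: "p \<in> loops_at E x \<longleftrightarrow> path_from_to p x x"
  by (auto simp: loops_at_def path_in_def)

lemma cls_eq_iff: "path_from_to p x x \<Longrightarrow> cls p = cls q \<longleftrightarrow> homotopic_paths E p q"
  unfolding cls_def using homotopic_class_eq_iff loops_at_iff by metis

lemma cls_in: "path_from_to p x x \<Longrightarrow> cls p \<in> carrier G"
  by (auto simp: carrier_fundamental_group cls_def loops_at_iff)

lemma cls_mult: "path_from_to p x x \<Longrightarrow> path_from_to q x x \<Longrightarrow> cls p \<otimes>\<^bsub>G\<^esub> cls q = cls (p +++ q)"
  unfolding cls_def using mult_fundamental_group loops_at_iff by metis

lemma one_G: "\<one>\<^bsub>G\<^esub> = cls (linepath x x)"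
  by (simp add: fundamental_group_def cls_def)

lemma lasso_cong:
  assumes "path_from_to c x b" "path_from_to d x b'" "path_from_to s b b'" "homotopic_paths E s s'"
  shows "cls (lasso c s d) = cls (lasso c s' d)"
proof -
  have "homotopic_paths E (lasso c s d) (lasso c s' d)"
    unfolding lasso_def using assms path_in_reverse[OF assms(2)]
    by (intro homotopic_join homotopic_refl) (auto simp: path_in_def)
  then show ?thesis using assms by (subst cls_eq_iff) (auto intro: path_from_to_lasso)
qed

lemma lasso_mult:
  assumes c: "path_from_to c x u" and s: "path_from_to s u u'" and d: "path_from_to d x u'"
    and w: "path_from_to w u' u''" and e: "path_from_to e x u''"
  shows "cls (lasso c s d) \<otimes>\<^bsub>G\<^esub> cls (lasso d w e) = cls (lasso c (s +++ w) e)"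
proof -
  let ?d = "reversepath d" and ?e = "reversepath e"
  have d': "path_from_to ?d u' x" and e': "path_from_to ?e u'' x" using d e by (auto intro: path_in_reverse)
  note J = path_in_join
  have z: "path_from_to (w +++ ?e) u' x" using w e' by (rule J)
  have "homotopic_paths E (lasso c s d +++ lasso d w e) (c +++ ((s +++ ?d) +++ (d +++ (w +++ ?e))))"
    unfolding lasso_def by (rule homotopic_assoc[OF c J[OF s d'] J[OF d z]])
  also have "homotopic_paths E \<dots> (c +++ (s +++ (?d +++ (d +++ (w +++ ?e)))))"
    using c s d d' z by (intro homotopic_join homotopic_refl[OF c] homotopic_assoc[OF s d' J[OF d z]]) (simp add: path_in_def)
  also have "homotopic_paths E \<dots> (c +++ (s +++ (w +++ ?e)))"
    using c s d d' z
    by (intro homotopic_join homotopic_refl[OF c] homotopic_refl[OF s] homotopic_cancel(1)[OF d z]) (simp_all add: path_in_def)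
  also have "homotopic_paths E \<dots> (lasso c (s +++ w) e)"
    unfolding lasso_def using c s w e'
    by (intro homotopic_join homotopic_refl[OF c] homotopic_paths_sym[OF homotopic_assoc[OF s w e']]) (simp add: path_in_def)
  finally have "homotopic_paths E (lasso c s d +++ lasso d w e) (lasso c (s +++ w) e)" .
  then have "cls (lasso c s d +++ lasso d w e) = cls (lasso c (s +++ w) e)"
    using path_from_to_lasso[OF c s d] path_from_to_lasso[OF d w e] by (subst cls_eq_iff) (auto intro: J)
  then show ?thesis
    using cls_mult[OF path_from_to_lasso[OF c s d] path_from_to_lasso[OF d w e]] by simp
qed

lemma lasso_const:
  assumes "path_from_to c x u"
  shows "cls (lasso c (linepath u u) c) = \<one>\<^bsub>G\<^esub>"
proof -
  have u: "path_from_to (linepath u u) u u" using assms pathfinish_in_path_image[of c] by (auto simp: path_in_def)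
  have "homotopic_paths E (lasso c (linepath u u) c) (c +++ reversepath c)"
    unfolding lasso_def using assms
    by (intro homotopic_join homotopic_refl[OF assms] homotopic_paths_lid') (auto simp: path_in_def)
  also have "homotopic_paths E \<dots> (linepath x x)"
    using assms homotopic_paths_rinv[of c E] by (auto simp: path_in_def)
  finally show ?thesis
    unfolding one_G using path_from_to_lasso[OF assms u assms] by (subst cls_eq_iff) auto
qed

lemma lasso_inv:
  assumes c: "path_from_to c x u" and s: "path_from_to s u u'" and d: "path_from_to d x u'"
  shows "inv\<^bsub>G\<^esub> cls (lasso c s d) = cls (lasso d (reversepath s) c)"
proof -
  have s': "path_from_to (reversepath s) u' u" using s by (rule path_in_reverse)
  have "cls (lasso d (reversepath s) c) \<otimes>\<^bsub>G\<^esub> cls (lasso c s d) = cls (lasso d (reversepath s +++ s) d)"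
    by (rule lasso_mult[OF d s' c s d])
  also have "\<dots> = cls (lasso d (linepath u' u') d)"
    using s homotopic_paths_linv[of s E]
    by (intro lasso_cong[OF d d path_in_join[OF s' s]]) (auto simp: path_in_def)
  also have "\<dots> = \<one>\<^bsub>G\<^esub>" by (rule lasso_const[OF d])
  finally show ?thesis
    by (intro group.inv_equality[OF group_G] cls_in path_from_to_lasso[OF c s d] path_from_to_lasso[OF d s' c])
qed

end

section \<open>Transport of 1-chains modulo boundaries\<close>

context lattice_cover
begin

definition boundaries :: "(int^3) set \<Rightarrow> ('g cochain \<Rightarrow> real) set" where
  "boundaries Q = {(\<lambda>\<beta>. \<Sum>(s, k, x)\<leftarrow>rs. s * curl \<beta> k x) | rs :: (real \<times> 3 \<times> 'g vertex) list.
     \<forall>(s, k, x)\<in>set rs. x \<in> X \<and> square_in Q k (fst x)}"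

definition saturated :: "(int^3) set \<Rightarrow> ('g cochain \<Rightarrow> real) set \<Rightarrow> bool" where
  "saturated Q S \<longleftrightarrow> (\<forall>\<phi>\<in>S. \<forall>b\<in>boundaries Q. (\<lambda>\<beta>. \<phi> \<beta> + b \<beta>) \<in> S)"

definition translate :: "('g cochain \<Rightarrow> real) \<Rightarrow>
    ('g cochain \<Rightarrow> real) set \<Rightarrow> ('g cochain \<Rightarrow> real) set" where
  "translate \<psi> S = (\<lambda>\<phi> \<beta>. \<phi> \<beta> + \<psi> \<beta>) ` S"

text \<open>Acting by bijections on pairs of a group element and a set of 1-chains that is closed under adding
  boundaries makes parallel transport compute the endpoint of a lift and the 1-chain along it, modulo
  boundaries, at once. The identity on unsaturated sets keeps the action bijective.\<close>

definition chain_step where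
  "chain_step Q i q = (\<lambda>(g, S). if g \<in> carrier G \<and> saturated Q S
     then (g \<otimes> l i q, translate (\<lambda>\<beta>. \<beta> i (q, g)) S) else (g, S))"

definition chain_back where
  "chain_back Q i q = (\<lambda>(g, S). if g \<in> carrier G \<and> saturated Q S
     then (g \<otimes> inv (l i q), translate (\<lambda>\<beta>. - \<beta> i (q, g \<otimes> inv (l i q))) S) else (g, S))"

lemma translate_translate: "translate \<psi> (translate \<omega> S) = translate (\<lambda>\<beta>. \<omega> \<beta> + \<psi> \<beta>) S"
  by (simp add: translate_def image_image add.assoc)

lemma translate_zero: "translate (\<lambda>\<beta>. 0) S = S"
  by (simp add: translate_def)

lemma saturated_translate:
  assumes "saturated Q S"
  shows "saturated Q (translate \<psi> S)"
  unfolding saturated_def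
proof (intro ballI)
  fix \<phi> b assume "\<phi> \<in> translate \<psi> S" and b: "b \<in> boundaries Q"
  then obtain \<omega> where \<omega>: "\<omega> \<in> S" "\<phi> = (\<lambda>\<beta>. \<omega> \<beta> + \<psi> \<beta>)" by (auto simp: translate_def)
  then have "(\<lambda>\<beta>. \<omega> \<beta> + b \<beta>) \<in> S" using assms b by (auto simp: saturated_def)
  then show "(\<lambda>\<beta>. \<phi> \<beta> + b \<beta>) \<in> translate \<psi> S"
    unfolding translate_def \<omega>(2) by (rule rev_image_eqI) (simp add: algebra_simps)
qed

lemma chain_back_step: "chain_back Q i q \<circ> chain_step Q i q = id"
  by (rule ext) (auto simp: chain_back_def chain_step_def saturated_translate translate_translate translate_zero m_assoc)

lemma chain_step_back: "chain_step Q i q \<circ> chain_back Q i q = id"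
  by (rule ext) (auto simp: chain_back_def chain_step_def saturated_translate translate_translate translate_zero m_assoc)

lemma square_boundary: "x \<in> X \<Longrightarrow> square_in Q k (fst x) \<Longrightarrow> (\<lambda>\<beta>. s * curl \<beta> k x) \<in> boundaries Q"
  unfolding boundaries_def by (rule CollectI, rule exI[of _ "[(s, k, x)]"]) auto

lemma translate_cong_boundary:
  assumes S: "saturated Q S" and b: "(\<lambda>\<beta>. \<psi> \<beta> - \<omega> \<beta>) \<in> boundaries Q" "(\<lambda>\<beta>. \<omega> \<beta> - \<psi> \<beta>) \<in> boundaries Q"
  shows "translate \<psi> S = translate \<omega> S"
proof -
  have sub: "translate \<psi> S \<subseteq> translate \<omega> S" if "(\<lambda>\<beta>. \<psi> \<beta> - \<omega> \<beta>) \<in> boundaries Q" for \<psi> \<omega> :: "'g cochain \<Rightarrow> real"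
  proof
    fix \<phi> assume "\<phi> \<in> translate \<psi> S"
    then obtain \<xi> where \<xi>: "\<xi> \<in> S" "\<phi> = (\<lambda>\<beta>. \<xi> \<beta> + \<psi> \<beta>)" by (auto simp: translate_def)
    then have "(\<lambda>\<beta>. \<xi> \<beta> + (\<psi> \<beta> - \<omega> \<beta>)) \<in> S" using S that by (auto simp: saturated_def)
    then show "\<phi> \<in> translate \<omega> S"
      unfolding translate_def \<xi>(2) by (rule rev_image_eqI) (simp add: algebra_simps)
  qed
  show ?thesis using sub b by (intro equalityI)
qed

text \<open>The two ways around a square agree in the group entry by flatness, and in the chain up
  to one square boundary, which a saturated set absorbs.\<close>

lemma axis_connection_chain_step:
  assumes "flat_on Q"
  shows "axis_connection Q (chain_step Q)"
proof
  show "bij (chain_step Q i q)" for i q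
    using chain_back_step chain_step_back by (rule o_bij)
next
  fix k q assume sq: "square_in Q k q"
  show "chain_step Q (k+2) (q + unit_vec (k+1)) \<circ> chain_step Q (k+1) q =
        chain_step Q (k+1) (q + unit_vec (k+2)) \<circ> chain_step Q (k+2) q"
  proof (rule ext, clarify)
    fix g S
    show "(chain_step Q (k+2) (q + unit_vec (k+1)) \<circ> chain_step Q (k+1) q) (g, S) =
        (chain_step Q (k+1) (q + unit_vec (k+2)) \<circ> chain_step Q (k+2) q) (g, S)"
    proof (cases "g \<in> carrier G \<and> saturated Q S")
      case True
      have x: "(q, g) \<in> X" using True by (simp add: X_def)
      define \<psi> where "\<psi> \<beta> = \<beta> (k+1) (q, g) + \<beta> (k+2) (fwd (k+1) (q, g))" for \<beta> :: "'g cochain"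
      define \<omega> where "\<omega> \<beta> = \<beta> (k+2) (q, g) + \<beta> (k+1) (fwd (k+2) (q, g))" for \<beta> :: "'g cochain"
      have eq: "(\<lambda>\<beta>. \<psi> \<beta> - \<omega> \<beta>) = (\<lambda>\<beta>. 1 * curl \<beta> k (q, g))" "(\<lambda>\<beta>. \<omega> \<beta> - \<psi> \<beta>) = (\<lambda>\<beta>. (-1) * curl \<beta> k (q, g))"
        by (simp_all add: \<psi>_def \<omega>_def curl_def fun_eq_iff)
      have "square_in Q k (fst (q, g))" using sq by simp
      then have "(\<lambda>\<beta>. \<psi> \<beta> - \<omega> \<beta>) \<in> boundaries Q" "(\<lambda>\<beta>. \<omega> \<beta> - \<psi> \<beta>) \<in> boundaries Q"
        unfolding eq by (rule square_boundary[OF x])+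
      then have "translate \<psi> S = translate \<omega> S" using True by (intro translate_cong_boundary) auto
      moreover have "g \<otimes> l (k+1) q \<otimes> l (k+2) (q + unit_vec (k+1)) = g \<otimes> l (k+2) q \<otimes> l (k+1) (q + unit_vec (k+2))"
        using assms sq True by (simp add: flat_on_def m_assoc)
      ultimately show ?thesis
        using True by (simp add: chain_step_def saturated_translate translate_translate \<psi>_def[abs_def] \<omega>_def[abs_def] fwd_def)
    qed (auto simp: chain_step_def)
  qed
qed

lemma inv_chain_step: "inv_into UNIV (chain_step Q i q) = chain_back Q i q"
  by (rule inv_unique_comp[OF chain_step_back chain_back_step])

lemma word_transport_chain_step:
  assumes "flat_on Q" "saturated Q S"
  shows "x \<in> X \<Longrightarrow> axis_connection.word_transport (chain_step Q) (fst x) w (snd x, S) =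
    (snd (lift_end x w), translate (\<lambda>\<beta>. path_sum \<beta> x w) S)"
  using assms(2)
proof (induction w arbitrary: x S)
  interpret axis_connection Q "chain_step Q" by (rule axis_connection_chain_step[OF assms(1)])
  case Nil
  then show ?case by (simp add: translate_zero)
next
  interpret axis_connection Q "chain_step Q" by (rule axis_connection_chain_step[OF assms(1)])
  case (Cons s w)
  define \<psi> where "\<psi> \<beta> = (if snd s then \<beta> (fst s) x else - \<beta> (fst s) (bwd (fst s) x))" for \<beta> :: "'g cochain"
  have g: "snd x \<in> carrier G" using Cons.prems by (simp add: X_def)
  have "(if snd s then chain_step Q (fst s) (fst x) else chain_back Q (fst s) (fst x + step_vec s)) (snd x, S)
      = (snd (move s x), translate \<psi> S)"
    using g Cons.prems(2)
    by (auto simp: chain_step_def chain_back_def move_def fwd_def bwd_def step_vec_def \<psi>_def[abs_def])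
  then show ?case
    using Cons.IH[of "move s x" "translate \<psi> S"] Cons.prems
    by (cases "snd s") (simp_all add: inv_chain_step saturated_translate translate_translate \<psi>_def)
qed

text \<open>Trivial transport fixes the pair of \<one> and the set of all boundaries. As 0 is a
  boundary, the translate of this set by the chain of \<open>w\<close> contains that chain, which is
  therefore itself a boundary.\<close>

lemma bounding_if_trivial_transport:
  assumes "flat_on Q"
    and "\<And>w. stays P 0 w \<Longrightarrow> lift_end base w = base \<Longrightarrow> axis_connection.word_transport (chain_step Q) 0 w = id"
  shows "bounding P Q"
  unfolding bounding_def
proof (intro allI impI, elim conjE)
  fix w assume w: "stays P 0 w" "lift_end base w = base"
  have zero: "(\<lambda>\<beta>. 0) \<in> boundaries Q"
    unfolding boundaries_def by (rule CollectI, rule exI[of _ "[]"]) auto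
  have sat: "saturated Q (boundaries Q)"
    unfolding saturated_def
  proof (intro ballI)
    fix b c assume "b \<in> boundaries Q" "c \<in> boundaries Q"
    then obtain rs us :: "(real \<times> 3 \<times> 'g vertex) list"
      where "b = (\<lambda>\<beta>. \<Sum>(s, k, x)\<leftarrow>rs. s * curl \<beta> k x)" "\<forall>(s, k, x)\<in>set rs. x \<in> X \<and> square_in Q k (fst x)"
        "c = (\<lambda>\<beta>. \<Sum>(s, k, x)\<leftarrow>us. s * curl \<beta> k x)" "\<forall>(s, k, x)\<in>set us. x \<in> X \<and> square_in Q k (fst x)"
      unfolding boundaries_def by blast
    then show "(\<lambda>\<beta>. b \<beta> + c \<beta>) \<in> boundaries Q"
      unfolding boundaries_def by (intro CollectI exI[of _ "rs @ us"]) auto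
  qed
  have "(\<one>, boundaries Q) = axis_connection.word_transport (chain_step Q) (fst base) w (snd base, boundaries Q)"
    using assms(2)[OF w] by (simp add: base_def)
  also have "\<dots> = (snd (lift_end base w), translate (\<lambda>\<beta>. path_sum \<beta> base w) (boundaries Q))"
    by (rule word_transport_chain_step[OF assms(1) sat base_in])
  finally have "boundaries Q = translate (\<lambda>\<beta>. path_sum \<beta> base w) (boundaries Q)" by simp
  moreover have "(\<lambda>\<beta>. 0 + path_sum \<beta> base w) \<in> translate (\<lambda>\<beta>. path_sum \<beta> base w) (boundaries Q)"
    unfolding translate_def by (rule image_eqI[OF _ zero]) simp
  ultimately have "(\<lambda>\<beta>. path_sum \<beta> base w) \<in> boundaries Q" by simp
  then obtain rs :: "(real \<times> 3 \<times> 'g vertex) list"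
    where "(\<lambda>\<beta>. path_sum \<beta> base w) = (\<lambda>\<beta>. \<Sum>(s, k, x)\<leftarrow>rs. s * curl \<beta> k x)"
      "\<forall>(s, k, x)\<in>set rs. x \<in> X \<and> square_in Q k (fst x)"
    unfolding boundaries_def by blast
  then show "\<exists>rs :: (real \<times> 3 \<times> 'g vertex) list. (\<forall>(s, k, x) \<in> set rs. x \<in> X \<and> square_in Q k (fst x)) \<and>
        (\<forall>\<beta>. path_sum \<beta> base w = (\<Sum>(s, k, x)\<leftarrow>rs. s * curl \<beta> k x))"
    by (intro exI[of _ rs]) (auto simp: fun_eq_iff)
qed

end

section \<open>Labels of lattice edges by loops in the exterior\<close>

context exterior_model
begin

definition reachable :: "int^3 \<Rightarrow> bool" where
  "reachable q \<longleftrightarrow> (\<exists>c. path_from_to c x (\<rho> (real_vec q)))"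

text \<open>At the origin the path is prescribed to be constant, so a closed word at 0 is labelled
  by its own class and not by a conjugate.\<close>

definition connector :: "int^3 \<Rightarrow> real \<Rightarrow> 'b" where
  "connector q = (if q = 0 then linepath x x else SOME c. path_from_to c x (\<rho> (real_vec q)))"

definition edge_path :: "int^3 \<Rightarrow> int^3 \<Rightarrow> real \<Rightarrow> 'b" where
  "edge_path a b = \<rho> \<circ> linepath (real_vec a) (real_vec b)"

text \<open>The value \<one> is a default. In a thick region reachability passes along edges in both
  directions, so on the squares there either all labels are genuine or all are \<one>.\<close>

definition label :: "3 \<Rightarrow> int^3 \<Rightarrow> (real \<Rightarrow> 'b) set" where
  "label i q = (if reachable q \<and> cball (real_vec q) 1 \<subseteq> U
     then cls (lasso (connector q) (edge_path q (q + unit_vec i)) (connector (q + unit_vec i))) else \<one>\<^bsub>G\<^esub>)"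

lemma \<rho>_0: "\<rho> 0 = x" using \<rho>_\<sigma>[OF x] \<sigma>_x by simp

lemma path_const: "path_from_to (linepath x x) x x"
  using x by (simp add: path_in_def)

lemma connector: "reachable q \<Longrightarrow> path_from_to (connector q) x (\<rho> (real_vec q))"
proof (cases "q = 0")
  case False
  assume "reachable q"
  then have "path_from_to (SOME c. path_from_to c x (\<rho> (real_vec q))) x (\<rho> (real_vec q))"
    unfolding reachable_def by (rule someI_ex)
  then show ?thesis using False by (simp add: connector_def)
qed (use path_const in \<open>simp add: connector_def \<rho>_0\<close>)

lemma path_from_to_\<rho>:
  assumes "path p" "path_image p \<subseteq> U"
  shows "path_from_to (\<rho> \<circ> p) (\<rho> (pathstart p)) (\<rho> (pathfinish p))"
  using assms path_continuous_image[OF assms(1) continuous_on_subset[OF cont_\<rho> assms(2)]] \<rho>_in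
  by (auto simp: path_in_def path_image_compose pathstart_compose pathfinish_compose)

lemma path_edge:
  assumes "cball (real_vec q) 1 \<subseteq> U"
  shows "path_from_to (edge_path q (q + step_vec s)) (\<rho> (real_vec q)) (\<rho> (real_vec (q + step_vec s)))"
  unfolding edge_path_def
  using path_from_to_\<rho>[of "linepath (real_vec q) (real_vec (q + step_vec s))"] segment_step[of q s] assms by simp

lemma step_vec_forward: "step_vec (i, True) = unit_vec i"
  by (simp add: step_vec_def)

lemma reachable_step:
  assumes "reachable q" "cball (real_vec q) 1 \<subseteq> U"
  shows "reachable (q + step_vec s)"
  using path_in_join[OF connector[OF assms(1)] path_edge[OF assms(2)]] unfolding reachable_def by blast

lemma reachable_zero: "reachable 0"
  using path_const \<rho>_0 by (auto simp: reachable_def)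

sublocale lattice_cover G label
proof (rule lattice_cover.intro[OF group_G], unfold_locales)
  fix i q
  show "label i q \<in> carrier G"
  proof (cases "reachable q \<and> cball (real_vec q) 1 \<subseteq> U")
    case True
    then have "path_from_to (edge_path q (q + unit_vec i)) (\<rho> (real_vec q)) (\<rho> (real_vec (q + unit_vec i)))"
      "reachable (q + unit_vec i)"
      using path_edge[of q "(i, True)"] reachable_step[of q "(i, True)"] by (simp_all add: step_vec_forward)
    then show ?thesis
      using True unfolding label_def by (auto intro!: cls_in path_from_to_lasso[OF connector _ connector])
  next
    case False
    then show ?thesis using group_G by (auto simp: label_def group.is_monoid monoid.one_closed)
  qed
qed

text \<open>The radius 4 leaves room for a convex ball about \<open>q\<close> that contains every
  lattice square with corner \<open>q\<close> and lies in \<open>U\<close>.\<close>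

definition thick :: "(int^3) set \<Rightarrow> bool" where
  "thick Q \<longleftrightarrow> (\<forall>q\<in>Q. cball (real_vec q) 4 \<subseteq> U)"

lemma homotopic_\<rho>:
  assumes "homotopic_paths U p q"
  shows "homotopic_paths E (\<rho> \<circ> p) (\<rho> \<circ> q)"
  using \<rho>_in by (intro homotopic_paths_continuous_image[OF assms cont_\<rho>]) auto

lemma homotopic_convex:
  fixes B :: "(real^3) set"
  assumes B: "convex B" and p: "path_in B p a b" and q: "path_in B q a b"
  shows "homotopic_paths B p q"
proof (rule homotopic_paths_linear)
  fix t :: real assume "t \<in> {0..1}"
  then have "p t \<in> B" "q t \<in> B" using p q by (auto simp: path_in_def path_image_def)
  then show "closed_segment (p t) (q t) \<subseteq> B" using B by (rule closed_segment_subset)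
qed (use p q in \<open>auto simp: path_in_def\<close>)

lemma thick_near: "thick Q \<Longrightarrow> q \<in> Q \<Longrightarrow> cball (real_vec q) 1 \<subseteq> U"
  unfolding thick_def by fastforce

text \<open>The two ways around a square are homotopic in a convex ball inside \<open>U\<close>,
  hence in \<open>E\<close> after applying \<open>\<rho>\<close>; the connectors at the intermediate
  corners cancel.\<close>

lemma flat_on_thick:
  assumes "thick Q"
  shows "flat_on Q"
  unfolding flat_on_def
proof (intro allI impI)
  fix k q assume sq: "square_in Q k q"
  let ?a = "q + unit_vec (k+1)" and ?b = "q + unit_vec (k+2)" and ?c = "q + unit_vec (k+1) + unit_vec (k+2)"
  have Q: "q \<in> Q" "?a \<in> Q" "?b \<in> Q" using sq by (auto simp: square_in_def)
  note near = Q[THEN thick_near[OF assms]]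
  have c: "?b + unit_vec (k+1) = ?c" by (simp add: algebra_simps)
  have e: "path_from_to (edge_path p (p + unit_vec i)) (\<rho> (real_vec p)) (\<rho> (real_vec (p + unit_vec i)))"
    if "cball (real_vec p) 1 \<subseteq> U" for p i
    using path_edge[OF that, of "(i, True)"] by (simp only: step_vec_forward)
  have r: "reachable (p + unit_vec i) \<longleftrightarrow> reachable p"
    if "cball (real_vec p) 1 \<subseteq> U" "cball (real_vec (p + unit_vec i)) 1 \<subseteq> U" for p i
    using reachable_step[of p "(i, True)"] reachable_step[of "p + unit_vec i" "(i, False)"] that
    by (auto simp: step_vec_def)
  show "label (k+1) q \<otimes>\<^bsub>G\<^esub> label (k+2) ?a = label (k+2) q \<otimes>\<^bsub>G\<^esub> label (k+1) ?b"
  proof (cases "reachable q")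
    case False
    then show ?thesis using r[OF near(1,2)] r[OF near(1,3)] by (simp add: label_def)
  next
    case True
    have ra: "reachable ?a" using r[OF near(1,2)] True by simp
    have rb: "reachable ?b" using r[OF near(1,3)] True by simp
    have rc: "reachable ?c" using reachable_step[OF ra near(2), of "(k+2, True)"] by (simp only: step_vec_forward)
    have 1: "label (k+1) q \<otimes>\<^bsub>G\<^esub> label (k+2) ?a = cls (lasso (connector q) (edge_path q ?a +++ edge_path ?a ?c) (connector ?c))"
      using True ra near
      by (simp add: label_def lasso_mult[OF connector[OF True] e[OF near(1)] connector[OF ra] e[OF near(2)] connector[OF rc]])
    have e2: "path_from_to (edge_path ?b ?c) (\<rho> (real_vec ?b)) (\<rho> (real_vec ?c))" using e[OF near(3), of "k+1"] by (simp only: c)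
    have lb: "label (k+1) ?b = cls (lasso (connector ?b) (edge_path ?b ?c) (connector ?c))"
      unfolding label_def c using rb near(3) by (simp del: real_vec_unit)
    have 2: "label (k+2) q \<otimes>\<^bsub>G\<^esub> label (k+1) ?b = cls (lasso (connector q) (edge_path q ?b +++ edge_path ?b ?c) (connector ?c))"
      unfolding lb using True near
      by (simp add: label_def lasso_mult[OF connector[OF True] e[OF near(1)] connector[OF rb] e2 connector[OF rc]])
    define B where "B = cball (real_vec q) 4"
    have B: "B \<subseteq> U" "convex B" using assms Q(1) by (auto simp: thick_def B_def)
    have v: "real_vec ?a \<in> B" "real_vec ?b \<in> B" "real_vec ?c \<in> B" "real_vec q \<in> B"
    proof -
      have "norm (axis (k+1) 1 + axis (k+2) 1 :: real^3) \<le> 4"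
        using norm_triangle_ineq[of "axis (k+1) 1 :: real^3" "axis (k+2) 1"] by (simp add: norm_axis_1)
      moreover have "real_vec q - real_vec ?c = - (axis (k+1) 1 + axis (k+2) 1)"
        unfolding real_vec_unit by (simp add: algebra_simps)
      ultimately show "real_vec ?c \<in> B" unfolding B_def mem_cball dist_norm by (simp only: norm_minus_cancel)
      show "real_vec ?a \<in> B" "real_vec ?b \<in> B" "real_vec q \<in> B"
        by (simp_all add: B_def dist_norm norm_axis_1)
    qed
    have seg: "path_in B (linepath a b) a b" if "a \<in> B" "b \<in> B" for a b
      using that B(2) by (simp add: path_in_def closed_segment_subset)
    have "homotopic_paths B (linepath (real_vec q) (real_vec ?a) +++ linepath (real_vec ?a) (real_vec ?c))
       (linepath (real_vec q) (real_vec ?b) +++ linepath (real_vec ?b) (real_vec ?c))"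
      by (rule homotopic_convex[OF B(2) path_in_join[OF seg[OF v(4) v(1)] seg[OF v(1) v(3)]]
          path_in_join[OF seg[OF v(4) v(2)] seg[OF v(2) v(3)]]])
    then have "homotopic_paths U (linepath (real_vec q) (real_vec ?a) +++ linepath (real_vec ?a) (real_vec ?c))
       (linepath (real_vec q) (real_vec ?b) +++ linepath (real_vec ?b) (real_vec ?c))"
      using B(1) homotopic_paths_subset by blast
    then have "homotopic_paths E (edge_path q ?a +++ edge_path ?a ?c) (edge_path q ?b +++ edge_path ?b ?c)"
      unfolding edge_path_def path_compose_join[symmetric] by (rule homotopic_\<rho>)
    then have "cls (lasso (connector q) (edge_path q ?a +++ edge_path ?a ?c) (connector ?c)) =
        cls (lasso (connector q) (edge_path q ?b +++ edge_path ?b ?c) (connector ?c))"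
      by (rule lasso_cong[OF connector[OF True] connector[OF rc] path_in_join[OF e[OF near(1)] e[OF near(2)]]])
    then show ?thesis by (simp only: 1 2)
  qed
qed

lemma lift_end_label:
  assumes "stays P q w" "\<And>p. p \<in> P \<Longrightarrow> cball (real_vec p) 1 \<subseteq> U" "reachable q" "g \<in> carrier G"
  shows "snd (lift_end (q, g) w) = g \<otimes>\<^bsub>G\<^esub> cls (lasso (connector q) (\<rho> \<circ> word_path q w) (connector (q + displacement w)))"
    and "reachable (q + displacement w)"
proof -
  have "snd (lift_end (q, g) w) = g \<otimes>\<^bsub>G\<^esub> cls (lasso (connector q) (\<rho> \<circ> word_path q w) (connector (q + displacement w)))
     \<and> reachable (q + displacement w)"
    using assms(1,3,4)
  proof (induction w arbitrary: q g)
    case Nil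
    have eq: "\<rho> \<circ> word_path q [] = linepath (\<rho> (real_vec q)) (\<rho> (real_vec q))"
      by (simp add: fun_eq_iff linepath_refl)
    show ?case
      unfolding eq lift_end.simps displacement_simps add_0_right lasso_const[OF connector[OF Nil(2)]]
      using Nil by simp
  next
    case (Cons s w)
    let ?q = "q + step_vec s"
    have q: "q \<in> P" "?q \<in> P" "stays P ?q w" using Cons.prems by (auto dest: stays_start)
    note near = q(1,2)[THEN assms(2)]
    have r: "reachable ?q" using Cons.prems near by (intro reachable_step)
    define c where "c = cls (lasso (connector q) (edge_path q ?q) (connector ?q))"
    have ee: "path_from_to (edge_path q ?q) (\<rho> (real_vec q)) (\<rho> (real_vec ?q))"
      by (rule path_edge[OF near(1)])
    have c_in: "c \<in> carrier G"
      unfolding c_def by (intro cls_in path_from_to_lasso[OF connector[OF Cons.prems(2)] ee connector[OF r]])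
    have mv: "move s (q, g) = (?q, g \<otimes>\<^bsub>G\<^esub> c)"
    proof (cases "snd s")
      case True
      then have "?q = q + unit_vec (fst s)" by (simp add: step_vec_def)
      then show ?thesis using True Cons.prems near by (simp add: move_def fwd_def label_def c_def)
    next
      case False
      then have qs: "?q = q - unit_vec (fst s)" "?q + unit_vec (fst s) = q" by (simp_all add: step_vec_def)
      have e': "path_from_to (edge_path ?q q) (\<rho> (real_vec ?q)) (\<rho> (real_vec q))"
        using path_edge[OF near(2), of "(fst s, True)"] unfolding step_vec_forward qs(2) .
      have rev: "reversepath (edge_path ?q q) = edge_path q ?q"
        by (simp add: edge_path_def path_compose_reversepath[symmetric] reversepath_linepath)
      have "label (fst s) ?q = cls (lasso (connector ?q) (edge_path ?q q) (connector q))"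
        using r near by (simp only: label_def qs(2)) simp
      then have "inv\<^bsub>G\<^esub> label (fst s) ?q = c"
        using lasso_inv[OF connector[OF r] e' connector[OF Cons.prems(2)]] by (simp add: c_def rev)
      then show ?thesis using False qs by (simp add: move_def bwd_def)
    qed
    have wp: "path_from_to (\<rho> \<circ> word_path ?q w) (\<rho> (real_vec ?q)) (\<rho> (real_vec (?q + displacement w)))"
    proof -
      have "path_image (word_path ?q w) \<subseteq> U"
        using path_image_word_path[OF q(3)] assms(2) by blast
      then show ?thesis using path_from_to_\<rho>[of "word_path ?q w"] by simp
    qed
    have gc: "g \<otimes>\<^bsub>G\<^esub> c \<in> carrier G" using c_in Cons.prems(3) by simp
    have IH: "snd (lift_end (?q, g \<otimes>\<^bsub>G\<^esub> c) w) = g \<otimes>\<^bsub>G\<^esub> c \<otimes>\<^bsub>G\<^esub>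
        cls (lasso (connector ?q) (\<rho> \<circ> word_path ?q w) (connector (?q + displacement w)))"
      "reachable (?q + displacement w)"
      using Cons.IH[OF q(3) r gc] by blast+
    have l_in: "cls (lasso (connector ?q) (\<rho> \<circ> word_path ?q w) (connector (?q + displacement w))) \<in> carrier G"
      by (intro cls_in path_from_to_lasso[OF connector[OF r] wp connector[OF IH(2)]])
    have "c \<otimes>\<^bsub>G\<^esub> cls (lasso (connector ?q) (\<rho> \<circ> word_path ?q w) (connector (?q + displacement w))) =
      cls (lasso (connector q) (edge_path q ?q +++ (\<rho> \<circ> word_path ?q w)) (connector (?q + displacement w)))"
      unfolding c_def by (rule lasso_mult[OF connector[OF Cons.prems(2)] ee connector[OF r] wp connector[OF IH(2)]])
    then show ?case
      using IH mv c_in l_in Cons.prems(3)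
      by (simp add: m_assoc edge_path_def path_compose_join add.assoc)
  qed
  then show "snd (lift_end (q, g) w) = g \<otimes>\<^bsub>G\<^esub> cls (lasso (connector q) (\<rho> \<circ> word_path q w) (connector (q + displacement w)))"
    "reachable (q + displacement w)" by auto
qed

lemma lasso_base:
  assumes "path_from_to s x x"
  shows "cls (lasso (linepath x x) s (linepath x x)) = cls s"
proof -
  have "homotopic_paths E (lasso (linepath x x) s (linepath x x)) (s +++ linepath x x)"
    unfolding lasso_def reversepath_linepath
    using path_in_join[OF assms path_const] by (intro homotopic_paths_lid') (auto simp: path_in_def)
  also have "homotopic_paths E \<dots> s"
    using assms by (intro homotopic_paths_rid') (auto simp: path_in_def)
  finally show ?thesis
    using path_from_to_lasso[OF path_const assms path_const] by (simp add: cls_eq_iff)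
qed

lemma lift_end_closed_word:
  assumes "stays P 0 w" "thick P" "displacement w = 0"
  shows "lift_end base w = (0, cls (\<rho> \<circ> word_path 0 w))" and "path_from_to (\<rho> \<circ> word_path 0 w) x x"
proof -
  have near: "cball (real_vec p) 1 \<subseteq> U" if "p \<in> P" for p using thick_near[OF assms(2) that] .
  have "path_image (word_path 0 w) \<subseteq> U"
    using path_image_word_path[OF assms(1)] near by blast
  then show wp: "path_from_to (\<rho> \<circ> word_path 0 w) x x"
    using path_from_to_\<rho>[of "word_path 0 w"] assms(3) by (simp add: \<rho>_0)
  have "snd (lift_end (0, \<one>\<^bsub>G\<^esub>) w) = \<one>\<^bsub>G\<^esub> \<otimes>\<^bsub>G\<^esub> cls (\<rho> \<circ> word_path 0 w)"
    using lift_end_label(1)[OF assms(1) near reachable_zero, of "\<one>\<^bsub>G\<^esub>"] assms(3)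
    by (simp add: connector_def lasso_base[OF wp])
  then have "snd (lift_end base w) = cls (\<rho> \<circ> word_path 0 w)"
    using cls_in[OF wp] by (simp add: base_def)
  moreover have "fst (lift_end base w) = 0" using assms(3) by simp
  ultimately show "lift_end base w = (0, cls (\<rho> \<circ> word_path 0 w))" by (metis prod.collapse)
qed

text \<open>The covering unwraps the fundamental group: a word whose lift closes up represents a
  loop that is trivial in \<open>E\<close>, so \<open>trivial_transport\<close> applies to the
  chains along it.\<close>

lemma bounding_pushable:
  assumes "thick P" "thick Q" "pushable P Q" "collar Q"
  shows "bounding P Q"
proof (rule bounding_if_trivial_transport[OF flat_on_thick[OF assms(2)]])
  fix w assume w: "stays P 0 w" "lift_end base w = base"
  have d: "displacement w = 0" using arg_cong[OF w(2), of fst] by simp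
  have "cls (\<rho> \<circ> word_path 0 w) = \<one>\<^bsub>G\<^esub>"
    using lift_end_closed_word(1)[OF w(1) assms(1) d] w(2) by (simp add: base_def)
  then have "homotopic_paths E (\<rho> \<circ> word_path 0 w) (linepath x x)"
    using cls_eq_iff[OF lift_end_closed_word(2)[OF w(1) assms(1) d]] by (simp add: one_G)
  then show "axis_connection.word_transport (chain_step Q) 0 w = id"
    by (rule trivial_transport[OF axis_connection_chain_step[OF flat_on_thick[OF assms(2)]] assms(3,4) w(1) d])
qed

end

section \<open>Loops of the exterior as lattice words\<close>

lemma dist_le_sum_components:
  assumes "\<And>i. \<bar>(a - b :: real^3) $ i\<bar> \<le> r"
  shows "dist a b \<le> 3 * r"
proof -
  have "(\<Sum>i\<in>UNIV. \<bar>(a - b) $ i\<bar>) \<le> (\<Sum>i\<in>(UNIV::3 set). r)"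
    using assms by (intro sum_mono)
  then show ?thesis using norm_le_l1_cart[of "a - b"] by (simp add: dist_norm)
qed

lemma dist_floor_vec: "dist (real_vec (floor_vec z)) z \<le> 3"
proof -
  have "\<bar>(real_vec (floor_vec z) - z) $ i\<bar> \<le> 1" for i
    by (simp add: floor_vec_def) linarith
  then show ?thesis using dist_le_sum_components[of "real_vec (floor_vec z)" z 1] by simp
qed

lemma dist_king_adjacent: "king_adjacent a b \<Longrightarrow> dist (real_vec a) (real_vec b) \<le> 3"
proof -
  assume "king_adjacent a b"
  then have "\<bar>(real_vec a - real_vec b) $ i\<bar> \<le> 1" for i
    unfolding king_adjacent_def by (simp flip: of_int_diff of_int_abs)
  then show ?thesis using dist_le_sum_components[of "real_vec a" "real_vec b" 1] by simp
qed

definition axis_word :: "3 \<Rightarrow> int \<Rightarrow> lattice_word" where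
  "axis_word i d = (if d = 1 then [(i, True)] else if d = -1 then [(i, False)] else [])"

lemma displacement_axis_word: "\<bar>d\<bar> \<le> 1 \<Longrightarrow> displacement (axis_word i d) = axis i d"
  by (auto simp: axis_word_def step_vec_def vec_eq_iff axis_def)

lemma stays_axis_word: "\<bar>d\<bar> \<le> 1 \<Longrightarrow> stays S q (axis_word i d) \<longleftrightarrow> q \<in> S \<and> q + axis i d \<in> S"
proof -
  have "step_vec (i, True) = axis i 1" "step_vec (i, False) = axis i (-1)"
    by (simp_all add: step_vec_def vec_eq_iff axis_def)
  moreover have zero: "axis i 0 = (0 :: int^3)" by (simp add: vec_eq_iff axis_def)
  moreover assume "\<bar>d\<bar> \<le> 1"
  then have "d = 1 \<or> d = 0 \<or> d = -1" by linarith
  ultimately show ?thesis by (elim disjE) (simp_all add: axis_word_def zero)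
qed

text \<open>One coordinate is changed at a time, and all intermediate points remain neighbours of
  a.\<close>

lemma king_word:
  assumes "king_adjacent a b"
  obtains w where "stays {c. king_adjacent a c} a w" "a + displacement w = b"
proof -
  define d where "d = b - a"
  have d: "\<bar>d $ i\<bar> \<le> 1" for i using assms by (simp add: d_def king_adjacent_def abs_minus_commute)
  define w where "w = axis_word 1 (d $ 1) @ axis_word 2 (d $ 2) @ axis_word 3 (d $ 3)"
  have b: "a + axis 1 (d $ 1) + axis 2 (d $ 2) + axis 3 (d $ 3) = b"
    by (simp add: vec_eq_iff forall_3 axis_def d_def)
  have "stays {c. king_adjacent a c} a w"
    using d by (simp add: w_def stays_append stays_axis_word displacement_axis_word king_adjacent_def forall_3 axis_def)
  moreover have "a + displacement w = b"
    using d b by (simp add: w_def displacement_axis_word add.assoc)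
  ultimately show ?thesis by (rule that)
qed

lemma path_in_mono: "path_in S p a b \<Longrightarrow> S \<subseteq> T \<Longrightarrow> path_in T p a b"
  by (auto simp: path_in_def)

lemma path_in_subpath:
  assumes "path p" "path_image p \<subseteq> S" "u \<in> {0..1}" "v \<in> {0..1}"
  shows "path_in S (subpath u v p) (p u) (p v)"
  using assms path_image_subpath_subset[of u v p] by (auto simp: path_in_def)

lemma path_in_linepath: "convex S \<Longrightarrow> a \<in> S \<Longrightarrow> b \<in> S \<Longrightarrow> path_in S (linepath a b) a b"
  by (simp add: path_in_def closed_segment_subset)

lemma path_in_word_path:
  assumes "stays P q w" "\<And>p. p \<in> P \<Longrightarrow> cball (real_vec p) 1 \<subseteq> S"
  shows "path_in S (word_path q w) (real_vec q) (real_vec (q + displacement w))"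
  using path_image_word_path[OF assms(1)] assms(2) by (fastforce simp: path_in_def)

lemma word_path_append:
  assumes "stays P q (u @ w)" "\<And>p. p \<in> P \<Longrightarrow> cball (real_vec p) 1 \<subseteq> S"
  shows "homotopic_paths S (word_path q (u @ w)) (word_path q u +++ word_path (q + displacement u) w)"
  using assms(1)
proof (induction u arbitrary: q)
  case Nil
  then have "path_in S (word_path q w) (real_vec q) (real_vec (q + displacement w))"
    using assms(2) by (intro path_in_word_path) auto
  then have "homotopic_paths S (linepath (real_vec q) (real_vec q) +++ word_path q w) (word_path q w)"
    by (intro homotopic_paths_lid') (auto simp: path_in_def)
  then show ?case by (simp only: append_Nil word_path.simps displacement_simps add_0_right) (rule homotopic_paths_sym)
next
  case (Cons s u)
  let ?q = "q + step_vec s"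
  have st: "q \<in> P" "stays P ?q (u @ w)" "stays P ?q u" "stays P (?q + displacement u) w"
    using Cons.prems by (auto simp: stays_append)
  have 1: "path_in S (linepath (real_vec q) (real_vec ?q)) (real_vec q) (real_vec ?q)"
    using segment_step[of q s] assms(2)[OF st(1)] by (auto simp: path_in_def)
  have 2: "path_in S (word_path ?q u) (real_vec ?q) (real_vec (?q + displacement u))"
    using st(3) assms(2) by (rule path_in_word_path)
  have 3: "path_in S (word_path (?q + displacement u) w) (real_vec (?q + displacement u)) (real_vec (?q + displacement u + displacement w))"
    using st(4) assms(2) by (rule path_in_word_path)
  have "homotopic_paths S (word_path q ((s # u) @ w))
     (linepath (real_vec q) (real_vec ?q) +++ (word_path ?q u +++ word_path (?q + displacement u) w))"
    unfolding append_Cons word_path.simps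
    using Cons.IH[OF st(2)] by (intro homotopic_join homotopic_refl[OF 1]) auto
  also have "homotopic_paths S \<dots> (word_path q (s # u) +++ word_path (?q + displacement u) w)"
    unfolding word_path.simps by (rule homotopic_paths_sym[OF homotopic_assoc[OF 1 2 3]])
  finally show ?case by (simp only: displacement_simps add.assoc)
qed

context exterior_model
begin

text \<open>Induction on the samples. The next piece of p, the segments from its ends to the lattice
  and the new piece of the word lie in one convex ball inside \<open>U\<close>, so they can be
  exchanged by a homotopy there.\<close>

lemma word_approximates_path:
  assumes p: "path p" "path_image p \<subseteq> \<sigma> ` E" "p 0 = 0"
    and deep: "\<And>e. e \<in> E \<Longrightarrow> cball (\<sigma> e) 8 \<subseteq> U"
    and near: "\<And>e b. e \<in> E \<Longrightarrow> dist (real_vec b) (\<sigma> e) \<le> 6 \<Longrightarrow> b \<in> P"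
    and P: "thick P" and N: "fine_samples N p"
  shows "i \<le> N \<Longrightarrow> \<exists>w. stays P 0 w \<and> displacement w = sample N p i \<and>
     homotopic_paths U (word_path 0 w)
       (subpath 0 (real i / real N) p +++ linepath (p (real i / real N)) (real_vec (sample N p i)))"
proof (induction i)
  case 0
  have s0: "sample N p 0 = 0" using p(3) floor_real_vec[of 0] by (simp add: sample_def)
  have "0 \<in> path_image p" using p(3) by (auto simp: path_image_def intro!: image_eqI[of _ _ 0])
  then obtain e where e: "e \<in> E" "\<sigma> e = 0" using p(2) by auto
  have "0 \<in> P" using near[OF e(1), of 0] e by simp
  have "0 \<in> U" using \<sigma>_in[OF e(1)] e by simp
  have "path_in {0} (subpath 0 0 p +++ linepath 0 0) 0 0"
    using p(3) by (intro path_in_join) (auto simp: path_in_def subpath_refl)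
  moreover have "path_in {0::real^3} (word_path 0 []) 0 0" by (simp add: path_in_def)
  ultimately have "homotopic_paths {0} (word_path 0 []) (subpath 0 0 p +++ linepath 0 0)"
    by (intro homotopic_convex[of "{0}" _ 0 0]) auto
  then have "homotopic_paths U (word_path 0 []) (subpath 0 0 p +++ linepath 0 0)"
    using \<open>0 \<in> U\<close> homotopic_paths_subset by blast
  then have "homotopic_paths U (word_path 0 [])
      (subpath 0 (real 0 / real N) p +++ linepath (p (real 0 / real N)) (real_vec (sample N p 0)))"
    by (simp only: s0 of_nat_0 div_0 p(3) real_vec_zero)
  then show ?case using \<open>0 \<in> P\<close> s0 by (intro exI[of _ "[]"]) (simp del: word_path.simps)
next
  case (Suc i)
  have N0: "N > 0" using N by (simp add: fine_samples_def)
  define s where "s = real i / real N"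
  define u where "u = real (Suc i) / real N"
  have su: "s \<in> {0..1}" "u \<in> {0..1}" "s \<le> u" "u - s = 1 / real N"
    using Suc.prems N0 by (auto simp: s_def u_def divide_simps)
  define a where "a = sample N p i"
  define b where "b = sample N p (Suc i)"
  obtain w where w: "stays P 0 w" "displacement w = a"
    "homotopic_paths U (word_path 0 w) (subpath 0 s p +++ linepath (p s) (real_vec a))"
    using Suc by (auto simp: a_def s_def)
  have close: "\<bar>p r $ k - p r' $ k\<bar> < 1" if "r \<in> {s..u}" "r' \<in> {s..u}" for r r' k
  proof -
    have "\<bar>r - r'\<bar> \<le> 1 / real N" "r \<in> {0..1}" "r' \<in> {0..1}" using that su by auto
    then show ?thesis using N unfolding fine_samples_def by blast
  qed
  have ab: "king_adjacent a b"
    unfolding a_def b_def sample_def s_def[symmetric] u_def[symmetric]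
    using close[of s u] su(3) by (intro king_adjacent_floor) auto
  obtain w' where w': "stays {c. king_adjacent a c} a w'" "a + displacement w' = b"
    using king_word[OF ab] .
  have "p s \<in> path_image p" using su(1) by (simp add: path_image_def)
  then obtain e where e: "e \<in> E" "p s = \<sigma> e" using p(2) by auto
  \<comment> \<open>The floor of \<open>p s\<close> is within 3 of it, the neighbours of the floor
    within 6, and the unit balls about these within 7.\<close>
  define B where "B = cball (p s) 8"
  have B: "convex B" "B \<subseteq> U" using deep[OF e(1)] e(2) by (auto simp: B_def)
  have da: "dist (real_vec a) (p s) \<le> 3" using dist_floor_vec[of "p s"] by (simp add: a_def sample_def s_def)
  have dc: "dist (real_vec c) (p s) \<le> 6" if "king_adjacent a c" for c
    using dist_triangle[of "real_vec c" "p s" "real_vec a"] dist_king_adjacent[OF that] da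
    by (simp add: dist_commute)
  have cP: "c \<in> P" if "king_adjacent a c" for c
    using near[OF e(1), of c] dc[OF that] e(2) by simp
  have cB: "cball (real_vec c) 1 \<subseteq> B" if "king_adjacent a c" for c
  proof
    fix z assume "z \<in> cball (real_vec c) 1"
    then have "dist (p s) z \<le> 7"
      using dc[OF that] dist_triangle[of "p s" z "real_vec c"] by (simp add: dist_commute)
    then show "z \<in> B" by (simp add: B_def)
  qed
  have centre: "real_vec c \<in> B" if "king_adjacent a c" for c
    using subsetD[OF cB[OF that], of "real_vec c"] by simp
  have inB: "real_vec a \<in> B" "real_vec b \<in> B" "p s \<in> B"
    using centre[of a] centre[OF ab] by (simp_all add: B_def)
  have pB: "p r \<in> B" if "r \<in> {s..u}" for r
  proof -
    have "dist (p s) (p r) \<le> 3 * 1"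
      using close[of s r] that su(3) by (intro dist_le_sum_components) (auto intro: less_imp_le)
    then show ?thesis by (simp add: B_def)
  qed
  have subB: "path_in B (subpath s u p) (p s) (p u)"
  proof -
    have "path_image (subpath s u p) \<subseteq> B"
      using pB su(3) by (auto simp: path_image_subpath)
    then show ?thesis using p(1) su by (simp add: path_in_def)
  qed
  have wB: "path_in B (word_path a w') (real_vec a) (real_vec b)"
    using path_in_word_path[OF w'(1), of B] cB w'(2) by auto
  have pu: "p u \<in> B" using pB[of u] su(3) by simp
  define k where "k = linepath (p s) (real_vec a)"
  have k: "path_in B k (p s) (real_vec a)" "reversepath k = linepath (real_vec a) (p s)"
    using path_in_linepath[OF B(1) inB(3,1)] by (simp_all add: k_def reversepath_linepath)
  define k' where "k' = linepath (p u) (real_vec b)"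
  have k': "path_in B k' (p u) (real_vec b)"
    using path_in_linepath[OF B(1) pu inB(2)] by (simp add: k'_def)
  have rk: "path_in B (reversepath k) (real_vec a) (p s)" using k(1) by (rule path_in_reverse)
  have hB: "homotopic_paths U (word_path a w') (reversepath k +++ (subpath s u p +++ k'))"
    using homotopic_convex[OF B(1) wB path_in_join[OF rk path_in_join[OF subB k']]] B(2) homotopic_paths_subset by blast
  have pU: "path_image p \<subseteq> U" using p(2) \<sigma>_in by auto
  have s0: "path_in U (subpath 0 s p) 0 (p s)"
    using path_in_subpath[OF p(1) pU, of 0 s] su(1) p(3) by simp
  note U = path_in_mono[OF _ B(2)]
  have kU: "path_in U k (p s) (real_vec a)" and kU': "path_in U k' (p u) (real_vec b)" and
    subU: "path_in U (subpath s u p) (p s) (p u)" and rkU: "path_in U (reversepath k) (real_vec a) (p s)"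
    using U[OF k(1)] U[OF k'] U[OF subB] U[OF rk] by auto
  have tail: "path_in U (subpath s u p +++ k') (p s) (real_vec b)" using subU kU' by (rule path_in_join)
  have st: "stays P 0 (w @ w')"
    using w w' stays_mono[OF w'(1), of P] cP by (auto simp: stays_append)
  have "homotopic_paths U (word_path 0 (w @ w')) (word_path 0 w +++ word_path (0 + displacement w) w')"
    using st thick_near[OF P] by (rule word_path_append)
  also have "homotopic_paths U \<dots> ((subpath 0 s p +++ k) +++ (reversepath k +++ (subpath s u p +++ k')))"
    using w(2,3) hB by (intro homotopic_join) (auto simp: k_def)
  also have "homotopic_paths U \<dots> (subpath 0 s p +++ (k +++ (reversepath k +++ (subpath s u p +++ k'))))"
    by (rule homotopic_assoc[OF s0 kU path_in_join[OF rkU tail]])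
  also have "homotopic_paths U \<dots> (subpath 0 s p +++ (subpath s u p +++ k'))"
    using s0 kU
    by (intro homotopic_join[OF homotopic_refl[OF s0] homotopic_cancel(2)[OF kU path_in_join[OF rkU tail] tail]])
       (simp add: path_in_def)
  also have "homotopic_paths U \<dots> ((subpath 0 s p +++ subpath s u p) +++ k')"
    by (rule homotopic_paths_sym[OF homotopic_assoc[OF s0 subU kU']])
  also have "homotopic_paths U \<dots> (subpath 0 u p +++ k')"
    using su p(1) pU kU' subU
    by (intro homotopic_join homotopic_refl[OF kU'] homotopic_join_subpaths) (auto simp: path_in_def)
  finally have "homotopic_paths U (word_path 0 (w @ w')) (subpath 0 u p +++ k')" .
  moreover have "displacement (w @ w') = b" using w w' by simp
  ultimately show ?case using st unfolding k'_def u_def b_def by blast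
qed

lemma full_holonomy_thick:
  assumes deep: "\<And>e. e \<in> E \<Longrightarrow> cball (\<sigma> e) 8 \<subseteq> U"
    and near: "\<And>e b. e \<in> E \<Longrightarrow> dist (real_vec b) (\<sigma> e) \<le> 6 \<Longrightarrow> b \<in> P"
    and P: "thick P"
  shows "full_holonomy P"
  unfolding full_holonomy_def
proof
  fix g assume "g \<in> carrier G"
  then obtain \<gamma> where \<gamma>: "path_from_to \<gamma> x x" "g = cls \<gamma>"
    by (auto simp: carrier_fundamental_group cls_def loops_at_iff)
  define p where "p = \<sigma> \<circ> \<gamma>"
  have p: "path p" "path_image p \<subseteq> \<sigma> ` E" "p 0 = 0" "p 1 = 0"
    using \<gamma>(1) path_continuous_image[of \<gamma> \<sigma>] continuous_on_subset[OF cont_\<sigma>] \<sigma>_x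
    by (auto simp: p_def path_in_def path_image_compose pathstart_def pathfinish_def)
  obtain N where N: "fine_samples N p" using fine_samples_exists[OF p(1)] ..
  have N0: "N > 0" using N by (simp add: fine_samples_def)
  have sN: "sample N p N = 0" using p(4) N0 floor_real_vec[of 0] by (simp add: sample_def)
  obtain w where "stays P 0 w \<and> displacement w = sample N p N \<and>
     homotopic_paths U (word_path 0 w) (subpath 0 (real N / real N) p +++ linepath (p (real N / real N)) (real_vec (sample N p N)))"
    using word_approximates_path[OF p(1-3) deep near P N order_refl] by (rule exE)
  then have w: "stays P 0 w" "displacement w = sample N p N"
     "homotopic_paths U (word_path 0 w) (subpath 0 (real N / real N) p +++ linepath (p (real N / real N)) (real_vec (sample N p N)))"
    by blast+
  have d: "displacement w = 0" using w(2) sN by simp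
  have "homotopic_paths U (word_path 0 w) (p +++ linepath 0 0)"
    using w(3) N0 p(4) sN by simp
  also have "homotopic_paths U (p +++ linepath 0 0) p"
    using p \<sigma>_in by (intro homotopic_paths_rid') (auto simp: pathfinish_def)
  finally have "homotopic_paths E (\<rho> \<circ> word_path 0 w) (\<rho> \<circ> p)" by (rule homotopic_\<rho>)
  \<comment> \<open>Only a homotopy is claimed, since the two functions need agree only on the unit
    interval.\<close>
  also have "homotopic_paths E (\<rho> \<circ> p) \<gamma>"
  proof (rule homotopic_paths_eq)
    show "path (\<rho> \<circ> p)" "path_image (\<rho> \<circ> p) \<subseteq> E"
      using homotopic_paths_imp_path[OF calculation] homotopic_paths_imp_subset[OF calculation] by auto
    show "(\<rho> \<circ> p) t = \<gamma> t" if "t \<in> {0..1}" for t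
    proof -
      have "\<gamma> t \<in> path_image \<gamma>" using that by (simp add: path_image_def)
      then show ?thesis using \<gamma>(1) \<rho>_\<sigma>[of "\<gamma> t"] by (auto simp: p_def path_in_def)
    qed
  qed
  finally have "homotopic_paths E (\<rho> \<circ> word_path 0 w) \<gamma>" .
  then have "cls (\<rho> \<circ> word_path 0 w) = g"
    using cls_eq_iff[OF lift_end_closed_word(2)[OF w(1) P d]] \<gamma>(2) by simp
  then show "\<exists>w. stays P 0 w \<and> lift_end base w = (0, g)"
    using lift_end_closed_word(1)[OF w(1) P d] w(1) by auto
qed

end

section \<open>The exterior as a retract of an open subset of space\<close>

text \<open>Openness comes from invariance of domain. An angle and the disc coordinate parametrize a
  patch of the tube by an open subset of a 3-dimensional space, and deleting a point of the sphere
  off the patch turns the target into R^3.\<close>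

lemma openin_tube:
  assumes V: "V \<subseteq> S3" and h: "homeomorphism (S1 \<times> (UNIV :: complex set)) V h h'"
  shows "openin (top_of_set S3) (h ` (S1 \<times> ball 0 1))"
proof (subst openin_subopen, intro ballI)
  fix k assume "k \<in> h ` (S1 \<times> ball 0 1)"
  then obtain s0 z0 where k: "s0 \<in> S1" "z0 \<in> ball 0 1" "k = h (s0, z0)" by auto
  have cont: "continuous_on (S1 \<times> UNIV) h" and inj: "inj_on h (S1 \<times> UNIV)" and im: "h ` (S1 \<times> UNIV) = V"
    using h by (auto simp: homeomorphism_def intro!: inj_on_inverseI[where g = h'])
  \<comment> \<open>Angles between -1 and 1 are within pi/2, so \<open>cis\<close> is injective on
    them and has positive real part.\<close>
  define D where "D = {-1<..<1::real} \<times> ball (0::complex) 1"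
  define \<phi> where "\<phi> = (\<lambda>(\<theta>::real, z::complex). h (s0 * cis \<theta>, z))"
  have D: "open D" by (simp add: D_def open_Times)
  have s_in: "s0 * cis \<theta> \<in> S1" for \<theta> using k(1) by (simp add: norm_mult)
  have cont_\<phi>: "continuous_on D \<phi>"
    unfolding \<phi>_def case_prod_unfold
    by (rule continuous_on_compose2[OF cont]) (use s_in in \<open>auto intro!: continuous_intros\<close>)
  have cis_inj: "\<theta> = \<theta>'" if "cis \<theta> = cis \<theta>'" "\<theta> \<in> {-1<..<1}" "\<theta>' \<in> {-1<..<1}" for \<theta> \<theta>'
  proof -
    have "sin \<theta> = sin \<theta>'" using that(1) by (auto simp: complex_eq_iff)
    moreover have "\<bar>\<theta>\<bar> \<le> pi / 2" "\<bar>\<theta>'\<bar> \<le> pi / 2" using that(2,3) pi_gt3 by auto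
    ultimately show ?thesis by (metis sin_inj_pi abs_le_iff minus_le_iff)
  qed
  have inj_\<phi>: "inj_on \<phi> D"
  proof (rule inj_onI, clarify)
    fix \<theta> z \<theta>' z' assume D: "(\<theta>, z) \<in> D" "(\<theta>', z') \<in> D" and eq: "\<phi> (\<theta>, z) = \<phi> (\<theta>', z')"
    have "(s0 * cis \<theta>, z) = (s0 * cis \<theta>', z')"
      using inj_onD[OF inj eq[unfolded \<phi>_def case_prod_conv]] s_in by auto
    moreover have "s0 \<noteq> 0" using k(1) by auto
    ultimately show "\<theta> = \<theta>' \<and> z = z'" using cis_inj D by (auto simp: D_def)
  qed
  \<comment> \<open>The antipodal core point; positivity of the cosine keeps it off the
    patch.\<close>
  define b where "b = h (- s0, 0)"
  have "h (- s0, 0) \<in> h ` (S1 \<times> UNIV)" using k(1) by (intro imageI) simp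
  then have b: "b \<in> S3" using V im by (auto simp only: b_def)
  have b_notin: "b \<notin> \<phi> ` D"
  proof
    assume "b \<in> \<phi> ` D"
    then obtain \<theta> z where \<theta>: "(\<theta>, z) \<in> D" "h (- s0, 0) = h (s0 * cis \<theta>, z)" by (auto simp: b_def \<phi>_def)
    have "(- s0, 0) = (s0 * cis \<theta>, z)"
      using inj_onD[OF inj \<theta>(2)] s_in k(1) by auto
    then have "s0 * cis \<theta> = s0 * (-1)" by simp
    moreover have "s0 \<noteq> 0" using k(1) by auto
    ultimately have "cis \<theta> = -1" using mult_left_cancel[of s0 "cis \<theta>" "-1"] by blast
    then have "cos \<theta> = -1" by (simp add: complex_eq_iff)
    moreover have "cos \<theta> > 0" using \<theta>(1) pi_gt3 by (intro cos_gt_zero_pi) (auto simp: D_def)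
    ultimately show False by simp
  qed
  have "(S3 - {b}) homeomorphic (UNIV :: (real^3) set)"
    using b by (intro homeomorphic_punctured_sphere_affine) auto
  then obtain st st' where st: "homeomorphism (S3 - {b}) (UNIV :: (real^3) set) st st'"
    by (auto simp: homeomorphic_def)
  have \<phi>_in: "\<phi> ` D \<subseteq> S3 - {b}"
    using b_notin V im s_in by (auto simp: \<phi>_def)
  have "open ((st \<circ> \<phi>) ` D)"
  proof (rule invariance_of_domain_gen[OF D])
    show "continuous_on D (st \<circ> \<phi>)"
      using cont_\<phi> st \<phi>_in by (intro continuous_on_compose) (auto simp: homeomorphism_def intro: continuous_on_subset)
    show "inj_on (st \<circ> \<phi>) D"
      using inj_\<phi> st \<phi>_in by (intro comp_inj_on) (auto simp: homeomorphism_def intro!: inj_on_inverseI[where g = st'])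
  qed simp
  then have "openin (top_of_set (S3 - {b})) (st' ` (st \<circ> \<phi>) ` D)"
    using homeomorphism_imp_open_map[OF homeomorphism_sym[THEN iffD1, OF st]] by simp
  moreover have "st' ` (st \<circ> \<phi>) ` D = \<phi> ` D"
    using st \<phi>_in unfolding image_image by (intro image_cong) (auto simp: homeomorphism_def)
  moreover have "openin (top_of_set S3) (S3 - {b})"
    by (intro openin_delete) simp
  ultimately have "openin (top_of_set S3) (\<phi> ` D)" by (metis openin_trans)
  moreover have "k \<in> \<phi> ` D"
    using k by (auto simp: \<phi>_def D_def intro!: image_eqI[of _ _ "(0, z0)"])
  moreover have "\<phi> ` D \<subseteq> h ` (S1 \<times> ball 0 1)"
    using s_in by (auto simp: \<phi>_def D_def)
  ultimately show "\<exists>T. openin (top_of_set S3) T \<and> k \<in> T \<and> T \<subseteq> h ` (S1 \<times> ball 0 1)" by blast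
qed

text \<open>Removing a smaller closed tube leaves \<open>E\<close> together with a shell on which
  the normal coordinate is nonzero. The retraction pushes this shell radially outwards onto the
  boundary torus; \<open>k0\<close> is a core point.\<close>

lemma exterior_retract:
  assumes "is_exterior E K"
  obtains W r k0 where "openin (top_of_set S3) W" "E \<subseteq> W" "k0 \<in> S3" "k0 \<notin> W" "compact E"
    "continuous_on W r" "r ` W \<subseteq> E" "\<And>e. e \<in> E \<Longrightarrow> r e = e"
proof -
  obtain h h' V where V: "V \<subseteq> S3" and h: "homeomorphism (S1 \<times> (UNIV :: complex set)) V h h'"
    and E: "E = S3 - h ` (S1 \<times> ball 0 1)"
    using assms by (auto simp: is_exterior_def open_tubular_neighborhood_def)
  have cont: "continuous_on (S1 \<times> UNIV) h" and cont': "continuous_on V h'"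
    and im: "h ` (S1 \<times> UNIV) = V" and hh': "\<And>v. v \<in> V \<Longrightarrow> h (h' v) = v" "\<And>p. p \<in> S1 \<times> UNIV \<Longrightarrow> h' (h p) = p"
    and im': "h' ` V = S1 \<times> UNIV"
    using h by (auto simp: homeomorphism_def)
  have h_S3: "h (s, z) \<in> S3" if "s \<in> S1" for s z
  proof -
    have "h (s, z) \<in> V" unfolding im[symmetric] using that by (intro imageI) simp
    then show ?thesis using V by (rule subsetD[rotated])
  qed
  have compact_h: "compact (h ` (S1 \<times> cball 0 \<rho>))" for \<rho> :: real
    by (intro compact_continuous_image continuous_on_subset[OF cont] compact_Times) auto
  have closedE: "closed E"
    unfolding E using openin_tube[OF V h] by (metis closedin_closed_eq closedin_diff closedin_topspace closed_sphere openin_closedin_eq topspace_euclidean_subtopology closedin_closed_trans)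
  then have compactE: "compact E" using compact_Int_closed[of S3 E] E by (simp add: Int_absorb1)
  define W where "W = S3 - h ` (S1 \<times> cball 0 (1/2))"
  define Cl where "Cl = W \<inter> h ` (S1 \<times> cball 0 1)"
  have W: "openin (top_of_set S3) W"
    unfolding W_def using compact_imp_closed[OF compact_h[of "1/2"]] V im
    by (intro openin_diff) (auto simp: closedin_closed_eq)
  have EW: "E \<subseteq> W" by (force simp: E W_def)
  have WE: "W = E \<union> Cl"
    using EW by (auto simp: Cl_def E W_def)
  define push where "push p = (fst p, snd p / complex_of_real (norm (snd p)))" for p :: "complex \<times> complex"
  define r where "r e = (if e \<in> E then e else h (push (h' e)))" for e
  have Cl_coord: "\<exists>s z. s \<in> S1 \<and> 1/2 < norm z \<and> norm z \<le> 1 \<and> e = h (s, z) \<and> h' e = (s, z)" if eC: "e \<in> Cl" for e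
  proof -
    obtain s z where sz: "s \<in> S1" "norm z \<le> 1" "e = h (s, z)" using eC by (auto simp: Cl_def)
    have "\<not> norm z \<le> 1/2" using eC sz by (auto simp: Cl_def W_def)
    then show ?thesis using sz hh'(2)[of "(s, z)"] by (intro exI[of _ s] exI[of _ z]) auto
  qed
  have Cl_V: "Cl \<subseteq> V" using im by (auto simp: Cl_def)
  \<comment> \<open>On the overlap the normal coordinate has norm 1, so pushing does nothing and the
    two closed pieces glue.\<close>
  have boundary: "h (push (h' e)) = e" if e1: "e \<in> Cl" and e2: "e \<in> E" for e
  proof -
    obtain s z where sz: "s \<in> S1" "norm z \<le> 1" "e = h (s, z)" "h' e = (s, z)" using Cl_coord[OF e1] by (elim exE conjE) (rule that)
    have "\<not> norm z < 1"
    proof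
      assume "norm z < 1"
      then have "(s, z) \<in> S1 \<times> ball 0 1" using sz(1) by simp
      then have "e \<in> h ` (S1 \<times> ball 0 1)" unfolding sz(3) by (rule imageI)
      then show False using e2 by (simp add: E)
    qed
    then have "norm z = 1" using sz(2) by simp
    then have "push (h' e) = (s, z)" unfolding sz(4) push_def by simp
    then have "h (push (h' e)) = h (s, z)" by (rule arg_cong)
    also have "\<dots> = e" by (rule sz(3)[symmetric])
    finally show ?thesis .
  qed
  have "continuous_on (E \<union> Cl) (\<lambda>e. if e \<in> E then e else h (push (h' e)))"
  proof (rule continuous_on_cases_local[where P = "\<lambda>e. e \<in> E" and f = "\<lambda>e. e" and g = "\<lambda>e. h (push (h' e))"])
    show "closedin (top_of_set (E \<union> Cl)) E"
      using closedE by (intro closed_subset) auto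
    show "closedin (top_of_set (E \<union> Cl)) Cl"
    proof -
      have "closedin (top_of_set W) Cl"
        unfolding Cl_def by (rule closedin_closed_Int[OF compact_imp_closed[OF compact_h]])
      then show ?thesis by (simp only: WE)
    qed
    show "continuous_on Cl (\<lambda>e. h (push (h' e)))"
    proof (rule continuous_on_compose2[OF cont])
      have c: "continuous_on Cl h'" using cont' Cl_V by (rule continuous_on_subset)
      have nz: "norm (snd (h' e)) \<noteq> 0" if "e \<in> Cl" for e using Cl_coord[OF that] by force
      show "continuous_on Cl (\<lambda>e. push (h' e))"
        unfolding push_def using c nz by (auto intro!: continuous_intros)
      show "(\<lambda>e. push (h' e)) ` Cl \<subseteq> S1 \<times> UNIV"
      proof (rule image_subsetI)
        fix e assume "e \<in> Cl"
        from Cl_coord[OF this] obtain s z where "s \<in> S1" "h' e = (s, z)" by (elim exE conjE) (rule that)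
        then show "push (h' e) \<in> S1 \<times> UNIV" by (simp add: push_def)
      qed
    qed
  qed (use boundary in auto)
  then have cont_r: "continuous_on W r" unfolding WE r_def .
  have r_in: "r e \<in> E" if "e \<in> W" for e
  proof (cases "e \<in> E")
    case False
    then have "e \<in> Cl" using that WE by auto
    from Cl_coord[OF this] obtain s z where sz: "s \<in> S1" "1/2 < norm z" "h' e = (s, z)"
      by (elim exE conjE) (rule that)
    have "push (h' e) = (s, z / norm z)" by (simp add: push_def sz)
    moreover have n: "norm (z / complex_of_real (norm z)) = 1" using sz(2) by (auto simp: norm_divide)
    have "h (s, z / norm z) \<notin> h ` (S1 \<times> ball 0 1)"
    proof
      assume "h (s, z / norm z) \<in> h ` (S1 \<times> ball 0 1)"
      then obtain p where p: "p \<in> S1 \<times> ball 0 1" "h (s, z / norm z) = h p" by auto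
      then have "(s, z / complex_of_real (norm z)) = p" using hh'(2)[of "(s, z / norm z)"] hh'(2)[of p] sz(1) by auto
      then show False using p(1) n by auto
    qed
    moreover have "h (s, z / norm z) \<in> S3" using sz(1) by (rule h_S3)
    ultimately show ?thesis using False by (simp add: r_def E)
  qed (simp add: r_def)
  show ?thesis
  proof (rule that[OF W EW _ _ compactE cont_r])
    show "h (1, 0) \<in> S3" by (rule h_S3) simp
    show "h (1, 0) \<notin> W" by (auto simp: W_def)
    show "r ` W \<subseteq> E" using r_in by auto
  qed (simp add: r_def)
qed

text \<open>Stereographic projection from a point outside \<open>W\<close> makes \<open>W\<close> an
  open subset of R^3, and a translation puts the base point at the origin.\<close>

lemma exterior_model_exists:
  assumes "is_exterior E K" "x \<in> E"
  obtains \<sigma> \<rho> U where "exterior_model E x \<sigma> \<rho> U" "open U" "compact E"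
proof -
  obtain W r k0 where W: "openin (top_of_set S3) W" "E \<subseteq> W" "k0 \<in> S3" "k0 \<notin> W" "compact E"
    "continuous_on W r" "r ` W \<subseteq> E" "\<And>e. e \<in> E \<Longrightarrow> r e = e"
    using exterior_retract[OF assms(1)] by metis
  have "(S3 - {k0}) homeomorphic (UNIV :: (real^3) set)"
    using W(3) by (intro homeomorphic_punctured_sphere_affine) auto
  then obtain st st' where st: "homeomorphism (S3 - {k0}) (UNIV :: (real^3) set) st st'"
    by (auto simp: homeomorphic_def)
  have WS: "W \<subseteq> S3 - {k0}" using W(1,4) openin_imp_subset by fastforce
  have "openin (top_of_set (S3 - {k0})) W"
    using W(1) WS by (rule openin_subset_trans) auto
  then have open_st: "open (st ` W)" using homeomorphism_imp_open_map[OF st] by simp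
  have cst: "continuous_on (S3 - {k0}) st" "continuous_on UNIV st'" and st'_st: "\<And>e. e \<in> W \<Longrightarrow> st' (st e) = e"
    using st WS by (auto simp: homeomorphism_def)
  define U where "U = (\<lambda>z. z - st x) ` st ` W"
  have openU: "open U" unfolding U_def using open_translation_subtract[OF open_st] by (simp add: image_def)
  have U_st: "z \<in> U \<Longrightarrow> st' (z + st x) \<in> W" for z using st'_st by (auto simp: U_def)
  have "exterior_model E x (\<lambda>e. st e - st x) (\<lambda>z. r (st' (z + st x))) U"
  proof
    show "x \<in> E" by fact
    show "continuous_on U (\<lambda>z. r (st' (z + st x)))"
      using U_st by (intro continuous_on_compose2[OF W(6)] continuous_on_compose2[OF cst(2)] continuous_intros) auto
    show "r (st' (z + st x)) \<in> E" if "z \<in> U" for z using U_st[OF that] W(7) by auto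
    show "continuous_on E (\<lambda>e. st e - st x)"
      using W(2) WS by (intro continuous_intros continuous_on_subset[OF cst(1)]) auto
    show "st e - st x \<in> U" if "e \<in> E" for e using that W(2) by (auto simp: U_def)
    show "r (st' (st e - st x + st x)) = e" if "e \<in> E" for e using that W(2,8) st'_st[of e] by auto
    show "st x - st x = 0" by simp
  qed
  then show ?thesis using openU W(5) by (rule that)
qed

text \<open>Continuity gives a radius at each point of M; a Lebesgue number of the resulting cover
  makes it uniform.\<close>

lemma near_identity_on_compact:
  fixes f :: "'a::metric_space \<Rightarrow> 'a"
  assumes M: "compact M" and U: "open U" "M \<subseteq> U" and f: "continuous_on U f" "\<And>e. e \<in> M \<Longrightarrow> f e = e"
    and "\<epsilon> > 0"
  shows "\<exists>\<delta>>0. \<forall>e\<in>M. \<forall>z. dist z e < \<delta> \<longrightarrow> z \<in> U \<and> dist z (f z) < \<epsilon>"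
proof -
  have "\<exists>d>0. \<forall>z. dist z e < d \<longrightarrow> z \<in> U \<and> dist z (f z) < \<epsilon>" if e: "e \<in> M" for e
  proof -
    obtain d1 where d1: "d1 > 0" "ball e d1 \<subseteq> U" using U e open_contains_ball by blast
    have "continuous (at e) f"
      using f(1) U e continuous_on_eq_continuous_at by blast
    then obtain d2 where d2: "d2 > 0" "\<And>z. dist z e < d2 \<Longrightarrow> dist (f z) (f e) < \<epsilon> / 2"
      using \<open>\<epsilon> > 0\<close> unfolding continuous_at_eps_delta by (metis half_gt_zero)
    show ?thesis
    proof (intro exI[of _ "min d1 (min d2 (\<epsilon> / 2))"] conjI allI impI)
      fix z assume z: "dist z e < min d1 (min d2 (\<epsilon> / 2))"
      then show "z \<in> U" using d1(2) by (auto simp: dist_commute)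
      have "dist (f z) e < \<epsilon> / 2" using d2(2)[of z] z f(2)[OF e] by simp
      then show "dist z (f z) < \<epsilon>" using z dist_triangle2[of z "f z" e] by simp
    qed (use d1 d2 \<open>\<epsilon> > 0\<close> in auto)
  qed
  then obtain d where d: "\<And>e. e \<in> M \<Longrightarrow> d e > 0"
    "\<And>e z. e \<in> M \<Longrightarrow> dist z e < d e \<Longrightarrow> z \<in> U \<and> dist z (f z) < \<epsilon>" by metis
  have "M \<subseteq> \<Union> ((\<lambda>e. ball e (d e)) ` M)" using d(1) by force
  then obtain \<delta> where \<delta>: "\<delta> > 0" "\<And>e. e \<in> M \<Longrightarrow> \<exists>B \<in> (\<lambda>e. ball e (d e)) ` M. ball e \<delta> \<subseteq> B"
    using Heine_Borel_lemma[OF M] by (metis (no_types, lifting) imageE open_ball)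
  show ?thesis
  proof (intro exI[of _ \<delta>] conjI ballI allI impI)
    fix e z assume e: "e \<in> M" "dist z e < \<delta>"
    obtain e' where e': "e' \<in> M" "ball e \<delta> \<subseteq> ball e' (d e')" using \<delta>(2)[OF e(1)] by auto
    then have "dist z e' < d e'" using e(2) by (auto simp: dist_commute subset_iff)
    then show "z \<in> U" "dist z (f z) < \<epsilon>" using d(2)[OF e'(1)] by auto
  qed (rule \<delta>(1))
qed

section \<open>Nested neighbourhoods and the choice of scale\<close>

context exterior_model
begin

text \<open>The model is enlarged instead of the lattice being refined, so the mesh stays 1.\<close>

lemma exterior_model_scale:
  assumes "s > 0"
  shows "exterior_model E x (\<lambda>e. s *\<^sub>R \<sigma> e) (\<lambda>z. \<rho> (inverse s *\<^sub>R z)) {z. inverse s *\<^sub>R z \<in> U}"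
proof
  show "continuous_on {z. inverse s *\<^sub>R z \<in> U} (\<lambda>z. \<rho> (inverse s *\<^sub>R z))"
    by (intro continuous_on_compose2[OF cont_\<rho>] continuous_intros) auto
qed (use assms x \<rho>_in \<sigma>_in \<rho>_\<sigma> \<sigma>_x in \<open>auto intro!: continuous_intros cont_\<sigma>\<close>)

text \<open>The number d bounds the displacement of \<sigma> \<circ> \<rho>. Radii and displacements
  grow with the scale of the model while the lattice constants do not.\<close>

definition controlled :: "real \<Rightarrow> real \<Rightarrow> bool" where
  "controlled r d \<longleftrightarrow> (\<forall>e\<in>E. \<forall>z. dist z (\<sigma> e) < r \<longrightarrow> z \<in> U \<and> dist z (\<sigma> (\<rho> z)) < d)"

definition lattice_near :: "real \<Rightarrow> (int^3) set" where
  "lattice_near r = {q. \<exists>e\<in>E. dist (real_vec q) (\<sigma> e) < r}"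

lemma thick_lattice_near:
  assumes "controlled (r + 5) d"
  shows "thick (lattice_near r)"
  unfolding thick_def
proof (intro ballI subsetI)
  fix q z assume "q \<in> lattice_near r" and z: "z \<in> cball (real_vec q) 4"
  then obtain e where e: "e \<in> E" "dist (real_vec q) (\<sigma> e) < r" by (auto simp: lattice_near_def)
  have "dist z (\<sigma> e) < r + 5" using e(2) z dist_triangle[of z "\<sigma> e" "real_vec q"] by (simp add: dist_commute)
  then show "z \<in> U" using assms e(1) by (auto simp: controlled_def)
qed

lemma pushable_lattice_near:
  assumes "controlled (r + 2) d" "r + d + 10 \<le> R"
  shows "pushable (lattice_near r) (lattice_near R)"
  unfolding pushable_def
proof (intro ballI conjI allI impI)
  fix q z assume "q \<in> lattice_near r" and z: "z \<in> cball (real_vec q) 1"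
  then obtain e where e: "e \<in> E" "dist (real_vec q) (\<sigma> e) < r" by (auto simp: lattice_near_def)
  have ze: "dist z (\<sigma> e) < r + 1" using e(2) z dist_triangle[of z "\<sigma> e" "real_vec q"] by (simp add: dist_commute)
  then have U: "z \<in> U" "dist z (\<sigma> (\<rho> z)) < d" using assms(1) e(1) by (auto simp: controlled_def)
  then show "z \<in> U" by simp
  fix w b assume w: "w \<in> closed_segment z (\<sigma> (\<rho> z))" and b: "dist (real_vec b) w \<le> 6"
  have "dist w z \<le> dist z (\<sigma> (\<rho> z))" using dist_in_closed_segment[OF w] by (simp add: dist_commute)
  then have "dist (real_vec b) (\<sigma> e) < R"
    \<comment> \<open>The distances sum to less than 6 + d + (r + 1).\<close>
    using b ze U(2) assms(2) dist_triangle[of "real_vec b" "\<sigma> e" w] dist_triangle[of w "\<sigma> e" z] by linarith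
  then show "b \<in> lattice_near R" using e(1) by (auto simp: lattice_near_def)
qed

lemma collar_lattice_near: "R > 6 \<Longrightarrow> collar (lattice_near R)"
  by (force simp: collar_def lattice_near_def)

lemma controlled_mono: "controlled r' d \<Longrightarrow> r \<le> r' \<Longrightarrow> controlled r d"
  unfolding controlled_def by (meson less_le_trans)

lemma controlled_pos:
  assumes "controlled r d" "r > 0"
  shows "d > 0"
proof -
  have "dist (\<sigma> x) (\<sigma> (\<rho> (\<sigma> x))) < d"
    using assms x unfolding controlled_def by (metis dist_self)
  then show ?thesis using zero_le_dist le_less_trans by blast
qed

text \<open>The radii r0, R0, r1, R1 give the four regions. From r to R the push needs its
  displacement and a lattice constant; from R0 to r1 there is only the margin of 2 per coordinate,
  of length at most 6.\<close>

lemma no_distorted_subgroup_aux: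
  assumes r0: "r0 > 6" "controlled (r0 + 5) d0" "r0 + d0 + 10 \<le> R0"
    and r1: "R0 + 10 \<le> r1" "controlled (r1 + 5) d1" "r1 + d1 + 10 \<le> R1"
    and U: "controlled (R1 + 10) d"
  shows "\<not> distorted_subgroup G H \<kappa> v \<mu> t y m n"
proof
  assume distorted: "distorted_subgroup G H \<kappa> v \<mu> t y m n"
  have "d0 > 0" using controlled_pos[OF r0(2)] r0(1) by simp
  then have R0: "R0 > 6" "r0 \<le> R0" "R0 \<le> r1" using r0 r1 by linarith+
  have "d1 > 0" using controlled_pos[OF r1(2)] R0 by simp
  then have R1: "R1 > 6" "r1 \<le> R1" using r1 R0 by linarith+
  have thick: "thick (lattice_near r)" if "r \<le> R1" for r
    using thick_lattice_near[OF controlled_mono[OF U, of "r + 5"]] that by simp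
  have sub: "lattice_near r \<subseteq> lattice_near r'" if "r \<le> r'" for r r'
    using that unfolding lattice_near_def by (auto intro: less_le_trans)
  have near: "q' \<in> lattice_near r1"
    if q: "q \<in> lattice_near R0" and qq: "\<And>i. \<bar>q' $ i - q $ i\<bar> \<le> 2" for q q' :: "int^3"
  proof -
    obtain e where e: "e \<in> E" "dist (real_vec q) (\<sigma> e) < R0" using q by (auto simp: lattice_near_def)
    have "\<bar>(real_vec q' - real_vec q) $ i\<bar> \<le> 2" for i
      using qq[of i] by (simp flip: of_int_diff of_int_abs)
    then have "dist (real_vec q') (real_vec q) \<le> 3 * 2" by (rule dist_le_sum_components)
    then have "dist (real_vec q') (\<sigma> e) < r1"
      using e(2) r1(1) dist_triangle[of "real_vec q'" "\<sigma> e" "real_vec q"] by simp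
    then show ?thesis using e(1) by (auto simp: lattice_near_def)
  qed
  have "full_holonomy (lattice_near r0)"
  proof (rule full_holonomy_thick)
    show "cball (\<sigma> e) 8 \<subseteq> U" if "e \<in> E" for e
    proof
      fix z assume "z \<in> cball (\<sigma> e) 8"
      then have "dist z (\<sigma> e) < R1 + 10" using R1(1) by (simp add: dist_commute)
      then show "z \<in> U" using U that by (auto simp: controlled_def)
    qed
    show "b \<in> lattice_near r0" if "e \<in> E" "dist (real_vec b) (\<sigma> e) \<le> 6" for e b
      using that r0(1) by (force simp: lattice_near_def)
    show "thick (lattice_near r0)" using R0 R1 by (intro thick) simp
  qed
  moreover have "bounding (lattice_near r0) (lattice_near R0)"
    using R0 R1 controlled_mono[OF r0(2), of "r0 + 2"] r0(3)
    by (intro bounding_pushable thick pushable_lattice_near collar_lattice_near) auto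
  moreover have "bounding (lattice_near r1) (lattice_near R1)"
    using R0 R1 controlled_mono[OF r1(2), of "r1 + 2"] r1(3)
    by (intro bounding_pushable thick pushable_lattice_near collar_lattice_near) auto
  ultimately have "distorted_lattice_cover_axioms G label (lattice_near r0) (lattice_near R0) (lattice_near r1) (lattice_near R1)"
    using R0 R1 near by (intro distorted_lattice_cover_axioms.intro flat_on_thick thick sub) auto
  then have "distorted_lattice_cover G label H \<kappa> v \<mu> t y m n
      (lattice_near r0) (lattice_near R0) (lattice_near r1) (lattice_near R1)"
    by (intro distorted_lattice_cover.intro[OF lattice_cover_axioms distorted])
  then show False by (rule distorted_lattice_cover.contradiction)
qed

text \<open>The sizes are fixed from outside inwards: the displacement near the inner region must be
  small compared with the next region, so b1 depends on a1, and b0 on a0 = b1 / 4. The scale s comes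
  last and makes the smallest radius 100, large against all lattice constants.\<close>

lemma no_distorted_subgroup:
  assumes "open U" "compact E"
  shows "\<not> distorted_subgroup G H \<kappa> v \<mu> t y m n"
proof -
  have M: "compact (\<sigma> ` E)" using cont_\<sigma> assms(2) by (rule compact_continuous_image)
  have ex: "\<exists>\<delta>>0. controlled \<delta> \<epsilon>" if "\<epsilon> > 0" for \<epsilon>
  proof -
    have "continuous_on U (\<lambda>z. \<sigma> (\<rho> z))"
      using \<rho>_in by (intro continuous_on_compose2[OF cont_\<sigma> cont_\<rho>]) auto
    then have "\<exists>\<delta>>0. \<forall>e\<in>\<sigma> ` E. \<forall>z. dist z e < \<delta> \<longrightarrow> z \<in> U \<and> dist z (\<sigma> (\<rho> z)) < \<epsilon>"
      using \<sigma>_in \<rho>_\<sigma> that by (intro near_identity_on_compact[OF M assms(1)]) auto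
    then show ?thesis by (simp add: controlled_def)
  qed
  obtain a1 where a1: "a1 > 0" "controlled a1 1" using ex[of 1] by auto
  obtain b1' where b1': "b1' > 0" "controlled b1' (a1 / 4)" using ex[of "a1 / 4"] a1(1) by auto
  define b1 where "b1 = min b1' (a1 / 4)"
  have b1: "b1 > 0" "b1 \<le> a1 / 4" "controlled b1 (a1 / 4)"
    using a1(1) b1' controlled_mono[OF b1'(2)] by (auto simp: b1_def)
  define a0 where "a0 = b1 / 4"
  obtain b0' where b0': "b0' > 0" "controlled b0' (a0 / 4)" using ex[of "a0 / 4"] b1(1) by (auto simp: a0_def)
  define b0 where "b0 = min b0' (a0 / 4)"
  have b0: "b0 > 0" "b0 \<le> a0 / 4" "controlled b0 (a0 / 4)"
    using b1(1) b0' controlled_mono[OF b0'(2)] by (auto simp: b0_def a0_def)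
  define s where "s = 100 / b0"
  have s: "s > 0" "s * b0 = 100" using b0(1) by (simp_all add: s_def)
  interpret S: exterior_model E x "\<lambda>e. s *\<^sub>R \<sigma> e" "\<lambda>z. \<rho> (inverse s *\<^sub>R z)" "{z. inverse s *\<^sub>R z \<in> U}"
    using s(1) by (rule exterior_model_scale)
  have scale: "S.controlled (s * r) (s * d)" if "controlled r d" for r d
    unfolding S.controlled_def
  proof (intro ballI allI impI)
    fix e z assume e: "e \<in> E" "dist z (s *\<^sub>R \<sigma> e) < s * r"
    define w where "w = inverse s *\<^sub>R z"
    have z: "z = s *\<^sub>R w" using s(1) by (simp add: w_def)
    have dist: "dist (s *\<^sub>R u) (s *\<^sub>R v) = s * dist u v" for u v :: "real^3"
      using s(1) by (simp add: dist_norm flip: scaleR_diff_right)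
    have "dist w (\<sigma> e) < r" using e(2) s(1) by (simp add: z dist)
    then have "w \<in> U \<and> dist w (\<sigma> (\<rho> w)) < d" using that e(1) by (auto simp: controlled_def)
    then show "z \<in> {z. inverse s *\<^sub>R z \<in> U} \<and> dist z (s *\<^sub>R \<sigma> (\<rho> (inverse s *\<^sub>R z))) < s * d"
      using s(1) by (simp add: z dist)
  qed
  have sizes: "s * a0 \<ge> 400" "s * b1 = 4 * (s * a0)" "s * a1 \<ge> 4 * (s * b1)"
    using s b0(2) b1(2) mult_left_mono[OF b0(2), of s] mult_left_mono[OF b1(2), of s] by (simp_all add: a0_def)
  show ?thesis
  proof (rule S.no_distorted_subgroup_aux)
    show "(6::real) < 50" by simp
    show "S.controlled (50 + 5) (s * (a0 / 4))"
      using S.controlled_mono[OF scale[OF b0(3)]] s(2) by simp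
    show "50 + s * (a0 / 4) + 10 \<le> s * a0" using sizes(1) by simp
    show "s * a0 + 10 \<le> s * b1 / 2" using sizes by linarith
    show "S.controlled (s * b1 / 2 + 5) (s * (a1 / 4))"
      by (rule S.controlled_mono[OF scale[OF b1(3)]]) (use sizes in linarith)
    show "s * b1 / 2 + s * (a1 / 4) + 10 \<le> s * a1 / 2" unfolding times_divide_eq_right using sizes by linarith
    show "S.controlled (s * a1 / 2 + 10) (s * 1)"
      by (rule S.controlled_mono[OF scale[OF a1(2)]]) (use sizes in linarith)
  qed
qed

end

theorem theorem1p4:
  fixes K E :: "(real ^ 4) set" and x :: "real ^ 4"
  assumes "knot K"
    and "is_exterior E K"
    and "x \<in> E"
  shows "R_group (fundamental_group E x) \<longleftrightarrow> Rbar_group (fundamental_group E x)"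
proof
  interpret group "fundamental_group E x"
    using assms(3) by (rule group_fundamental_group)
  show "R_group (fundamental_group E x)" if "Rbar_group (fundamental_group E x)"
    using that by (rule Rbar_imp_R)
  show "Rbar_group (fundamental_group E x)" if R: "R_group (fundamental_group E x)"
  proof (rule ccontr)
    assume "\<not> Rbar_group (fundamental_group E x)"
    then obtain t y m n where "R_group_with_distortion (fundamental_group E x) t y m n"
      using R R_group_distortion by blast
    then interpret D: R_group_with_distortion "fundamental_group E x" t y m n .
    obtain \<sigma> \<rho> U where model: "exterior_model E x \<sigma> \<rho> U" "open U" "compact E"
      using exterior_model_exists[OF assms(2,3)] .
    show False
      using exterior_model.no_distorted_subgroup[OF model] D.distorted_subgroup_axioms by blast
  qed
qed

end
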